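(* Let $A=\bigoplus_{i,j\in\{1,2,3,4\}}A_{i,j}$, where $$\begin{bmatrix}A_{1,1}&A_{1,2}&A_{1,3}&A_{1,4}\\ A_{2,1}&A_{2,2}&A_{2,3}&A_{2,4}\\ A_{3,1}&A_{3,2}&A_{3,3}&A_{3,4}\\ A_{4,1}&A_{4,2}&A_{4,3}&A_{4,4}\end{bmatrix}=\begin{bmatrix}\mathbb Q^{3\times3}&0&0&\mathbb Q^{3\times1}\\ 0&\mathbb Q&0&\mathbb Q\\ 0&0&\mathbb Q&0\\ \mathbb Q^{1\times3}&\mathbb Q&0&\mathbb Q[\bar\eta,\bar\xi]\end{bmatrix},$$ with elements written as arrays $[a_{i,j}]_{i,j}$, $a_{i,j}\in A_{i,j}$, and with multiplication $$[a_{i,j}]_{i,j}\cdot[a'_{s,t}]_{s,t}=\Big[\sum_{r\in\{1,2,3,4\}}\alpha_{i,r,j}(a_{i,r},a'_{r,j})\Big]_{i,j},$$ where the $\mathbb Q$-bilinear maps $\alpha_{i,j,k}$ are those given in the context. Then, with the $\mathbb Q$-linear maps $\gamma_{i,j}$ given in the context, the map $$\gamma:A\to\mathrm{B}_{\mathbb Q}(S_3,S_3),\qquad [a_{i,j}]_{i,j}\mapsto\sum_{i,j\in\{1,2,3,4\}}\gamma_{i,j}(a_{i,j})$$ is an isomorphism of $\mathbb Q$-algebras.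
   Context: **Double Burnside algebra.** Let $G$ be a finite group and $R$ a commutative ring. A $(G,G)$-biset is a finite set with commuting left and right $G$-actions. For $(G,G)$-bisets $M,N$, the tensor product $M\times_G N$ is the set of $G$-orbits on $M\times N$ under $g(m,n)=(mg^{-1},gn)$, with the biset structure induced by $h(m,n)p=(hm,np)$. The double Burnside algebra $\mathrm{B}_R(G,G)$ is the $R$-module generated by the isomorphism classes $[M]$ of finite $(G,G)$-bisets modulo the relations $[M\sqcup N]=[M]+[N]$, with multiplication induced by $[M]\cdot[N]=[M\times_G N]$; its unit is $[G]$. A left $(G\times G)$-set $Y$ is regarded as a $(G,G)$-biset via $h\cdot y\cdot g=(h,g^{-1})y$. **Basis.** In $S_3$ let $a=(1,2)$, $b=(1,2,3)$, $V_0=\{\mathrm{id}\}$, $V_1=\langle a\rangle$, $V_4=\langle b\rangle$, $V_5=S_3$. Put $H_{i,j}=[(S_3\times S_3)/(V_i\times V_j)]$ for $i,j\in\{0,1,4,5\}$; $H^\Delta_t=[(S_3\times S_3)/\{(x,x):x\in V_t\}]$ for $t\in\{1,4,5\}$; and $H_6,H_7,H_8$ the classes of $(S_3\times S_3)/U_s$ with $U_6=\langle(a,a),(1,b)\rangle$, $U_7=\langle(a,a),(b,1)\rangle$, $U_8=\langle(a,a),(b,1),(1,b)\rangle$ respectively. These $22$ elements form a $\mathbb Q$-basis of $\mathrm{B}_{\mathbb Q}(S_3,S_3)$. **Elements of $\mathrm{B}_{\mathbb Q}(S_3,S_3)$.** For $x=(x_0,x_1,x_4,x_5)$, $y=(y_0,y_1,y_4,y_5)\in\mathbb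 Q^4$ put $T(x,y)=\sum_{i,j\in\{0,1,4,5\}}x_iy_jH_{i,j}$. Let $l_e=(-\tfrac12,1,\tfrac12,0)$, $l_g=(-\tfrac43,2,1,0)$, $l_h=(-\tfrac13,0,1,0)$, $l_4=(\tfrac16,-\tfrac13,-\tfrac16,\tfrac13)$, $f_e=(1,0,0,0)$, $f_g=(-1,1,0,0)$, $f_h=(\tfrac14,-1,\tfrac34,0)$, $f_4=(\tfrac14,-\tfrac12,-\tfrac14,\tfrac12)$. Put $e=T(l_e,f_e)$, $g=T(l_g,f_g)$, $h=T(l_h,f_h)$; $b_{p,q}=T(l_p,f_q)$ for $p\neq q$ in $\{e,g,h\}$; $b_{p,\varepsilon_4}=T(l_p,f_4)$ and $b_{\varepsilon_4,p}=T(l_4,f_p)$ for $p\in\{e,g,h\}$; $b'_{\varepsilon_4,\varepsilon_4}=T(l_4,f_4)$. Further put $\varepsilon_2=-H_{0,0}+H_{1,0}+H_{0,1}+H^\Delta_1-2H_{1,1}$, $\varepsilon_3=-\tfrac14H_{0,0}+\tfrac14H_{4,0}+\tfrac14H_{0,4}+\tfrac12H^\Delta_4-\tfrac34H_{4,4}$, $\varepsilon_4=\tfrac12H_{0,0}-H^\Delta_1-\tfrac12H^\Delta_4+H^\Delta_5$, $b_{\varepsilon_2,\varepsilon_4}=-\tfrac12H_{0,0}+\tfrac12H_{1,0}+\tfrac12H_{0,1}+\tfrac12H^\Delta_1+\tfrac12H_{0,4}-H_{1,1}-\tfrac12H_{0,5}-\tfrac12H_6-\tfrac12H_{1,4}+H_{1,5}$,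 $b_{\varepsilon_4,\varepsilon_2}=-\tfrac12H_{0,0}+\tfrac12H_{1,0}+\tfrac12H_{0,1}+\tfrac12H^\Delta_1+\tfrac12H_{4,0}-H_{1,1}-\tfrac12H_{5,0}-\tfrac12H_{4,1}-\tfrac12H_7+H_{5,1}$, $b''_{\varepsilon_4,\varepsilon_4}=\tfrac14H_{0,0}-\tfrac34H_{1,0}-\tfrac34H_{0,1}+\tfrac14H^\Delta_1-\tfrac14H_{4,0}-\tfrac14H_{0,4}+\tfrac32H_{1,1}+\tfrac34H_{5,0}+\tfrac34H_{0,5}-\tfrac14H_6+\tfrac34H_{4,1}+\tfrac34H_{1,4}-\tfrac14H_7+\tfrac14H_{4,4}-\tfrac32H_{1,5}-\tfrac32H_{5,1}-\tfrac34H_{4,5}-\tfrac34H_{5,4}+\tfrac14H_8+\tfrac32H_{5,5}$. **The maps $\alpha_{i,j,k}$.** $\mathbb Q[\bar\eta,\bar\xi]=\mathbb Q[\eta,\xi]/(\eta^2,\eta\xi,\xi^2)$, with $\mathbb Q$-basis $1,\bar\eta,\bar\xi$. The bilinear maps $\alpha_{i,j,k}:A_{i,j}\times A_{j,k}\to A_{i,k}$ are: zero whenever one of $A_{i,j},A_{j,k},A_{i,k}$ is zero; $\alpha_{1,4,1}=0$, $\alpha_{2,4,2}=0$; $\alpha_{4,1,4}(x,y)=(xy)\bar\eta$ (row times column); $\alpha_{4,2,4}(x,y)=xy(\bar\xi-12\bar\eta)$; $\alpha_{4,4,4}$ is multiplication in $\mathbb Q[\bar\eta,\bar\xi]$; in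 $\alpha_{1,4,4},\alpha_{2,4,4},\alpha_{4,4,1},\alpha_{4,4,2}$ an element $a+b\bar\eta+c\bar\xi\in A_{4,4}$ acts as multiplication by its constant term $a$; and $\alpha_{1,1,1},\alpha_{1,1,4},\alpha_{4,1,1},\alpha_{2,2,2},\alpha_{2,2,4},\alpha_{4,2,2},\alpha_{3,3,3}$ are the usual (matrix) products. **The maps $\gamma_{i,j}:A_{i,j}\to\mathrm{B}_{\mathbb Q}(S_3,S_3)$.** $\gamma_{1,1}((r_{i,j}))=r_{1,1}e+r_{1,2}b_{e,g}+r_{1,3}b_{e,h}+r_{2,1}b_{g,e}+r_{2,2}g+r_{2,3}b_{g,h}+r_{3,1}b_{h,e}+r_{3,2}b_{h,g}+r_{3,3}h$; $\gamma_{1,4}((u_1,u_2,u_3)^{t})=u_1b_{e,\varepsilon_4}+u_2b_{g,\varepsilon_4}+u_3b_{h,\varepsilon_4}$; $\gamma_{2,2}(u)=u\varepsilon_2$; $\gamma_{2,4}(u)=u\,b_{\varepsilon_2,\varepsilon_4}$; $\gamma_{3,3}(u)=u\varepsilon_3$; $\gamma_{4,1}((v_1,v_2,v_3))=v_1b_{\varepsilon_4,e}+v_2b_{\varepsilon_4,g}+v_3b_{\varepsilon_4,h}$; $\gamma_{4,2}(u)=u\,b_{\varepsilon_4,\varepsilon_2}$; $\gamma_{4,4}(a+b\bar\eta+c\bar\xi)=a\varepsilon_4+b\,b'_{\varepsilon_4,\varepsilon_4}+c\,b''_{\varepsilon_4,\varepsilon_4}$; all other $\gamma_{i,j}$ are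 zero. *)

theory Defs
  imports
    "HOL-Algebra.Sym_Groups"
    "HOL-Algebra.Left_Coset"
    "HOL-Algebra.QuotRing"
    "HOL-Algebra.Module"
    "HOL-Algebra.Algebraic_Closure_Type"
    "HOL-Library.Poly_Mapping"
    "HOL-Computational_Algebra.Polynomial"
    "HOL-Analysis.Finite_Cartesian_Product"
begin

hide_const (open) Polynomial.smult
no_notation Formal_Power_Series.fps_nth (infixl \<open>$\<close> 75)

section \<open>Associative algebras over a commutative ring\<close>

text \<open>The library locale \<^locale>\<open>algebra\<close> requires the multiplication to be commutative,
  so it does not cover the algebras considered here.\<close>

locale assoc_algebra = module R M + ring M for R (structure) and M (structure) +
  assumes smult_mult_left:
      "\<lbrakk>a \<in> carrier R; x \<in> carrier M; y \<in> carrier M\<rbrakk> \<Longrightarrow>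
        (a \<odot>\<^bsub>M\<^esub> x) \<otimes>\<^bsub>M\<^esub> y = a \<odot>\<^bsub>M\<^esub> (x \<otimes>\<^bsub>M\<^esub> y)"
    and smult_mult_right:
      "\<lbrakk>a \<in> carrier R; x \<in> carrier M; y \<in> carrier M\<rbrakk> \<Longrightarrow>
        x \<otimes>\<^bsub>M\<^esub> (a \<odot>\<^bsub>M\<^esub> y) = a \<odot>\<^bsub>M\<^esub> (x \<otimes>\<^bsub>M\<^esub> y)"

definition algebra_iso ::
    "('r, 'k) ring_scheme \<Rightarrow> ('r, 'a, 'm) module_scheme \<Rightarrow> ('r, 'b, 'n) module_scheme \<Rightarrow> ('a \<Rightarrow> 'b) set"
  where "algebra_iso R M N =
    {f \<in> ring_iso M N. \<forall>a\<in>carrier R. \<forall>x\<in>carrier M. f (a \<odot>\<^bsub>M\<^esub> x) = a \<odot>\<^bsub>N\<^esub> f x}"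

abbreviation rat_ring :: "rat ring"
  where "rat_ring \<equiv> ring_of_type_algebra"

definition lincomb :: "('r, 'b, 'n) module_scheme \<Rightarrow> ('r \<times> 'b) list \<Rightarrow> 'b"
  where "lincomb M xs = foldr (\<lambda>(a, x) s. a \<odot>\<^bsub>M\<^esub> x \<oplus>\<^bsub>M\<^esub> s) xs \<zero>\<^bsub>M\<^esub>"


section \<open>Bisets\<close>

record ('g, 'x) biset =
  elems :: "'x set"
  lact :: "'g \<Rightarrow> 'x \<Rightarrow> 'x"
  ract :: "'x \<Rightarrow> 'g \<Rightarrow> 'x"

locale finite_biset = group G for G :: "('g, 'm) monoid_scheme" (structure) and M :: "('g, 'x) biset" +
  assumes finite_elems: "finite (elems M)"
    and lact_closed: "\<lbrakk>g \<in> carrier G; x \<in> elems M\<rbrakk> \<Longrightarrow> lact M g x \<in> elems M"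
    and ract_closed: "\<lbrakk>g \<in> carrier G; x \<in> elems M\<rbrakk> \<Longrightarrow> ract M x g \<in> elems M"
    and lact_one: "x \<in> elems M \<Longrightarrow> lact M \<one> x = x"
    and ract_one: "x \<in> elems M \<Longrightarrow> ract M x \<one> = x"
    and lact_mult: "\<lbrakk>g \<in> carrier G; h \<in> carrier G; x \<in> elems M\<rbrakk> \<Longrightarrow>
      lact M (g \<otimes> h) x = lact M g (lact M h x)"
    and ract_mult: "\<lbrakk>g \<in> carrier G; h \<in> carrier G; x \<in> elems M\<rbrakk> \<Longrightarrow>
      ract M x (g \<otimes> h) = ract M (ract M x g) h"
    and lact_ract: "\<lbrakk>g \<in> carrier G; h \<in> carrier G; x \<in> elems M\<rbrakk> \<Longrightarrow>
      ract M (lact M g x) h = lact M g (ract M x h)"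

definition biset_isomorphic ::
    "('g, 'm) monoid_scheme \<Rightarrow> ('g, 'x) biset \<Rightarrow> ('g, 'y) biset \<Rightarrow> bool"
  where "biset_isomorphic G M N \<longleftrightarrow>
    (\<exists>f. bij_betw f (elems M) (elems N) \<and>
      (\<forall>g\<in>carrier G. \<forall>x\<in>elems M. f (lact M g x) = lact N g (f x) \<and> f (ract M x g) = ract N (f x) g))"

text \<open>Every finite biset is isomorphic to one whose elements are natural numbers, so
  an isomorphism class (of a biset with elements of any type) is represented by the set of
  its members with elements in \<^typ>\<open>nat\<close>.\<close>

definition biset_class :: "('g, 'm) monoid_scheme \<Rightarrow> ('g, 'x) biset \<Rightarrow> ('g, nat) biset set"
  where "biset_class G M = {N. finite_biset G N \<and> biset_isomorphic G N M}"

definition biset_classes :: "('g, 'm) monoid_scheme \<Rightarrow> ('g, nat) biset set set"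
  where "biset_classes G = biset_class G ` {M :: ('g, nat) biset. finite_biset G M}"

definition biset_sum :: "('g, 'x) biset \<Rightarrow> ('g, 'y) biset \<Rightarrow> ('g, 'x + 'y) biset"
  where "biset_sum M N =
    \<lparr>elems = Sum_Type.Plus (elems M) (elems N),
     lact = (\<lambda>g. map_sum (lact M g) (lact N g)),
     ract = (\<lambda>z g. map_sum (\<lambda>x. ract M x g) (\<lambda>y. ract N y g) z)\<rparr>"

definition tensor_orbit ::
    "('g, 'm) monoid_scheme \<Rightarrow> ('g, 'x) biset \<Rightarrow> ('g, 'y) biset \<Rightarrow> 'x \<times> 'y \<Rightarrow> ('x \<times> 'y) set"
  where "tensor_orbit G M N = (\<lambda>(m, n). {(ract M m (inv\<^bsub>G\<^esub> g), lact N g n) |g. g \<in> carrier G})"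

text \<open>The actions on orbits are given by taking images: as the actions commute, the image of
  the orbit of \<open>(m, n)\<close> under \<open>(m, n) \<mapsto> (hm, np)\<close> is the orbit of \<open>(hm, np)\<close>.\<close>

definition biset_tensor ::
    "('g, 'm) monoid_scheme \<Rightarrow> ('g, 'x) biset \<Rightarrow> ('g, 'y) biset \<Rightarrow> ('g, ('x \<times> 'y) set) biset"
  where "biset_tensor G M N =
    \<lparr>elems = tensor_orbit G M N ` (elems M \<times> elems N),
     lact = (\<lambda>h. image (\<lambda>(m, n). (lact M h m, n))),
     ract = (\<lambda>z p. (\<lambda>(m, n). (m, ract N n p)) ` z)\<rparr>"

definition regular_biset :: "('g, 'm) monoid_scheme \<Rightarrow> ('g, 'g) biset"
  where "regular_biset G = \<lparr>elems = carrier G, lact = mult G, ract = mult G\<rparr>"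

definition biset_of_action ::
    "('g, 'm) monoid_scheme \<Rightarrow> 'y set \<Rightarrow> ('g \<times> 'g \<Rightarrow> 'y \<Rightarrow> 'y) \<Rightarrow> ('g, 'y) biset"
  where "biset_of_action G Y act =
    \<lparr>elems = Y,
     lact = (\<lambda>h y. act (h, \<one>\<^bsub>G\<^esub>) y),
     ract = (\<lambda>y g. act (\<one>\<^bsub>G\<^esub>, inv\<^bsub>G\<^esub> g) y)\<rparr>"

definition coset_biset :: "('g, 'm) monoid_scheme \<Rightarrow> ('g \<times> 'g) set \<Rightarrow> ('g, ('g \<times> 'g) set) biset"
  where "coset_biset G U =
    biset_of_action G (lcosets\<^bsub>G \<times>\<times> G\<^esub> U) (\<lambda>p C. p <#\<^bsub>G \<times>\<times> G\<^esub> C)"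


section \<open>The double Burnside algebra\<close>

definition class_mult ::
    "('g, 'm) monoid_scheme \<Rightarrow> ('g, nat) biset set \<Rightarrow> ('g, nat) biset set \<Rightarrow> ('g, nat) biset set"
  where "class_mult G c d = (\<Union>M\<in>c. \<Union>N\<in>d. biset_class G (biset_tensor G M N))"

definition free_burnside ::
    "('g, 'm) monoid_scheme \<Rightarrow> ('r::comm_ring_1, ('g, nat) biset set \<Rightarrow>\<^sub>0 'r) module"
  where "free_burnside G =
    \<lparr>carrier = {x. Poly_Mapping.keys x \<subseteq> biset_classes G},
     mult = (\<lambda>x y. \<Sum>c\<in>Poly_Mapping.keys x. \<Sum>d\<in>Poly_Mapping.keys y.
       Poly_Mapping.single (class_mult G c d) (Poly_Mapping.lookup x c * Poly_Mapping.lookup y d)),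
     one = Poly_Mapping.single (biset_class G (regular_biset G)) 1,
     zero = 0,
     add = (+),
     smult = (\<lambda>r. Poly_Mapping.map ((*) r))\<rparr>"

definition burnside_relations ::
    "('g, 'm) monoid_scheme \<Rightarrow> (('g, nat) biset set \<Rightarrow>\<^sub>0 'r::comm_ring_1) set"
  where "burnside_relations G =
    {Poly_Mapping.single (biset_class G (biset_sum M N)) 1
       - (Poly_Mapping.single (biset_class G M) 1 + Poly_Mapping.single (biset_class G N) 1)
     |(M :: ('g, nat) biset) (N :: ('g, nat) biset). finite_biset G M \<and> finite_biset G N}"

definition relation_module ::
    "('g, 'm) monoid_scheme \<Rightarrow> (('g, nat) biset set \<Rightarrow>\<^sub>0 'r::comm_ring_1) set"
  where "relation_module G =
    Modules.module.span (\<lambda>r. Poly_Mapping.map ((*) r)) (burnside_relations G)"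

definition double_burnside ::
    "('g, 'm) monoid_scheme \<Rightarrow> ('r::comm_ring_1, (('g, nat) biset set \<Rightarrow>\<^sub>0 'r) set) module"
  where "double_burnside G =
    (let F = free_burnside G; I = relation_module G in
      ring.extend (F Quot I)
        \<lparr>smult = (\<lambda>r C. \<Union>x\<in>C. I +>\<^bsub>F\<^esub> (r \<odot>\<^bsub>F\<^esub> x))\<rparr>)"

definition burnside_class ::
    "('g, 'm) monoid_scheme \<Rightarrow> ('g, 'x) biset \<Rightarrow> (('g, nat) biset set \<Rightarrow>\<^sub>0 'r::comm_ring_1) set"
  where "burnside_class G M =
    relation_module G +>\<^bsub>free_burnside G\<^esub> Poly_Mapping.single (biset_class G M) 1"


section \<open>Elements of the double Burnside algebra of the symmetric group of degree three\<close>

type_synonym burnside_S3 = "((nat \<Rightarrow> nat, nat) biset set \<Rightarrow>\<^sub>0 rat) set"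

abbreviation S3 :: "(nat \<Rightarrow> nat) monoid"
  where "S3 \<equiv> sym_group 3"

definition B_S3 :: "(rat, burnside_S3) module"
  where "B_S3 = double_burnside S3"

definition a_S3 :: "nat \<Rightarrow> nat"
  where "a_S3 = cycle_of_list [1, 2]"

definition b_S3 :: "nat \<Rightarrow> nat"
  where "b_S3 = cycle_of_list [1, 2, 3]"

text \<open>Only the indices 0, 1, 4, 5 are used for \<open>V\<close> and \<open>H\<close>, only 1, 4, 5 for \<open>Hdiag\<close>,
  and only 6, 7, 8 for \<open>U\<close> and \<open>HU\<close>.\<close>

definition V :: "nat \<Rightarrow> (nat \<Rightarrow> nat) set"
  where "V i =
    (if i = 0 then {id}
     else if i = 1 then generate S3 {a_S3}
     else if i = 4 then generate S3 {b_S3}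
     else carrier S3)"

definition U :: "nat \<Rightarrow> ((nat \<Rightarrow> nat) \<times> (nat \<Rightarrow> nat)) set"
  where "U s = generate (S3 \<times>\<times> S3)
    (if s = 6 then {(a_S3, a_S3), (id, b_S3)}
     else if s = 7 then {(a_S3, a_S3), (b_S3, id)}
     else {(a_S3, a_S3), (b_S3, id), (id, b_S3)})"

definition H :: "nat \<Rightarrow> nat \<Rightarrow> burnside_S3"
  where "H i j = burnside_class S3 (coset_biset S3 (V i \<times> V j))"

definition Hdiag :: "nat \<Rightarrow> burnside_S3"
  where "Hdiag t = burnside_class S3 (coset_biset S3 {(x, x) |x. x \<in> V t})"

definition HU :: "nat \<Rightarrow> burnside_S3"
  where "HU s = burnside_class S3 (coset_biset S3 (U s))"

text \<open>The lists are the coordinates with respect to the indices 0, 1, 4, 5.\<close>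

definition T :: "rat list \<Rightarrow> rat list \<Rightarrow> burnside_S3"
  where "T xs ys = lincomb B_S3
    [(x * y, H i j). (i, x) \<leftarrow> zip [0, 1, 4, 5] xs, (j, y) \<leftarrow> zip [0, 1, 4, 5] ys]"

datatype label = lab_e | lab_g | lab_h | lab_4

fun l_vec :: "label \<Rightarrow> rat list" where
  "l_vec lab_e = [-1/2, 1, 1/2, 0]"
| "l_vec lab_g = [-4/3, 2, 1, 0]"
| "l_vec lab_h = [-1/3, 0, 1, 0]"
| "l_vec lab_4 = [1/6, -1/3, -1/6, 1/3]"

fun f_vec :: "label \<Rightarrow> rat list" where
  "f_vec lab_e = [1, 0, 0, 0]"
| "f_vec lab_g = [-1, 1, 0, 0]"
| "f_vec lab_h = [1/4, -1, 3/4, 0]"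
| "f_vec lab_4 = [1/4, -1/2, -1/4, 1/2]"

text \<open>The diagonal values of \<open>bT\<close> at \<open>lab_e\<close>, \<open>lab_g\<close>, \<open>lab_h\<close>, \<open>lab_4\<close> are
  $e$, $g$, $h$ and $b'_{\varepsilon_4,\varepsilon_4}$; the others are the $b_{p,q}$,
  where \<open>lab_4\<close> stands for $\varepsilon_4$.\<close>

definition bT :: "label \<Rightarrow> label \<Rightarrow> burnside_S3"
  where "bT p q = T (l_vec p) (f_vec q)"

definition eps2 :: burnside_S3
  where "eps2 = lincomb B_S3
    [(-1, H 0 0), (1, H 1 0), (1, H 0 1), (1, Hdiag 1), (-2, H 1 1)]"

definition eps3 :: burnside_S3
  where "eps3 = lincomb B_S3
    [(-1/4, H 0 0), (1/4, H 4 0), (1/4, H 0 4), (1/2, Hdiag 4), (-3/4, H 4 4)]"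

definition eps4 :: burnside_S3
  where "eps4 = lincomb B_S3
    [(1/2, H 0 0), (-1, Hdiag 1), (-1/2, Hdiag 4), (1, Hdiag 5)]"

definition b_eps2_eps4 :: burnside_S3
  where "b_eps2_eps4 = lincomb B_S3
    [(-1/2, H 0 0), (1/2, H 1 0), (1/2, H 0 1), (1/2, Hdiag 1), (1/2, H 0 4),
     (-1, H 1 1), (-1/2, H 0 5), (-1/2, HU 6), (-1/2, H 1 4), (1, H 1 5)]"

definition b_eps4_eps2 :: burnside_S3
  where "b_eps4_eps2 = lincomb B_S3
    [(-1/2, H 0 0), (1/2, H 1 0), (1/2, H 0 1), (1/2, Hdiag 1), (1/2, H 4 0),
     (-1, H 1 1), (-1/2, H 5 0), (-1/2, H 4 1), (-1/2, HU 7), (1, H 5 1)]"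

definition b''_eps4_eps4 :: burnside_S3
  where "b''_eps4_eps4 = lincomb B_S3
    [(1/4, H 0 0), (-3/4, H 1 0), (-3/4, H 0 1), (1/4, Hdiag 1), (-1/4, H 4 0),
     (-1/4, H 0 4), (3/2, H 1 1), (3/4, H 5 0), (3/4, H 0 5), (-1/4, HU 6),
     (3/4, H 4 1), (3/4, H 1 4), (-1/4, HU 7), (1/4, H 4 4), (-3/2, H 1 5),
     (-3/2, H 5 1), (-3/4, H 4 5), (-3/4, H 5 4), (1/4, HU 8), (3/2, H 5 5)]"


section \<open>The local algebra $\mathbb{Q}[\eta,\xi]/(\eta^2,\eta\xi,\xi^2)$\<close>

text \<open>$\mathbb{Q}[\eta,\xi]$ is realised as $\mathbb{Q}[\xi][\eta]$.\<close>

definition eta :: "rat poly poly" where "eta = [:0, 1:]"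

definition xi :: "rat poly poly" where "xi = [:[:0, 1:]:]"

definition eta_xi_ideal :: "rat poly poly set"
  where "eta_xi_ideal = {p * eta\<^sup>2 + q * (eta * xi) + r * xi\<^sup>2 |p q r. True}"

lemma eta_xi_ideal_iff:
  "p \<in> eta_xi_ideal \<longleftrightarrow>
    coeff (coeff p 0) 0 = 0 \<and> coeff (coeff p 1) 0 = 0 \<and> coeff (coeff p 0) 1 = 0"
proof
  assume "p \<in> eta_xi_ideal"
  then show "coeff (coeff p 0) 0 = 0 \<and> coeff (coeff p 1) 0 = 0 \<and> coeff (coeff p 0) 1 = 0"
    by (auto simp: eta_xi_ideal_def eta_def xi_def power2_eq_square coeff_pCons coeff_mult
        split: nat.splits)
next
  assume *: "coeff (coeff p 0) 0 = 0 \<and> coeff (coeff p 1) 0 = 0 \<and> coeff (coeff p 0) 1 = 0"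
  obtain c0 c1 p2 where p: "p = pCons c0 (pCons c1 p2)"
    by (metis pCons_cases)
  obtain x y r where c0: "c0 = pCons x (pCons y r)"
    by (metis pCons_cases)
  obtain z s where c1: "c1 = pCons z s"
    by (metis pCons_cases)
  have "p = p2 * eta\<^sup>2 + [:s:] * (eta * xi) + [:r:] * xi\<^sup>2"
    using * by (simp add: p c0 c1 eta_def xi_def power2_eq_square)
  then show "p \<in> eta_xi_ideal"
    unfolding eta_xi_ideal_def by blast
qed

quotient_type qex = "rat poly poly" / "\<lambda>p q. p - q \<in> eta_xi_ideal"
  by (rule equivpI) (auto simp: reflp_def symp_def transp_def eta_xi_ideal_iff)

instantiation qex :: comm_ring_1
begin

lift_definition zero_qex :: qex is 0 .

lift_definition one_qex :: qex is 1 .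

lift_definition plus_qex :: "qex \<Rightarrow> qex \<Rightarrow> qex" is "(+)"
  by (auto simp: eta_xi_ideal_iff)

lift_definition uminus_qex :: "qex \<Rightarrow> qex" is uminus
  by (auto simp: eta_xi_ideal_iff)

lift_definition minus_qex :: "qex \<Rightarrow> qex \<Rightarrow> qex" is "(-)"
  by (auto simp: eta_xi_ideal_iff)

lift_definition times_qex :: "qex \<Rightarrow> qex \<Rightarrow> qex" is "(*)"
  by (auto simp: eta_xi_ideal_iff coeff_mult)

instance
  by standard (transfer; simp add: eta_xi_ideal_iff algebra_simps)+

end

lift_definition eta_bar :: qex is eta .

lift_definition xi_bar :: qex is xi .

lift_definition qex_scale :: "rat \<Rightarrow> qex \<Rightarrow> qex" is "\<lambda>c. Polynomial.smult [:c:]"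
  by (auto simp: eta_xi_ideal_iff)

lift_definition coeff_one :: "qex \<Rightarrow> rat" is "\<lambda>p. coeff (coeff p 0) 0"
  by (auto simp: eta_xi_ideal_iff)

lift_definition coeff_eta :: "qex \<Rightarrow> rat" is "\<lambda>p. coeff (coeff p 1) 0"
  by (auto simp: eta_xi_ideal_iff)

lift_definition coeff_xi :: "qex \<Rightarrow> rat" is "\<lambda>p. coeff (coeff p 0) 1"
  by (auto simp: eta_xi_ideal_iff)

lemma qex_basis:
  "z = qex_scale a 1 + qex_scale b eta_bar + qex_scale c xi_bar \<longleftrightarrow>
    a = coeff_one z \<and> b = coeff_eta z \<and> c = coeff_xi z"
  by transfer (auto simp: eta_xi_ideal_iff eta_def xi_def)


section \<open>The algebra of arrays\<close>

text \<open>The zero spaces among the sixteen $A_{i,j}$ are omitted.\<close>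

record arr =
  A11 :: "rat^3^3"
  A14 :: "rat^1^3"
  A22 :: rat
  A24 :: rat
  A33 :: rat
  A41 :: "rat^3^1"
  A42 :: rat
  A44 :: qex

definition alpha_111 :: "rat^3^3 \<Rightarrow> rat^3^3 \<Rightarrow> rat^3^3" where "alpha_111 x y = x ** y"
definition alpha_114 :: "rat^3^3 \<Rightarrow> rat^1^3 \<Rightarrow> rat^1^3" where "alpha_114 x y = x ** y"
definition alpha_141 :: "rat^1^3 \<Rightarrow> rat^3^1 \<Rightarrow> rat^3^3" where "alpha_141 x y = 0"
definition alpha_144 :: "rat^1^3 \<Rightarrow> qex \<Rightarrow> rat^1^3"
  where "alpha_144 x z = map_matrix (\<lambda>u. u * coeff_one z) x"
definition alpha_222 :: "rat \<Rightarrow> rat \<Rightarrow> rat" where "alpha_222 x y = x * y"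
definition alpha_224 :: "rat \<Rightarrow> rat \<Rightarrow> rat" where "alpha_224 x y = x * y"
definition alpha_242 :: "rat \<Rightarrow> rat \<Rightarrow> rat" where "alpha_242 x y = 0"
definition alpha_244 :: "rat \<Rightarrow> qex \<Rightarrow> rat" where "alpha_244 x z = x * coeff_one z"
definition alpha_333 :: "rat \<Rightarrow> rat \<Rightarrow> rat" where "alpha_333 x y = x * y"
definition alpha_411 :: "rat^3^1 \<Rightarrow> rat^3^3 \<Rightarrow> rat^3^1" where "alpha_411 x y = x ** y"
definition alpha_414 :: "rat^3^1 \<Rightarrow> rat^1^3 \<Rightarrow> qex"
  where "alpha_414 x y = qex_scale ((x ** y) $ 1 $ 1) eta_bar"
definition alpha_422 :: "rat \<Rightarrow> rat \<Rightarrow> rat" where "alpha_422 x y = x * y"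
definition alpha_424 :: "rat \<Rightarrow> rat \<Rightarrow> qex"
  where "alpha_424 x y = qex_scale (x * y) (xi_bar - 12 * eta_bar)"
definition alpha_441 :: "qex \<Rightarrow> rat^3^1 \<Rightarrow> rat^3^1"
  where "alpha_441 z y = map_matrix (\<lambda>u. coeff_one z * u) y"
definition alpha_442 :: "qex \<Rightarrow> rat \<Rightarrow> rat" where "alpha_442 z y = coeff_one z * y"
definition alpha_444 :: "qex \<Rightarrow> qex \<Rightarrow> qex" where "alpha_444 z w = z * w"

definition arr_mult :: "arr \<Rightarrow> arr \<Rightarrow> arr"
  where "arr_mult x y =
    \<lparr>A11 = alpha_111 (A11 x) (A11 y) + alpha_141 (A14 x) (A41 y),
     A14 = alpha_114 (A11 x) (A14 y) + alpha_144 (A14 x) (A44 y),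
     A22 = alpha_222 (A22 x) (A22 y) + alpha_242 (A24 x) (A42 y),
     A24 = alpha_224 (A22 x) (A24 y) + alpha_244 (A24 x) (A44 y),
     A33 = alpha_333 (A33 x) (A33 y),
     A41 = alpha_411 (A41 x) (A11 y) + alpha_441 (A44 x) (A41 y),
     A42 = alpha_422 (A42 x) (A22 y) + alpha_442 (A44 x) (A42 y),
     A44 = alpha_414 (A41 x) (A14 y) + alpha_424 (A42 x) (A24 y) + alpha_444 (A44 x) (A44 y)\<rparr>"

definition arr_one :: arr
  where "arr_one = \<lparr>A11 = mat 1, A14 = 0, A22 = 1, A24 = 0, A33 = 1, A41 = 0, A42 = 0, A44 = 1\<rparr>"

definition arr_zero :: arr
  where "arr_zero = \<lparr>A11 = 0, A14 = 0, A22 = 0, A24 = 0, A33 = 0, A41 = 0, A42 = 0, A44 = 0\<rparr>"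

definition arr_add :: "arr \<Rightarrow> arr \<Rightarrow> arr"
  where "arr_add x y =
    \<lparr>A11 = A11 x + A11 y, A14 = A14 x + A14 y, A22 = A22 x + A22 y, A24 = A24 x + A24 y,
     A33 = A33 x + A33 y, A41 = A41 x + A41 y, A42 = A42 x + A42 y, A44 = A44 x + A44 y\<rparr>"

definition arr_scale :: "rat \<Rightarrow> arr \<Rightarrow> arr"
  where "arr_scale c x =
    \<lparr>A11 = map_matrix ((*) c) (A11 x), A14 = map_matrix ((*) c) (A14 x),
     A22 = c * A22 x, A24 = c * A24 x, A33 = c * A33 x,
     A41 = map_matrix ((*) c) (A41 x), A42 = c * A42 x, A44 = qex_scale c (A44 x)\<rparr>"

definition arr_algebra :: "(rat, arr) module"
  where "arr_algebra =
    \<lparr>carrier = UNIV, mult = arr_mult, one = arr_one, zero = arr_zero, add = arr_add,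
     smult = arr_scale\<rparr>"


section \<open>The map from arrays to the double Burnside algebra\<close>

definition gamma_11 :: "rat^3^3 \<Rightarrow> burnside_S3"
  where "gamma_11 r = lincomb B_S3
    [(r $ 1 $ 1, bT lab_e lab_e), (r $ 1 $ 2, bT lab_e lab_g), (r $ 1 $ 3, bT lab_e lab_h),
     (r $ 2 $ 1, bT lab_g lab_e), (r $ 2 $ 2, bT lab_g lab_g), (r $ 2 $ 3, bT lab_g lab_h),
     (r $ 3 $ 1, bT lab_h lab_e), (r $ 3 $ 2, bT lab_h lab_g), (r $ 3 $ 3, bT lab_h lab_h)]"

definition gamma_14 :: "rat^1^3 \<Rightarrow> burnside_S3"
  where "gamma_14 u = lincomb B_S3
    [(u $ 1 $ 1, bT lab_e lab_4), (u $ 2 $ 1, bT lab_g lab_4), (u $ 3 $ 1, bT lab_h lab_4)]"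

definition gamma_22 :: "rat \<Rightarrow> burnside_S3" where "gamma_22 u = u \<odot>\<^bsub>B_S3\<^esub> eps2"
definition gamma_24 :: "rat \<Rightarrow> burnside_S3" where "gamma_24 u = u \<odot>\<^bsub>B_S3\<^esub> b_eps2_eps4"
definition gamma_33 :: "rat \<Rightarrow> burnside_S3" where "gamma_33 u = u \<odot>\<^bsub>B_S3\<^esub> eps3"

definition gamma_41 :: "rat^3^1 \<Rightarrow> burnside_S3"
  where "gamma_41 v = lincomb B_S3
    [(v $ 1 $ 1, bT lab_4 lab_e), (v $ 1 $ 2, bT lab_4 lab_g), (v $ 1 $ 3, bT lab_4 lab_h)]"

definition gamma_42 :: "rat \<Rightarrow> burnside_S3" where "gamma_42 u = u \<odot>\<^bsub>B_S3\<^esub> b_eps4_eps2"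

definition gamma_44 :: "qex \<Rightarrow> burnside_S3"
  where "gamma_44 z = lincomb B_S3
    [(coeff_one z, eps4), (coeff_eta z, bT lab_4 lab_4), (coeff_xi z, b''_eps4_eps4)]"

definition gamma :: "arr \<Rightarrow> burnside_S3"
  where "gamma x =
    gamma_11 (A11 x) \<oplus>\<^bsub>B_S3\<^esub> gamma_14 (A14 x) \<oplus>\<^bsub>B_S3\<^esub>
    gamma_22 (A22 x) \<oplus>\<^bsub>B_S3\<^esub> gamma_24 (A24 x) \<oplus>\<^bsub>B_S3\<^esub> gamma_33 (A33 x) \<oplus>\<^bsub>B_S3\<^esub>
    gamma_41 (A41 x) \<oplus>\<^bsub>B_S3\<^esub> gamma_42 (A42 x) \<oplus>\<^bsub>B_S3\<^esub> gamma_44 (A44 x)"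

end

theory Submission
  imports Defs "HOL-Analysis.Cartesian_Space"
begin

text \<open>To a biset \<open>M\<close> and a function \<open>w\<close> on the subgroups of \<open>G \<times> G\<close> attach the mark
  \<open>\<Sum>x\<in>M. w (S\<^sub>x)\<close>, where \<open>S\<^sub>x = {(g, h). g x = x h}\<close>. The stabilizer of the orbit of \<open>(x, y)\<close>
  in a tensor product is the relational composition \<open>S\<^sub>x O S\<^sub>y\<close>, and this orbit of \<open>G\<close> has
  \<open>|G| / |k\<^sub>2(S\<^sub>x) \<inter> k\<^sub>1(S\<^sub>y)|\<close> elements, where \<open>k\<^sub>1\<close>, \<open>k\<^sub>2\<close> are the kernels of the opposite projections;
  so marks of tensor products are computed from compositions of subgroups (the ghost algebra of
  Boltje and Danz). By the orbit decomposition a biset is determined modulo the relations by its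
  marks for conjugation-invariant \<open>w\<close>. The subgroups of \<open>S\<^sub>3 \<times> S\<^sub>3\<close> form 22 conjugacy classes, which
  are told apart by the orders of the two projections and of their kernels. Choosing \<open>w\<close> so that
  the 22 marks of a biset are the coordinates of its preimage under \<open>\<gamma>\<close>, the marks induce an injective
  map from the double Burnside algebra to the array algebra. It is multiplicative by a finite
  calculation with representatives of the 22 classes, and it is a left inverse of \<open>\<gamma>\<close>.\<close>

section \<open>Stabilizers in bisets\<close>

text \<open>The composition S_x O S_y depends on the relative position of the two subgroups and not
  only on their conjugacy classes. This is the obstacle to a product formula for marks. Averaging
  over left translations of the second biset removes it, and multiplicativity becomes one identity
  of integer vectors for each of the 22 * 22 pairs of classes.

  The rows of \<open>mark_table\<close> are not derived in the proof. They express the 22 transitive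
  bisets in the basis of the statement, scaled to integers, and are certified by three checks: the
  product law, their linear independence, and the fact that the elements of the statement receive
  unit vectors as coordinates.

  The ring laws of the double Burnside algebra are never proved from bisets. The marks give a map on
  formal sums which respects the operations and whose fibres are exactly the cosets of the
  relations; the laws are carried over from the arrays. So associativity of the tensor product, the
  ideal property of the relations and the independence of the 22 classes are outcomes and not
  inputs.\<close>

definition biset_stab :: "('g, 'm) monoid_scheme \<Rightarrow> ('g, 'x) biset \<Rightarrow> 'x \<Rightarrow> ('g \<times> 'g) set"
  where "biset_stab G M x = {(g, h). g \<in> carrier G \<and> h \<in> carrier G \<and> lact M g x = ract M x h}"

text \<open>Bisets are treated as left sets of the square, \<open>(g, h)\<close> acting by g x
  h^{-1}; \<open>biset_stab\<close> is then an ordinary stabilizer (\<open>mem_stab_iff\<close>).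
  The form g x = x h is the one that composes under tensor products.\<close>

definition biset_act :: "('g, 'm) monoid_scheme \<Rightarrow> ('g, 'x) biset \<Rightarrow> 'g \<times> 'g \<Rightarrow> 'x \<Rightarrow> 'x"
  where "biset_act G M = (\<lambda>(g, h) x. ract M (lact M g x) (inv\<^bsub>G\<^esub> h))"

definition conj_pair :: "('g, 'm) monoid_scheme \<Rightarrow> 'g \<times> 'g \<Rightarrow> 'g \<times> 'g \<Rightarrow> 'g \<times> 'g"
  where "conj_pair G p q = p \<otimes>\<^bsub>G \<times>\<times> G\<^esub> q \<otimes>\<^bsub>G \<times>\<times> G\<^esub> inv\<^bsub>G \<times>\<times> G\<^esub> p"

context finite_biset
begin

lemma pair_group: "group (G \<times>\<times> G)"
  by (simp add: DirProd_group is_group)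

lemma act_closed: "p \<in> carrier (G \<times>\<times> G) \<Longrightarrow> x \<in> elems M \<Longrightarrow> biset_act G M p x \<in> elems M"
  by (auto simp: biset_act_def lact_closed ract_closed)

lemma act_one: "x \<in> elems M \<Longrightarrow> biset_act G M \<one>\<^bsub>G \<times>\<times> G\<^esub> x = x"
  by (simp add: biset_act_def lact_one ract_one)

lemma act_mult:
  assumes "p \<in> carrier (G \<times>\<times> G)" "q \<in> carrier (G \<times>\<times> G)" "x \<in> elems M"
  shows "biset_act G M (p \<otimes>\<^bsub>G \<times>\<times> G\<^esub> q) x = biset_act G M p (biset_act G M q x)"
  using assms
  by (cases p; cases q)
    (simp add: biset_act_def lact_mult lact_closed ract_closed inv_mult_group ract_mult lact_ract)

lemma act_inv:
  assumes "p \<in> carrier (G \<times>\<times> G)" "x \<in> elems M"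
  shows "biset_act G M (inv\<^bsub>G \<times>\<times> G\<^esub> p) (biset_act G M p x) = x"
proof -
  interpret GG: group "G \<times>\<times> G" by (rule pair_group)
  show ?thesis
    using act_mult[OF GG.inv_closed[OF assms(1)] assms] act_one assms
    by (simp del: one_DirProd inv_DirProd carrier_DirProd)
qed

lemma mem_stab_iff:
  assumes "x \<in> elems M"
  shows "p \<in> biset_stab G M x \<longleftrightarrow> p \<in> carrier (G \<times>\<times> G) \<and> biset_act G M p x = x"
proof (cases p)
  case (Pair g h)
  have "lact M g x = ract M x h \<longleftrightarrow> ract M (lact M g x) (inv h) = x"
    if g: "g \<in> carrier G" and h: "h \<in> carrier G"
  proof -
    have "ract M (ract M (lact M g x) (inv h)) h = lact M g x"
      using g h assms by (simp flip: ract_mult add: lact_closed ract_one)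
    moreover have "ract M (ract M x h) (inv h) = x"
      using g h assms by (simp flip: ract_mult add: lact_closed ract_one)
    ultimately show ?thesis by metis
  qed
  then show ?thesis by (auto simp: Pair biset_stab_def biset_act_def)
qed

lemma stab_subgroup:
  assumes "x \<in> elems M"
  shows "subgroup (biset_stab G M x) (G \<times>\<times> G)"
proof -
  interpret GG: group "G \<times>\<times> G" by (rule pair_group)
  show ?thesis
  proof (rule GG.subgroupI)
    show "biset_stab G M x \<subseteq> carrier (G \<times>\<times> G)"
      by (auto simp: biset_stab_def)
    show "biset_stab G M x \<noteq> {}"
      using mem_stab_iff[OF assms, of "\<one>\<^bsub>G \<times>\<times> G\<^esub>"] act_one[OF assms] by auto
    show "inv\<^bsub>G \<times>\<times> G\<^esub> p \<in> biset_stab G M x" if "p \<in> biset_stab G M x" for p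
      using that act_inv[of p x] assms by (auto simp: mem_stab_iff simp del: carrier_DirProd)
    show "p \<otimes>\<^bsub>G \<times>\<times> G\<^esub> q \<in> biset_stab G M x"
      if "p \<in> biset_stab G M x" "q \<in> biset_stab G M x" for p q
      using that assms by (simp add: mem_stab_iff act_mult del: carrier_DirProd)
  qed
qed

lemma stab_act:
  assumes p: "p \<in> carrier (G \<times>\<times> G)" and x: "x \<in> elems M"
  shows "biset_stab G M (biset_act G M p x) = conj_pair G p ` biset_stab G M x"
proof -
  interpret GG: group "G \<times>\<times> G" by (rule pair_group)
  note x' = act_closed[OF p x]
  show ?thesis
  proof (intro equalityI subsetI)
    fix q assume "q \<in> biset_stab G M (biset_act G M p x)"
    then have q: "q \<in> carrier (G \<times>\<times> G)"
      and eq: "biset_act G M q (biset_act G M p x) = biset_act G M p x"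
      using mem_stab_iff[OF x'] by auto
    let ?r = "inv\<^bsub>G \<times>\<times> G\<^esub> p \<otimes>\<^bsub>G \<times>\<times> G\<^esub> q \<otimes>\<^bsub>G \<times>\<times> G\<^esub> p"
    have "biset_act G M ?r x = x"
      using p q x x' eq by (simp add: act_mult act_inv act_closed del: carrier_DirProd)
    then have "?r \<in> biset_stab G M x"
      using p q x by (simp add: mem_stab_iff del: carrier_DirProd)
    moreover have "q = conj_pair G p ?r"
      using p q by (simp add: conj_pair_def GG.m_assoc del: carrier_DirProd one_DirProd)
        (simp add: GG.m_assoc[symmetric] del: carrier_DirProd one_DirProd)
    ultimately show "q \<in> conj_pair G p ` biset_stab G M x" by blast
  next
    fix q assume "q \<in> conj_pair G p ` biset_stab G M x"
    then obtain r where r: "r \<in> carrier (G \<times>\<times> G)" "biset_act G M r x = x" "q = conj_pair G p r"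
      using mem_stab_iff[OF x] by auto
    then show "q \<in> biset_stab G M (biset_act G M p x)"
      using p x x' by (simp add: mem_stab_iff conj_pair_def act_mult act_inv act_closed
          del: carrier_DirProd)
  qed
qed

text \<open>Left translation conjugates the first factor only; the averaging in the tensor product
  uses this case.\<close>

lemma stab_lact:
  assumes "g \<in> carrier G" "x \<in> elems M"
  shows "biset_stab G M (lact M g x) = conj_pair G (g, \<one>) ` biset_stab G M x"
  using stab_act[of "(g, \<one>)" x] assms by (simp add: biset_act_def ract_one lact_closed)

end

section \<open>Isomorphisms of bisets\<close>

lemma biset_isomorphic_trans:
  assumes "biset_isomorphic G L M" "biset_isomorphic G M N"
  shows "biset_isomorphic G L N"
proof -
  from assms obtain f f' where f: "bij_betw f (elems L) (elems M)"
    "\<forall>g\<in>carrier G. \<forall>x\<in>elems L. f (lact L g x) = lact M g (f x) \<and> f (ract L x g) = ract M (f x) g"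
    and f': "bij_betw f' (elems M) (elems N)"
    "\<forall>g\<in>carrier G. \<forall>x\<in>elems M. f' (lact M g x) = lact N g (f' x) \<and> f' (ract M x g) = ract N (f' x) g"
    unfolding biset_isomorphic_def by auto
  then show ?thesis
    unfolding biset_isomorphic_def
    by (intro exI[of _ "f' \<circ> f"]) (auto simp: bij_betw_trans dest: bij_betwE)
qed

lemma biset_isomorphic_sym:
  assumes "finite_biset G M" "biset_isomorphic G M N"
  shows "biset_isomorphic G N M"
proof -
  interpret finite_biset G M by fact
  obtain f where f: "bij_betw f (elems M) (elems N)"
    "\<And>g x. g \<in> carrier G \<Longrightarrow> x \<in> elems M \<Longrightarrow> f (lact M g x) = lact N g (f x)"
    "\<And>g x. g \<in> carrier G \<Longrightarrow> x \<in> elems M \<Longrightarrow> f (ract M x g) = ract N (f x) g"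
    using assms(2) unfolding biset_isomorphic_def by auto
  let ?e = "the_inv_into (elems M) f"
  have inj: "inj_on f (elems M)" using f(1) by (rule bij_betw_imp_inj_on)
  have "bij_betw ?e (elems N) (elems M)" by (rule bij_betw_the_inv_into[OF f(1)])
  moreover have "?e (lact N g y) = lact M g (?e y) \<and> ?e (ract N y g) = ract M (?e y) g"
    if g: "g \<in> carrier G" and y: "y \<in> elems N" for g y
  proof -
    obtain x where x: "x \<in> elems M" "y = f x" using y f(1) by (auto simp: bij_betw_def)
    show ?thesis
      using x g lact_closed ract_closed
      by (simp add: the_inv_into_f_f[OF inj] flip: f(2,3))
  qed
  ultimately show ?thesis unfolding biset_isomorphic_def by blast
qed

text \<open>Transport along an injection into \<open>nat\<close>. It makes
  \<open>biset_class G M\<close> nonempty for a biset on any type, so that a member of the class can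
  be chosen.\<close>

lemma exists_nat_biset:
  assumes "finite_biset G M"
  shows "\<exists>N :: ('g, nat) biset. finite_biset G N \<and> biset_isomorphic G N (M :: ('g, 'x) biset)"
proof -
  interpret finite_biset G M by fact
  obtain e :: "'x \<Rightarrow> nat" and n where "e ` elems M = {i. i < n}" and e: "inj_on e (elems M)"
    using finite_imp_inj_to_nat_seg[OF finite_elems] by blast
  let ?d = "the_inv_into (elems M) e"
  let ?N = "\<lparr>elems = e ` elems M, lact = (\<lambda>g i. e (lact M g (?d i))),
    ract = (\<lambda>i g. e (ract M (?d i) g))\<rparr>"
  note d = the_inv_into_f_f[OF e]
  have "finite_biset G ?N"
    by unfold_locales
      (auto simp: d finite_elems lact_closed ract_closed lact_one ract_one lact_mult ract_mult lact_ract)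
  moreover have "biset_isomorphic G M ?N"
    unfolding biset_isomorphic_def using e by (intro exI[of _ e]) (auto simp: d bij_betw_def)
  ultimately show ?thesis
    using biset_isomorphic_sym[OF assms] by blast
qed

lemma biset_class_eqI:
  assumes "finite_biset G M" "biset_isomorphic G M N"
  shows "biset_class G M = biset_class G N"
  unfolding biset_class_def
  using biset_isomorphic_trans[OF _ assms(2)]
    biset_isomorphic_trans[OF _ biset_isomorphic_sym[OF assms]] by blast

lemma biset_class_in_classes:
  assumes "finite_biset G M"
  shows "biset_class G M \<in> biset_classes G"
proof -
  obtain N :: "('a, nat) biset" where N: "finite_biset G N" "biset_isomorphic G N M"
    using exists_nat_biset[OF assms] by blast
  then show ?thesis
    unfolding biset_classes_def using biset_class_eqI[OF N] by auto
qed

section \<open>Marks\<close>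

definition biset_mark ::
    "('g, 'm) monoid_scheme \<Rightarrow> (('g \<times> 'g) set \<Rightarrow> 'r::comm_ring_1) \<Rightarrow> ('g, 'x) biset \<Rightarrow> 'r"
  where "biset_mark G w M = (\<Sum>x\<in>elems M. w (biset_stab G M x))"

text \<open>An isomorphism preserves each stabilizer itself and not only its conjugacy class, so the
  mark is an invariant for every \<open>w\<close>.\<close>

lemma biset_mark_iso:
  assumes "finite_biset G M" "biset_isomorphic G M N"
  shows "biset_mark G w M = biset_mark G w N"
proof -
  interpret finite_biset G M by fact
  obtain f where f: "bij_betw f (elems M) (elems N)"
    "\<And>g x. g \<in> carrier G \<Longrightarrow> x \<in> elems M \<Longrightarrow> f (lact M g x) = lact N g (f x)"
    "\<And>g x. g \<in> carrier G \<Longrightarrow> x \<in> elems M \<Longrightarrow> f (ract M x g) = ract N (f x) g"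
    using assms(2) unfolding biset_isomorphic_def by auto
  have "biset_stab G N (f x) = biset_stab G M x" if "x \<in> elems M" for x
    using that lact_closed ract_closed bij_betw_imp_inj_on[OF f(1)]
    by (auto simp: biset_stab_def inj_on_eq_iff simp flip: f(2,3))
  then show ?thesis
    unfolding biset_mark_def sum.reindex_bij_betw[OF f(1), symmetric] by simp
qed

lemma biset_sum_finite:
  assumes "finite_biset G M" "finite_biset G N"
  shows "finite_biset G (biset_sum M N)"
proof -
  interpret M: finite_biset G M by fact
  interpret N: finite_biset G N by fact
  show ?thesis
    unfolding biset_sum_def
    by unfold_locales
      (auto simp: M.finite_elems N.finite_elems M.lact_closed N.lact_closed M.ract_closed
        N.ract_closed M.lact_one N.lact_one M.ract_one N.ract_one M.lact_mult N.lact_mult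
        M.ract_mult N.ract_mult M.lact_ract N.lact_ract)
qed

lemma biset_mark_sum:
  assumes "finite_biset G M" "finite_biset G N"
  shows "biset_mark G w (biset_sum M N) = biset_mark G w M + biset_mark G w N"
proof -
  interpret M: finite_biset G M by fact
  interpret N: finite_biset G N by fact
  have "biset_stab G (biset_sum M N) (Inl x) = biset_stab G M x"
    "biset_stab G (biset_sum M N) (Inr y) = biset_stab G N y" for x y
    by (auto simp: biset_stab_def biset_sum_def)
  then show ?thesis
    by (simp add: biset_mark_def sum.Plus M.finite_elems N.finite_elems
        biset_sum_def[of M N, THEN arg_cong[of _ _ elems]])
qed

section \<open>Tensor products\<close>

text \<open>The fibres of the map from g to \<open>act g e\<close> are the left cosets of the
  stabilizer. The action laws are assumed at the point \<open>e\<close> only, so no permutation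
  representation has to be set up.\<close>

lemma (in group) card_orbit_mult_card_stabilizer:
  assumes fin: "finite (carrier G)"
    and one: "act \<one> e = e"
    and mult: "\<And>g h. g \<in> carrier G \<Longrightarrow> h \<in> carrier G \<Longrightarrow> act (g \<otimes> h) e = act g (act h e)"
  shows "card ((\<lambda>g. act g e) ` carrier G) * card {g \<in> carrier G. act g e = e} = card (carrier G)"
proof -
  let ?S = "{g \<in> carrier G. act g e = e}"
  have "card {h \<in> carrier G. act h e = act g e} = card ?S" if g: "g \<in> carrier G" for g
  proof -
    have "act (inv g \<otimes> h) e = e" if "h \<in> carrier G" "act h e = act g e" for h
      using that g by (metis inv_closed l_inv mult one)
    then have "{h \<in> carrier G. act h e = act g e} = (\<lambda>s. g \<otimes> s) ` ?S"
      using g by (force simp: mult image_iff m_assoc[symmetric] intro!: exI[of _ "inv g \<otimes> _"])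
    then show ?thesis
      using g by (simp add: card_image inj_on_def)
  qed
  then have "(\<Sum>p\<in>(\<lambda>g. act g e) ` carrier G. card {h \<in> carrier G. act h e = p}) =
      (\<Sum>p\<in>(\<lambda>g. act g e) ` carrier G. card ?S)"
    by (intro sum.cong) auto
  moreover have "card (carrier G) =
      (\<Sum>p\<in>(\<lambda>g. act g e) ` carrier G. card {h \<in> carrier G. act h e = p})"
    using sum.image_gen[OF fin, of "\<lambda>_. 1" "\<lambda>g. act g e"] by (simp only: card_eq_sum)
  ultimately show ?thesis by simp
qed

text \<open>This is the number |k_2(K) \<inter> k_1(L)|: the order of the stabilizer in G of a pair
  whose components have stabilizers \<open>K\<close> and \<open>L\<close>.\<close>

definition link_size :: "('g, 'm) monoid_scheme \<Rightarrow> ('g \<times> 'g) set \<Rightarrow> ('g \<times> 'g) set \<Rightarrow> nat"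
  where "link_size G K L = card {y. (\<one>\<^bsub>G\<^esub>, y) \<in> K \<and> (y, \<one>\<^bsub>G\<^esub>) \<in> L}"

locale finite_biset_pair = M: finite_biset G M + N: finite_biset G N
  for G :: "('g, 'm) monoid_scheme" (structure) and M :: "('g, 'x) biset" and N :: "('g, 'y) biset"
begin

abbreviation orb where "orb \<equiv> tensor_orbit G M N"

lemma orb_self: "p \<in> elems M \<times> elems N \<Longrightarrow> p \<in> orb p"
  by (force simp: tensor_orbit_def M.ract_one N.lact_one intro: exI[of _ \<one>])

lemma orb_subset: "p \<in> elems M \<times> elems N \<Longrightarrow> orb p \<subseteq> elems M \<times> elems N"
  by (auto simp: tensor_orbit_def M.ract_closed N.lact_closed)

lemma orb_mem_iff:
  "(m', n') \<in> orb (m, n) \<longleftrightarrow> (\<exists>g\<in>carrier G. m' = ract M m (inv g) \<and> n' = lact N g n)"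
  by (auto simp: tensor_orbit_def)

lemma orb_eq:
  assumes p: "p \<in> elems M \<times> elems N" and q: "q \<in> orb p"
  shows "orb q = orb p"
proof -
  obtain m n where mn: "p = (m, n)" "m \<in> elems M" "n \<in> elems N" using p by auto
  obtain g where g: "g \<in> carrier G" "q = (ract M m (inv g), lact N g n)"
    using q mn by (auto simp: tensor_orbit_def)
  have "orb q = (\<lambda>h. (ract M m (inv h), lact N h n)) ` ((\<lambda>h. h \<otimes> g) ` carrier G)"
    using mn g
    by (force simp: tensor_orbit_def image_iff M.inv_mult_group M.ract_mult N.lact_mult)
  also have "(\<lambda>h. h \<otimes> g) ` carrier G = carrier G"
    using M.surj_const_mult M.inv_closed g(1)
    by (force simp: image_iff M.m_assoc intro!: bexI[of _ "_ \<otimes> inv g"])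
  finally show ?thesis by (auto simp: mn tensor_orbit_def)
qed

lemma orb_eq_iff:
  "p \<in> elems M \<times> elems N \<Longrightarrow> q \<in> elems M \<times> elems N \<Longrightarrow> orb q = orb p \<longleftrightarrow> q \<in> orb p"
  using orb_eq orb_self by metis

lemma lact_tensor:
  assumes "h \<in> carrier G" "m \<in> elems M" "n \<in> elems N"
  shows "lact (biset_tensor G M N) h (orb (m, n)) = orb (lact M h m, n)"
  using assms by (force simp: biset_tensor_def tensor_orbit_def image_iff M.lact_ract)

lemma ract_tensor:
  assumes "h \<in> carrier G" "m \<in> elems M" "n \<in> elems N"
  shows "ract (biset_tensor G M N) (orb (m, n)) h = orb (m, ract N n h)"
  using assms by (force simp: biset_tensor_def tensor_orbit_def image_iff N.lact_ract)

lemma elems_tensor: "elems (biset_tensor G M N) = orb ` (elems M \<times> elems N)"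
  by (simp add: biset_tensor_def)

lemma tensor_finite: "finite_biset G (biset_tensor G M N)"
  by unfold_locales
    (auto simp: elems_tensor M.finite_elems N.finite_elems lact_tensor ract_tensor M.lact_closed
      N.ract_closed M.lact_one N.ract_one M.lact_mult N.ract_mult)

text \<open>The pairs (h m, n) and (m, n k) lie in one orbit exactly when some u satisfies h m = m u
  and u n = n k, that is, when \<open>(h, u)\<close> and \<open>(u, k)\<close> lie in the two
  stabilizers. This middle element is the inverse of the group element that moves one pair to the
  other.\<close>

lemma stab_tensor:
  assumes m: "m \<in> elems M" and n: "n \<in> elems N"
  shows "biset_stab G (biset_tensor G M N) (orb (m, n)) = biset_stab G M m O biset_stab G N n"
proof -
  have "orb (lact M h m, n) = orb (m, ract N n k) \<longleftrightarrow>
      (\<exists>u\<in>carrier G. lact M h m = ract M m u \<and> lact N u n = ract N n k)"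
    if h: "h \<in> carrier G" and k: "k \<in> carrier G" for h k
  proof -
    have "orb (lact M h m, n) = orb (m, ract N n k) \<longleftrightarrow>
        (\<exists>g\<in>carrier G. lact M h m = ract M m (inv g) \<and> n = lact N g (ract N n k))"
      using m n h k by (subst orb_eq_iff) (auto simp: M.lact_closed N.ract_closed orb_mem_iff)
    also have "\<dots> \<longleftrightarrow> (\<exists>u\<in>carrier G. lact M h m = ract M m u \<and> n = lact N (inv u) (ract N n k))"
      by (metis M.inv_closed M.inv_inv)
    also have "\<dots> \<longleftrightarrow> (\<exists>u\<in>carrier G. lact M h m = ract M m u \<and> lact N u n = ract N n k)"
    proof -
      have "n = lact N (inv u) (ract N n k) \<longleftrightarrow> lact N u n = ract N n k" if "u \<in> carrier G" for u
        using that n k N.ract_closed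
        by (metis M.inv_closed M.l_inv M.r_inv N.lact_mult N.lact_one)
      then show ?thesis by blast
    qed
    finally show ?thesis .
  qed
  then show ?thesis
    using m n by (simp add: biset_stab_def lact_tensor ract_tensor relcomp_unfold set_eq_iff
        cong: conj_cong) blast
qed

lemma card_orb:
  assumes "finite (carrier G)" and m: "m \<in> elems M" and n: "n \<in> elems N"
  shows "card (orb (m, n)) * link_size G (biset_stab G M m) (biset_stab G N n) = card (carrier G)"
proof -
  let ?act = "\<lambda>g (m, n). (ract M m (inv g), lact N g n)"
  have "orb (m, n) = (\<lambda>g. ?act g (m, n)) ` carrier G"
    by (auto simp: tensor_orbit_def)
  moreover have "{g \<in> carrier G. ?act g (m, n) = (m, n)} =
      {y. (\<one>, y) \<in> biset_stab G M m \<and> (y, \<one>) \<in> biset_stab G N n}"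
  proof -
    have "ract M m (inv g) = m \<longleftrightarrow> m = ract M m g" if "g \<in> carrier G" for g
      using that m by (metis M.inv_closed M.l_inv M.r_inv M.ract_mult M.ract_one)
    then show ?thesis
      using m n by (auto simp: biset_stab_def M.lact_one N.ract_one)
  qed
  ultimately show ?thesis
    using M.card_orbit_mult_card_stabilizer[OF assms(1), of ?act "(m, n)"] m n
    by (simp add: link_size_def M.ract_one N.lact_one M.inv_mult_group M.ract_mult N.lact_mult)
qed

text \<open>Group the pairs by orbit. Each of the |z| pairs in an orbit z has the link size |G| /
  |z|, so the orbit contributes |G| times its mark.\<close>

lemma biset_mark_tensor:
  fixes w :: "('g \<times> 'g) set \<Rightarrow> 'r::field_char_0"
  assumes fin: "finite (carrier G)"
  shows "of_nat (card (carrier G)) * biset_mark G w (biset_tensor G M N) =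
    (\<Sum>m\<in>elems M. \<Sum>n\<in>elems N. of_nat (link_size G (biset_stab G M m) (biset_stab G N n)) *
      w (biset_stab G M m O biset_stab G N n))"
proof -
  let ?A = "elems M \<times> elems N"
  let ?T = "biset_tensor G M N"
  let ?k = "\<lambda>(m, n). of_nat (link_size G (biset_stab G M m) (biset_stab G N n)) :: 'r"
  have finA: "finite ?A" by (simp add: M.finite_elems N.finite_elems)
  have "(\<Sum>p | p \<in> ?A \<and> orb p = z. ?k p * w (biset_stab G ?T (orb p))) =
      of_nat (card (carrier G)) * w (biset_stab G ?T z)" if z: "z \<in> orb ` ?A" for z
  proof -
    obtain p where p: "p \<in> ?A" "z = orb p" using z by auto
    have eq: "{q. q \<in> ?A \<and> orb q = z} = z"
      using p orb_eq_iff orb_subset by blast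
    have k: "of_nat (card z) * ?k q = of_nat (card (carrier G))" if "q \<in> z" for q
    proof -
      obtain m n where mn: "q = (m, n)" "m \<in> elems M" "n \<in> elems N" "orb q = z"
        using \<open>q \<in> z\<close> eq by (cases q) auto
      show ?thesis
        using card_orb[OF fin mn(2,3)] mn(1,4) by (simp flip: of_nat_mult)
    qed
    have z0: "of_nat (card z) \<noteq> (0::'r)"
      using orb_self[OF p(1)] p(2) finite_subset[OF orb_subset[OF p(1)] finA] by auto
    have "(\<Sum>p | p \<in> ?A \<and> orb p = z. ?k p * w (biset_stab G ?T (orb p))) =
        (\<Sum>q\<in>z. ?k q * w (biset_stab G ?T z))"
      using eq by (intro sum.cong) auto
    also have "\<dots> = (\<Sum>q\<in>z. of_nat (card (carrier G)) / of_nat (card z) * w (biset_stab G ?T z))"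
      using k z0 by (intro sum.cong refl) (auto simp: field_simps)
    also have "\<dots> = of_nat (card (carrier G)) * w (biset_stab G ?T z)"
      using z0 by simp
    finally show ?thesis .
  qed
  then have "of_nat (card (carrier G)) * biset_mark G w ?T =
      (\<Sum>z\<in>orb ` ?A. \<Sum>p | p \<in> ?A \<and> orb p = z. ?k p * w (biset_stab G ?T (orb p)))"
    by (simp add: biset_mark_def elems_tensor sum_distrib_left)
  also have "\<dots> = (\<Sum>p\<in>?A. ?k p * w (biset_stab G ?T (orb p)))"
    by (rule sum.image_gen[OF finA, symmetric])
  also have "\<dots> = (\<Sum>(m, n)\<in>?A. of_nat (link_size G (biset_stab G M m) (biset_stab G N n)) *
      w (biset_stab G M m O biset_stab G N n))"
    by (intro sum.cong) (auto simp: stab_tensor)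
  finally show ?thesis
    by (simp add: sum.cartesian_product)
qed

text \<open>Left translation permutes \<open>N\<close>, so the right stabilizer may be averaged over its conjugates.\<close>

lemma biset_mark_tensor_average:
  fixes w :: "('g \<times> 'g) set \<Rightarrow> 'r::field_char_0"
  assumes fin: "finite (carrier G)"
  shows "(of_nat (card (carrier G)))\<^sup>2 * biset_mark G w (biset_tensor G M N) =
    (\<Sum>m\<in>elems M. \<Sum>n\<in>elems N. \<Sum>g\<in>carrier G.
      of_nat (link_size G (biset_stab G M m) (conj_pair G (g, \<one>) ` biset_stab G N n)) *
      w (biset_stab G M m O conj_pair G (g, \<one>) ` biset_stab G N n))"
proof -
  let ?F = "\<lambda>m L. of_nat (link_size G (biset_stab G M m) L) * w (biset_stab G M m O L)"
  have bij: "bij_betw (lact N g) (elems N) (elems N)" if g: "g \<in> carrier G" for g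
    by (rule bij_betwI[where g = "lact N (inv g)"])
      (use g in \<open>auto simp: N.lact_closed N.lact_one simp flip: N.lact_mult\<close>)
  have avg: "of_nat (card (carrier G)) * (\<Sum>n\<in>elems N. ?F m (biset_stab G N n)) =
      (\<Sum>g\<in>carrier G. \<Sum>n\<in>elems N. ?F m (conj_pair G (g, \<one>) ` biset_stab G N n))" for m
  proof -
    have "(\<Sum>n\<in>elems N. ?F m (biset_stab G N n)) =
        (\<Sum>n\<in>elems N. ?F m (conj_pair G (g, \<one>) ` biset_stab G N n))" if "g \<in> carrier G" for g
      unfolding sum.reindex_bij_betw[OF bij[OF that], of "\<lambda>n. ?F m (biset_stab G N n)", symmetric]
      by (rule sum.cong) (simp_all add: N.stab_lact that)
    then have "(\<Sum>g\<in>carrier G. \<Sum>n\<in>elems N. ?F m (biset_stab G N n)) =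
        (\<Sum>g\<in>carrier G. \<Sum>n\<in>elems N. ?F m (conj_pair G (g, \<one>) ` biset_stab G N n))"
      by (rule sum.cong[OF refl])
    then show ?thesis by simp
  qed
  from avg have "of_nat (card (carrier G)) * (\<Sum>m\<in>elems M. \<Sum>n\<in>elems N. ?F m (biset_stab G N n)) =
      (\<Sum>m\<in>elems M. \<Sum>g\<in>carrier G. \<Sum>n\<in>elems N. ?F m (conj_pair G (g, \<one>) ` biset_stab G N n))"
    by (subst sum_distrib_left) (rule sum.cong[OF refl])
  also have "\<dots> = (\<Sum>m\<in>elems M. \<Sum>n\<in>elems N. \<Sum>g\<in>carrier G.
      ?F m (conj_pair G (g, \<one>) ` biset_stab G N n))"
    by (intro sum.cong refl sum.swap)
  finally show ?thesis
    by (simp add: biset_mark_tensor[OF fin, symmetric] power2_eq_square mult.assoc)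
qed

end

text \<open>The product of the two bijections maps orbits onto orbits. Taking images is injective on
  orbits because they are subsets of \<open>elems M \<times> elems N\<close>, where the product map
  is injective.\<close>

lemma biset_tensor_iso:
  assumes "finite_biset G M" "finite_biset G N" "finite_biset G M'" "finite_biset G N'"
    and "biset_isomorphic G M M'" "biset_isomorphic G N N'"
  shows "biset_isomorphic G (biset_tensor G M N) (biset_tensor G M' N')"
proof -
  interpret A: finite_biset_pair G M N by (simp add: finite_biset_pair_def assms)
  interpret B: finite_biset_pair G M' N' by (simp add: finite_biset_pair_def assms)
  obtain f where f: "bij_betw f (elems M) (elems M')"
    "\<And>g x. g \<in> carrier G \<Longrightarrow> x \<in> elems M \<Longrightarrow> f (lact M g x) = lact M' g (f x)"
    "\<And>g x. g \<in> carrier G \<Longrightarrow> x \<in> elems M \<Longrightarrow> f (ract M x g) = ract M' (f x) g"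
    using assms(5) unfolding biset_isomorphic_def by auto
  obtain e where e: "bij_betw e (elems N) (elems N')"
    "\<And>g x. g \<in> carrier G \<Longrightarrow> x \<in> elems N \<Longrightarrow> e (lact N g x) = lact N' g (e x)"
    "\<And>g x. g \<in> carrier G \<Longrightarrow> x \<in> elems N \<Longrightarrow> e (ract N x g) = ract N' (e x) g"
    using assms(6) unfolding biset_isomorphic_def by auto
  let ?F = "image (map_prod f e)"
  have orb: "?F (A.orb (m, n)) = B.orb (f m, e n)" if "m \<in> elems M" "n \<in> elems N" for m n
    using that by (force simp: tensor_orbit_def image_iff f e)
  have bij: "bij_betw (map_prod f e) (elems M \<times> elems N) (elems M' \<times> elems N')"
    by (rule bij_betw_map_prod[OF f(1) e(1)])
  have inj: "inj_on ?F (A.orb ` (elems M \<times> elems N))"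
    using A.orb_subset
    by (intro inj_on_image inj_on_subset[OF bij_betw_imp_inj_on[OF bij]]) auto
  have "?F (A.orb p) = B.orb (map_prod f e p)" if "p \<in> elems M \<times> elems N" for p
    using that orb by (cases p) simp
  then have "?F ` A.orb ` (elems M \<times> elems N) = B.orb ` map_prod f e ` (elems M \<times> elems N)"
    unfolding image_image by (rule image_cong[OF refl])
  then have "bij_betw ?F (elems (biset_tensor G M N)) (elems (biset_tensor G M' N'))"
    using inj bij_betw_imp_surj_on[OF bij]
    by (simp add: A.elems_tensor B.elems_tensor bij_betw_def)
  moreover have "f m \<in> elems M'" if "m \<in> elems M" for m
    using that bij_betwE[OF f(1)] by blast
  moreover have "e n \<in> elems N'" if "n \<in> elems N" for n
    using that bij_betwE[OF e(1)] by blast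
  ultimately show ?thesis
    unfolding biset_isomorphic_def
    by (intro exI[of _ ?F])
      (auto simp: A.elems_tensor A.lact_tensor A.ract_tensor B.lact_tensor B.ract_tensor orb f e
        A.M.lact_closed A.N.ract_closed)
qed

text \<open>\<open>class_mult\<close> is a union over all pairs of representatives. All terms of the
  union agree, and there is at least one.\<close>

lemma class_mult_eq:
  assumes M: "finite_biset G M" and N: "finite_biset G N"
  shows "class_mult G (biset_class G M) (biset_class G N) = biset_class G (biset_tensor G M N)"
proof -
  have "biset_class G (biset_tensor G M' N') = biset_class G (biset_tensor G M N)"
    if "M' \<in> biset_class G M" "N' \<in> biset_class G N" for M' N'
  proof (rule biset_class_eqI)
    show "finite_biset G (biset_tensor G M' N')"
      using that finite_biset_pair.tensor_finite
      by (auto simp: biset_class_def finite_biset_pair_def)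
    show "biset_isomorphic G (biset_tensor G M' N') (biset_tensor G M N)"
      using that M N by (intro biset_tensor_iso) (auto simp: biset_class_def)
  qed
  moreover obtain M' where "M' \<in> biset_class G M"
    using exists_nat_biset[OF M] by (auto simp: biset_class_def)
  moreover obtain N' where "N' \<in> biset_class G N"
    using exists_nat_biset[OF N] by (auto simp: biset_class_def)
  ultimately show ?thesis
    unfolding class_mult_def by auto
qed

section \<open>Transitive bisets\<close>

context group
begin

lemma pair_group: "group (G \<times>\<times> G)"
  by (simp add: DirProd_group is_group)

text \<open>\<open>coset_biset\<close> inverts the right factor and \<open>biset_act\<close> inverts
  it again; what remains is left multiplication in the square.\<close>

lemma coset_biset_act:
  assumes "K \<subseteq> carrier (G \<times>\<times> G)" "p \<in> carrier (G \<times>\<times> G)" "q \<in> carrier (G \<times>\<times> G)"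
  shows "biset_act G (coset_biset G K) p (q <#\<^bsub>G \<times>\<times> G\<^esub> K) = (p \<otimes>\<^bsub>G \<times>\<times> G\<^esub> q) <#\<^bsub>G \<times>\<times> G\<^esub> K"
proof -
  interpret GG: group "G \<times>\<times> G" by (rule pair_group)
  obtain g h where p: "p = (g, h)" "g \<in> carrier G" "h \<in> carrier G" using assms(2) by auto
  obtain g' h' where q: "q = (g', h')" "g' \<in> carrier G" "h' \<in> carrier G" using assms(3) by auto
  show ?thesis
    using assms(1) p q
    by (simp add: biset_act_def coset_biset_def biset_of_action_def GG.lcos_m_assoc)
qed

lemma coset_biset_finite:
  assumes fin: "finite (carrier G)" and K: "subgroup K (G \<times>\<times> G)"
  shows "finite_biset G (coset_biset G K)"
proof -
  interpret GG: group "G \<times>\<times> G" by (rule pair_group)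
  have sub: "C \<subseteq> carrier (G \<times>\<times> G)" if "C \<in> lcosets\<^bsub>G \<times>\<times> G\<^esub> K" for C
    using that subgroup.lcosets_carrier[OF K pair_group] by blast
  have closed: "p <#\<^bsub>G \<times>\<times> G\<^esub> C \<in> lcosets\<^bsub>G \<times>\<times> G\<^esub> K"
    if "C \<in> lcosets\<^bsub>G \<times>\<times> G\<^esub> K" "p \<in> carrier (G \<times>\<times> G)" for p C
  proof -
    from that obtain q where q: "q \<in> carrier (G \<times>\<times> G)" "C = q <#\<^bsub>G \<times>\<times> G\<^esub> K"
      by (auto simp: LCOSETS_def)
    then have "p <#\<^bsub>G \<times>\<times> G\<^esub> C = (p \<otimes>\<^bsub>G \<times>\<times> G\<^esub> q) <#\<^bsub>G \<times>\<times> G\<^esub> K"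
      using GG.lcos_m_assoc[OF subgroup.subset[OF K]] that(2) by blast
    then show ?thesis
      using GG.m_closed[OF that(2) q(1)] unfolding LCOSETS_def by blast
  qed
  have "finite (lcosets\<^bsub>G \<times>\<times> G\<^esub> K)"
    using fin by (auto simp: LCOSETS_def)
  moreover have one: "(\<one>, \<one>) <#\<^bsub>G \<times>\<times> G\<^esub> C = C" if "C \<in> lcosets\<^bsub>G \<times>\<times> G\<^esub> K" for C
    using GG.lcos_mult_one[OF sub[OF that]] by simp
  moreover have assoc: "p <#\<^bsub>G \<times>\<times> G\<^esub> (q <#\<^bsub>G \<times>\<times> G\<^esub> C) = (p \<otimes>\<^bsub>G \<times>\<times> G\<^esub> q) <#\<^bsub>G \<times>\<times> G\<^esub> C"
    if "C \<in> lcosets\<^bsub>G \<times>\<times> G\<^esub> K" "p \<in> carrier (G \<times>\<times> G)" "q \<in> carrier (G \<times>\<times> G)" for p q C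
    by (rule GG.lcos_m_assoc[OF sub[OF that(1)] that(2,3)])
  ultimately show ?thesis
    by unfold_locales
      (simp_all add: coset_biset_def biset_of_action_def closed inv_mult_group)
qed

lemma coset_biset_stab:
  assumes fin: "finite (carrier G)" and K: "subgroup K (G \<times>\<times> G)" and p: "p \<in> carrier (G \<times>\<times> G)"
  shows "biset_stab G (coset_biset G K) (p <#\<^bsub>G \<times>\<times> G\<^esub> K) = conj_pair G p ` K"
proof -
  interpret GG: group "G \<times>\<times> G" by (rule pair_group)
  interpret M: finite_biset G "coset_biset G K" by (rule coset_biset_finite[OF fin K])
  note sub = subgroup.subset[OF K]
  have K_elem: "K \<in> elems (coset_biset G K)"
    using GG.lcos_mult_one[OF sub] GG.one_closed
    by (force simp: coset_biset_def biset_of_action_def LCOSETS_def)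
  have act: "biset_act G (coset_biset G K) q K = q <#\<^bsub>G \<times>\<times> G\<^esub> K" if "q \<in> carrier (G \<times>\<times> G)" for q
    using coset_biset_act[OF sub that GG.one_closed] GG.lcos_mult_one[OF sub] that
    by (simp del: one_DirProd carrier_DirProd)
  have "biset_stab G (coset_biset G K) K = K"
  proof -
    have "q <#\<^bsub>G \<times>\<times> G\<^esub> K = K \<longleftrightarrow> q \<in> K" if q: "q \<in> carrier (G \<times>\<times> G)" for q
      using GG.lcos_self[OF q K] GG.coset_join3[OF q K] by blast
    then show ?thesis
      using sub by (auto simp: M.mem_stab_iff[OF K_elem] act simp del: carrier_DirProd)
  qed
  then show ?thesis
    using M.stab_act[OF p K_elem] act[OF p] by simp
qed

text \<open>All stabilizers are conjugates of \<open>K\<close>, and there are |G|^2 / |K| cosets.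
  The product form avoids a division in the ring of values.\<close>

lemma biset_mark_coset:
  fixes w :: "('a \<times> 'a) set \<Rightarrow> 'r::comm_ring_1"
  assumes fin: "finite (carrier G)" and K: "subgroup K (G \<times>\<times> G)"
    and inv: "\<And>p. p \<in> carrier (G \<times>\<times> G) \<Longrightarrow> w (conj_pair G p ` K) = w K"
  shows "of_nat (card K) * biset_mark G w (coset_biset G K) = (of_nat (card (carrier G)))\<^sup>2 * w K"
proof -
  interpret GG: group "G \<times>\<times> G" by (rule pair_group)
  have "biset_mark G w (coset_biset G K) = (\<Sum>C\<in>lcosets\<^bsub>G \<times>\<times> G\<^esub> K. w K)"
    unfolding biset_mark_def
  proof (rule sum.cong)
    show "elems (coset_biset G K) = lcosets\<^bsub>G \<times>\<times> G\<^esub> K"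
      by (simp add: coset_biset_def biset_of_action_def)
    show "w (biset_stab G (coset_biset G K) C) = w K" if "C \<in> lcosets\<^bsub>G \<times>\<times> G\<^esub> K" for C
      using that coset_biset_stab[OF fin K] inv unfolding LCOSETS_def by auto
  qed
  moreover have "card (lcosets\<^bsub>G \<times>\<times> G\<^esub> K) * card K = (card (carrier G))\<^sup>2"
    using GG.l_lagrange[OF _ K] fin by (simp add: Coset.order_def power2_eq_square card_cartesian_product)
  ultimately show ?thesis
    by (simp flip: of_nat_mult of_nat_power mult.assoc) (simp add: mult.commute)
qed

end

lemma (in finite_biset) transitive_isomorphic:
  assumes fin: "finite (carrier G)" and x: "x \<in> elems M"
    and trans: "elems M = (\<lambda>p. biset_act G M p x) ` carrier (G \<times>\<times> G)"
  shows "biset_isomorphic G (coset_biset G (biset_stab G M x)) M"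
proof -
  interpret GG: group "G \<times>\<times> G" by (rule pair_group)
  let ?K = "biset_stab G M x" and ?N = "coset_biset G (biset_stab G M x)"
  note K = stab_subgroup[OF x]
  note sub = subgroup.subset[OF K]
  \<comment> \<open>Any element of the coset may be chosen: two of them differ by an element of the
    stabilizer of \<open>x\<close> and send \<open>x\<close> to the same point.\<close>
  define f where "f C = biset_act G M (SOME p. p \<in> C) x" for C
  have f: "f (p <#\<^bsub>G \<times>\<times> G\<^esub> ?K) = biset_act G M p x" if p: "p \<in> carrier (G \<times>\<times> G)" for p
  proof -
    have "(SOME q. q \<in> p <#\<^bsub>G \<times>\<times> G\<^esub> ?K) \<in> p <#\<^bsub>G \<times>\<times> G\<^esub> ?K"
      by (rule someI, rule GG.lcos_self[OF p K])
    then obtain u where "u \<in> ?K" "(SOME q. q \<in> p <#\<^bsub>G \<times>\<times> G\<^esub> ?K) = p \<otimes>\<^bsub>G \<times>\<times> G\<^esub> u"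
      by (auto simp: l_coset_def)
    then show ?thesis
      using p x by (simp add: f_def act_mult mem_stab_iff del: carrier_DirProd)
  qed
  have elems: "elems ?N = (\<lambda>p. p <#\<^bsub>G \<times>\<times> G\<^esub> ?K) ` carrier (G \<times>\<times> G)"
    by (auto simp: coset_biset_def biset_of_action_def LCOSETS_def)
  have inj: "p <#\<^bsub>G \<times>\<times> G\<^esub> ?K = q <#\<^bsub>G \<times>\<times> G\<^esub> ?K"
    if p: "p \<in> carrier (G \<times>\<times> G)" and q: "q \<in> carrier (G \<times>\<times> G)"
      and eq: "biset_act G M p x = biset_act G M q x" for p q
  proof -
    have "biset_act G M (inv\<^bsub>G \<times>\<times> G\<^esub> p \<otimes>\<^bsub>G \<times>\<times> G\<^esub> q) x = x"
      using act_inv[OF p x] p q x by (simp add: act_mult eq[symmetric] del: carrier_DirProd)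
    then have "inv\<^bsub>G \<times>\<times> G\<^esub> p \<otimes>\<^bsub>G \<times>\<times> G\<^esub> q \<in> ?K"
      using p q by (simp add: mem_stab_iff[OF x] del: carrier_DirProd)
    then show ?thesis
      using GG.l_repr_independence[OF _ p K] subgroup.lcos_module_rev[OF K pair_group p q] by simp
  qed
  have "bij_betw f (elems ?N) (elems M)"
    unfolding bij_betw_def
  proof
    show "inj_on f (elems ?N)"
    proof (rule inj_onI)
      fix C D assume "C \<in> elems ?N" "D \<in> elems ?N" and eq: "f C = f D"
      then obtain p q where "p \<in> carrier (G \<times>\<times> G)" "C = p <#\<^bsub>G \<times>\<times> G\<^esub> ?K"
        "q \<in> carrier (G \<times>\<times> G)" "D = q <#\<^bsub>G \<times>\<times> G\<^esub> ?K"
        unfolding elems by blast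
      with eq show "C = D" using inj[of p q] by (simp only: f)
    qed
    show "f ` elems ?N = elems M"
      unfolding elems image_image trans by (rule image_cong) (simp_all add: f del: carrier_DirProd)
  qed
  moreover have "f (biset_act G ?N p C) = biset_act G M p (f C)"
    if "p \<in> carrier (G \<times>\<times> G)" "C \<in> elems ?N" for p C
    using that x by (auto simp: elems f coset_biset_act[OF sub] act_mult simp del: carrier_DirProd)
  moreover have "lact ?N g C = biset_act G ?N (g, \<one>) C \<and> ract ?N C g = biset_act G ?N (\<one>, inv g) C"
    if "g \<in> carrier G" "C \<in> elems ?N" for g C
  proof -
    interpret N: finite_biset G ?N by (rule coset_biset_finite[OF fin K])
    show ?thesis using that by (simp add: biset_act_def N.ract_one N.lact_one N.lact_closed)
  qed
  moreover have "lact M g y = biset_act G M (g, \<one>) y \<and> ract M y g = biset_act G M (\<one>, inv g) y"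
    if "g \<in> carrier G" "y \<in> elems M" for g y
    using that by (simp add: biset_act_def ract_one lact_one lact_closed)
  ultimately show ?thesis
    unfolding biset_isomorphic_def by (intro exI[of _ f]) (auto dest: bij_betwE)
qed

text \<open>The coset p K is as good a base point of the transitive biset as K, and its stabilizer
  is the conjugate of \<open>K\<close> by \<open>p\<close>.\<close>

lemma (in group) coset_biset_conj:
  assumes fin: "finite (carrier G)" and K: "subgroup K (G \<times>\<times> G)" and p: "p \<in> carrier (G \<times>\<times> G)"
  shows "biset_class G (coset_biset G (conj_pair G p ` K)) = biset_class G (coset_biset G K)"
proof -
  interpret GG: group "G \<times>\<times> G" by (rule pair_group)
  interpret M: finite_biset G "coset_biset G K" by (rule coset_biset_finite[OF fin K])
  let ?x = "p <#\<^bsub>G \<times>\<times> G\<^esub> K"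
  have elems: "elems (coset_biset G K) = (\<lambda>q. q <#\<^bsub>G \<times>\<times> G\<^esub> K) ` carrier (G \<times>\<times> G)"
    by (auto simp: coset_biset_def biset_of_action_def LCOSETS_def)
  have x: "?x \<in> elems (coset_biset G K)"
    using p by (simp add: elems)
  have "elems (coset_biset G K) = (\<lambda>q. biset_act G (coset_biset G K) q ?x) ` carrier (G \<times>\<times> G)"
  proof
    show "elems (coset_biset G K) \<subseteq> (\<lambda>q. biset_act G (coset_biset G K) q ?x) ` carrier (G \<times>\<times> G)"
    proof
      fix C assume "C \<in> elems (coset_biset G K)"
      then obtain q where q: "q \<in> carrier (G \<times>\<times> G)" "C = q <#\<^bsub>G \<times>\<times> G\<^esub> K"
        by (auto simp: elems)
      then have "C = biset_act G (coset_biset G K) (q \<otimes>\<^bsub>G \<times>\<times> G\<^esub> inv\<^bsub>G \<times>\<times> G\<^esub> p) ?x"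
        using p by (simp add: coset_biset_act[OF subgroup.subset[OF K]] GG.m_assoc
            del: carrier_DirProd one_DirProd)
      then show "C \<in> (\<lambda>q. biset_act G (coset_biset G K) q ?x) ` carrier (G \<times>\<times> G)"
        using p q(1) by (auto simp del: carrier_DirProd)
    qed
  qed (use M.act_closed x in \<open>auto simp del: carrier_DirProd\<close>)
  from M.transitive_isomorphic[OF fin x this]
  have "biset_isomorphic G (coset_biset G (conj_pair G p ` K)) (coset_biset G K)"
    by (simp add: coset_biset_stab[OF fin K p])
  moreover have "finite_biset G (coset_biset G (conj_pair G p ` K))"
    using coset_biset_finite[OF fin M.stab_subgroup[OF x]] by (simp add: coset_biset_stab[OF fin K p])
  ultimately show ?thesis
    by (rule biset_class_eqI[rotated])
qed

section \<open>The free module on biset classes\<close>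

lemma lookup_scale [simp]:
  "Poly_Mapping.lookup (Poly_Mapping.map ((*) r) x) c = r * Poly_Mapping.lookup x c"
  for r :: "'r::comm_ring_1"
  by (simp add: Poly_Mapping.map.rep_eq when_def)

interpretation pm: Modules.module "\<lambda>r :: 'r::comm_ring_1. Poly_Mapping.map ((*) r)"
  by unfold_locales
    (auto intro!: poly_mapping_eqI simp: lookup_add algebra_simps)

lemma (in finite_biset) restrict_finite:
  assumes "S \<subseteq> elems M" "\<And>g x. g \<in> carrier G \<Longrightarrow> x \<in> S \<Longrightarrow> lact M g x \<in> S \<and> ract M x g \<in> S"
  shows "finite_biset G (M\<lparr>elems := S\<rparr>)"
  by unfold_locales
    (use assms in \<open>auto simp: finite_subset[OF _ finite_elems] lact_one ract_one lact_mult
      ract_mult lact_ract subset_iff\<close>)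

lemma (in finite_biset) restrict_sum_isomorphic:
  assumes "S \<subseteq> elems M"
    and "\<And>g x. g \<in> carrier G \<Longrightarrow> x \<in> S \<Longrightarrow> lact M g x \<in> S \<and> ract M x g \<in> S"
  shows "biset_isomorphic G (biset_sum (M\<lparr>elems := S\<rparr>) (M\<lparr>elems := elems M - S\<rparr>)) M"
  unfolding biset_isomorphic_def
  by (intro exI[of _ "case_sum id id"])
    (use assms in \<open>auto simp: bij_betw_def inj_on_def biset_sum_def image_Un Plus_def image_image\<close>)

text \<open>Modulo the relations every biset is the sum of its orbits.\<close>

lemma single_class_in_span:
  assumes "finite (carrier G)" "finite_biset G (M :: ('g, nat) biset)"
  shows "Poly_Mapping.single (biset_class G M) (1::'r::comm_ring_1) \<in>
    pm.span (burnside_relations G \<union>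
      {Poly_Mapping.single (biset_class G (coset_biset G K)) 1 |K. subgroup K (G \<times>\<times> G)})"
    (is "_ \<in> pm.span ?B")
  using assms(2)
proof (induction "card (elems M)" arbitrary: M rule: less_induct)
  case less
  interpret finite_biset G M by (rule less.prems)
  interpret GG: group "G \<times>\<times> G" by (rule pair_group)
  have rel: "Poly_Mapping.single (biset_class G (biset_sum A B)) 1
      - (Poly_Mapping.single (biset_class G A) 1 + Poly_Mapping.single (biset_class G B) 1) \<in> pm.span ?B"
    if "finite_biset G A" "finite_biset G B" for A B :: "('g, nat) biset"
    using that by (intro pm.span_base) (auto simp: burnside_relations_def)
  show ?case
  proof (cases "elems M = {}")
    case True
    \<comment> \<open>For an empty biset the relation for \<open>M\<close> and \<open>M\<close>
      reads [M] - ([M] + [M]) = -[M], so [M] itself is a relation up to sign.\<close>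
    then have "biset_isomorphic G (biset_sum M M) M"
      by (simp add: biset_isomorphic_def biset_sum_def Plus_def bij_betw_def)
    then have "biset_class G (biset_sum M M) = biset_class G M"
      by (rule biset_class_eqI[OF biset_sum_finite[OF less.prems less.prems]])
    with rel[OF less.prems less.prems] show ?thesis
      using pm.span_neg by fastforce
  next
    case False
    then obtain x where x: "x \<in> elems M" by auto
    define S where "S = (\<lambda>p. biset_act G M p x) ` carrier (G \<times>\<times> G)"
    have S: "S \<subseteq> elems M" using act_closed[OF _ x] by (auto simp: S_def simp del: carrier_DirProd)
    have act_S: "biset_act G M p y \<in> S" if "p \<in> carrier (G \<times>\<times> G)" "y \<in> S" for p y
      using that x by (auto simp: S_def simp del: carrier_DirProd simp flip: act_mult)
    have act: "lact M g y = biset_act G M (g, \<one>\<^bsub>G\<^esub>) y \<and> ract M y g = biset_act G M (\<one>\<^bsub>G\<^esub>, inv\<^bsub>G\<^esub> g) y"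
      if "g \<in> carrier G" "y \<in> elems M" for g y
      using that by (simp add: biset_act_def ract_one lact_one lact_closed)
    have closed: "lact M g y \<in> S \<and> ract M y g \<in> S" if "g \<in> carrier G" "y \<in> S" for g y
      using that S act[of g y] act_S by auto
    have co_act: "y \<in> S" if "biset_act G M p y \<in> S" "p \<in> carrier (G \<times>\<times> G)" "y \<in> elems M" for p y
      using act_S[OF _ that(1), of "inv\<^bsub>G \<times>\<times> G\<^esub> p"] act_inv[OF that(2,3)] GG.inv_closed[OF that(2)] by simp
    have co_closed: "lact M g y \<in> elems M - S \<and> ract M y g \<in> elems M - S"
      if "g \<in> carrier G" "y \<in> elems M - S" for g y
      using that act[of g y] co_act[of "(g, \<one>\<^bsub>G\<^esub>)" y] co_act[of "(\<one>\<^bsub>G\<^esub>, inv\<^bsub>G\<^esub> g)" y] lact_closed[of g y]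
        ract_closed[of g y] by auto
    let ?M1 = "M\<lparr>elems := S\<rparr>" and ?M2 = "M\<lparr>elems := elems M - S\<rparr>"
    have M1: "finite_biset G ?M1" using restrict_finite[OF S closed] by blast
    have M2: "finite_biset G ?M2" using restrict_finite[OF _ co_closed] by blast
    have xS: "x \<in> S" using act_one[OF x] GG.one_closed unfolding S_def by (metis image_eqI)
    have "card (elems ?M2) < card (elems M)"
      using finite_elems x xS by (auto intro!: psubset_card_mono)
    from less.hyps[OF this M2]
    have 2: "Poly_Mapping.single (biset_class G ?M2) (1::'r) \<in> pm.span ?B" .
    interpret M1: finite_biset G ?M1 by (rule M1)
    have "biset_act G ?M1 = biset_act G M" by (auto simp: biset_act_def)
    then have "biset_isomorphic G (coset_biset G (biset_stab G ?M1 x)) ?M1"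
      using xS by (intro M1.transitive_isomorphic assms(1)) (simp_all add: S_def)
    then have "biset_class G ?M1 = biset_class G (coset_biset G (biset_stab G ?M1 x))"
      using biset_class_eqI coset_biset_finite[OF assms(1)] M1.stab_subgroup xS by fastforce
    then have 1: "Poly_Mapping.single (biset_class G ?M1) (1::'r) \<in> pm.span ?B"
      using M1.stab_subgroup[of x] xS by (intro pm.span_base) auto
    have "biset_class G (biset_sum ?M1 ?M2) = biset_class G M"
      using biset_class_eqI[OF biset_sum_finite[OF M1 M2] restrict_sum_isomorphic[OF S closed]] by simp
    with pm.span_add[OF rel[OF M1 M2] pm.span_add[OF 1 2]] show ?thesis
      by simp
  qed
qed

lemma free_burnside_in_span:
  assumes "finite (carrier G)" "x \<in> carrier (free_burnside G :: ('r::comm_ring_1, _) module)"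
  shows "x \<in> pm.span (burnside_relations G \<union>
      {Poly_Mapping.single (biset_class G (coset_biset G K)) 1 |K. subgroup K (G \<times>\<times> G)})"
    (is "_ \<in> pm.span ?B")
proof -
  have "x = (\<Sum>c\<in>Poly_Mapping.keys x. Poly_Mapping.single c (Poly_Mapping.lookup x c))"
    by (rule poly_mapping_eqI) (simp add: lookup_sum lookup_single when_def in_keys_iff)
  also have "\<dots> = (\<Sum>c\<in>Poly_Mapping.keys x.
      Poly_Mapping.map ((*) (Poly_Mapping.lookup x c)) (Poly_Mapping.single c 1))"
    by (intro sum.cong refl poly_mapping_eqI) (simp add: lookup_single when_def)
  also have "\<dots> \<in> pm.span ?B"
    using assms single_class_in_span[OF assms(1)]
    by (intro pm.span_sum pm.span_scale) (auto simp: free_burnside_def biset_classes_def)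
  finally show ?thesis .
qed

section \<open>Marks of formal sums\<close>

text \<open>The linear extension of the mark from classes to formal sums. It is defined for all
  finitely supported functions, so linearity holds without a carrier condition; a key that is no
  biset class contributes an arbitrary value.\<close>

definition formal_mark ::
    "('g, 'm) monoid_scheme \<Rightarrow> (('g \<times> 'g) set \<Rightarrow> 'r::comm_ring_1) \<Rightarrow>
      (('g, nat) biset set \<Rightarrow>\<^sub>0 'r) \<Rightarrow> 'r"
  where "formal_mark G w x =
    (\<Sum>c\<in>Poly_Mapping.keys x. Poly_Mapping.lookup x c * biset_mark G w (SOME M. M \<in> c))"

lemma formal_mark_superset:
  assumes "finite A" "Poly_Mapping.keys x \<subseteq> A"
  shows "formal_mark G w x =
    (\<Sum>c\<in>A. Poly_Mapping.lookup x c * biset_mark G w (SOME M. M \<in> c))"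
  unfolding formal_mark_def using assms
  by (intro sum.mono_neutral_left) (auto simp: in_keys_iff)

lemma formal_mark_add: "formal_mark G w (x + y) = formal_mark G w x + formal_mark G w y"
proof -
  let ?A = "Poly_Mapping.keys x \<union> Poly_Mapping.keys y"
  show ?thesis
    using keys_add[of x y]
    by (simp add: formal_mark_superset[of ?A] lookup_add distrib_right sum.distrib)
qed

lemma formal_mark_zero [simp]: "formal_mark G w 0 = 0"
  by (simp add: formal_mark_def)

lemma formal_mark_scale: "formal_mark G w (Poly_Mapping.map ((*) r) x) = r * formal_mark G w x"
proof -
  have "Poly_Mapping.keys (Poly_Mapping.map ((*) r) x) \<subseteq> Poly_Mapping.keys x"
    by (auto simp: in_keys_iff)
  then show ?thesis
    by (simp add: formal_mark_superset[of "Poly_Mapping.keys x"] sum_distrib_left mult.assoc)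
qed

lemma formal_mark_uminus: "formal_mark G w (- x) = - formal_mark G w x"
  using formal_mark_add[of G w x "- x"] by (simp add: eq_neg_iff_add_eq_0 add.commute)

lemma formal_mark_diff: "formal_mark G w (x - y) = formal_mark G w x - formal_mark G w y"
  using formal_mark_add[of G w x "- y"] by (simp add: formal_mark_uminus)

lemma formal_mark_sum: "formal_mark G w (\<Sum>i\<in>A. f i) = (\<Sum>i\<in>A. formal_mark G w (f i))"
  by (induction A rule: infinite_finite_induct) (simp_all add: formal_mark_add)

lemma formal_mark_single:
  assumes "finite_biset G M"
  shows "formal_mark G w (Poly_Mapping.single (biset_class G M) r) = r * biset_mark G w M"
proof -
  obtain N :: "('a, nat) biset" where "N \<in> biset_class G M"
    using exists_nat_biset[OF assms] by (auto simp: biset_class_def)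
  then have "(SOME N. N \<in> biset_class G M) \<in> biset_class G M"
    by (rule someI)
  then have "biset_mark G w (SOME N. N \<in> biset_class G M) = biset_mark G w M"
    by (auto simp: biset_class_def intro: biset_mark_iso)
  then show ?thesis
    by (simp add: formal_mark_superset[of "{biset_class G M}"])
qed

lemma formal_mark_relation:
  assumes "x \<in> relation_module G"
  shows "formal_mark G w x = 0"
proof -
  have "pm.subspace {x. formal_mark G w x = 0}"
    by (auto simp: pm.subspace_def formal_mark_add formal_mark_scale)
  moreover have "burnside_relations G \<subseteq> {x. formal_mark G w x = 0}"
    by (auto simp: burnside_relations_def formal_mark_diff formal_mark_add formal_mark_single
        biset_sum_finite biset_mark_sum)
  ultimately show ?thesis
    using assms pm.span_minimal unfolding relation_module_def by blast
qed

section \<open>Subgroups of the square of the symmetric group of degree three\<close>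

text \<open>A copy of the group on which finite checks can be evaluated. R_i stands for b^i and T_i
  for a b^i, permutations being composed from right to left; \<open>s3_perm\<close> makes the
  identification.\<close>

datatype s3 = R0 | R1 | R2 | T0 | T1 | T2

fun s3_mult :: "s3 \<Rightarrow> s3 \<Rightarrow> s3" where
  "s3_mult R0 R0 = R0"
| "s3_mult R0 R1 = R1"
| "s3_mult R0 R2 = R2"
| "s3_mult R0 T0 = T0"
| "s3_mult R0 T1 = T1"
| "s3_mult R0 T2 = T2"
| "s3_mult R1 R0 = R1"
| "s3_mult R1 R1 = R2"
| "s3_mult R1 R2 = R0"
| "s3_mult R1 T0 = T2"
| "s3_mult R1 T1 = T0"
| "s3_mult R1 T2 = T1"
| "s3_mult R2 R0 = R2"
| "s3_mult R2 R1 = R0"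
| "s3_mult R2 R2 = R1"
| "s3_mult R2 T0 = T1"
| "s3_mult R2 T1 = T2"
| "s3_mult R2 T2 = T0"
| "s3_mult T0 R0 = T0"
| "s3_mult T0 R1 = T1"
| "s3_mult T0 R2 = T2"
| "s3_mult T0 T0 = R0"
| "s3_mult T0 T1 = R1"
| "s3_mult T0 T2 = R2"
| "s3_mult T1 R0 = T1"
| "s3_mult T1 R1 = T2"
| "s3_mult T1 R2 = T0"
| "s3_mult T1 T0 = R2"
| "s3_mult T1 T1 = R0"
| "s3_mult T1 T2 = R1"
| "s3_mult T2 R0 = T2"
| "s3_mult T2 R1 = T0"
| "s3_mult T2 R2 = T1"
| "s3_mult T2 T0 = R1"
| "s3_mult T2 T1 = R2"
| "s3_mult T2 T2 = R0"

fun s3_inv :: "s3 \<Rightarrow> s3" where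
  "s3_inv R1 = R2"
| "s3_inv R2 = R1"
| "s3_inv x = x"

definition s3_all :: "s3 list"
  where "s3_all = [R0, R1, R2, T0, T1, T2]"

definition pair_mult :: "s3 \<times> s3 \<Rightarrow> s3 \<times> s3 \<Rightarrow> s3 \<times> s3"
  where "pair_mult p q = (s3_mult (fst p) (fst q), s3_mult (snd p) (snd q))"

definition s3_conj :: "s3 \<Rightarrow> s3 \<Rightarrow> s3"
  where "s3_conj g x = s3_mult (s3_mult g x) (s3_inv g)"

definition pair_conj :: "s3 \<times> s3 \<Rightarrow> s3 \<times> s3 \<Rightarrow> s3 \<times> s3"
  where "pair_conj p q = (s3_conj (fst p) (fst q), s3_conj (snd p) (snd q))"

text \<open>Generators and elements of representatives of the 22 conjugacy classes of subgroups of
  \<open>S\<^sub>3 \<times> S\<^sub>3\<close>; in \<open>elts\<close> every element after the first is an earlier one times a generator.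
  The order is that of the $H_{i,j}$, the $H^\Delta_t$ and $H_6$, $H_7$, $H_8$.\<close>

definition rep_table :: "((s3 \<times> s3) list \<times> (s3 \<times> s3) list) list"
  where "rep_table = [
    ([],
     [(R0, R0)]),
    ([(R0, T0)],
     [(R0, R0), (R0, T0)]),
    ([(R0, R1)],
     [(R0, R0), (R0, R1), (R0, R2)]),
    ([(R0, T0), (R0, R1)],
     [(R0, R0), (R0, T0), (R0, R1), (R0, T1), (R0, T2), (R0, R2)]),
    ([(T0, R0)],
     [(R0, R0), (T0, R0)]),
    ([(T0, R0), (R0, T0)],
     [(R0, R0), (T0, R0), (R0, T0), (T0, T0)]),
    ([(T0, R0), (R0, R1)],
     [(R0, R0), (T0, R0), (R0, R1), (T0, R1), (R0, R2), (T0, R2)]),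
    ([(T0, R0), (R0, T0), (R0, R1)],
     [(R0, R0), (T0, R0), (R0, T0), (R0, R1), (T0, T0), (T0, R1), (R0, T1), (R0, T2), (R0, R2),
      (T0, T1), (T0, T2), (T0, R2)]),
    ([(R1, R0)],
     [(R0, R0), (R1, R0), (R2, R0)]),
    ([(R1, R0), (R0, T0)],
     [(R0, R0), (R1, R0), (R0, T0), (R2, R0), (R1, T0), (R2, T0)]),
    ([(R1, R0), (R0, R1)],
     [(R0, R0), (R1, R0), (R0, R1), (R2, R0), (R1, R1), (R0, R2), (R2, R1), (R1, R2), (R2, R2)]),
    ([(R1, R0), (R0, T0), (R0, R1)],
     [(R0, R0), (R1, R0), (R0, T0), (R0, R1), (R2, R0), (R1, T0), (R1, R1), (R0, T1), (R0, T2),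
      (R0, R2), (R2, T0), (R2, R1), (R1, T1), (R1, T2), (R1, R2), (R2, T1), (R2, T2), (R2, R2)]),
    ([(T0, R0), (R1, R0)],
     [(R0, R0), (T0, R0), (R1, R0), (T1, R0), (T2, R0), (R2, R0)]),
    ([(T0, R0), (R1, R0), (R0, T0)],
     [(R0, R0), (T0, R0), (R1, R0), (R0, T0), (T1, R0), (T0, T0), (T2, R0), (R2, R0), (R1, T0),
      (T1, T0), (T2, T0), (R2, T0)]),
    ([(T0, R0), (R1, R0), (R0, R1)],
     [(R0, R0), (T0, R0), (R1, R0), (R0, R1), (T1, R0), (T0, R1), (T2, R0), (R2, R0), (R1, R1),
      (R0, R2), (T1, R1), (T0, R2), (T2, R1), (R2, R1), (R1, R2), (T1, R2), (T2, R2), (R2, R2)]),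
    ([(T0, R0), (R1, R0), (R0, T0), (R0, R1)],
     [(R0, R0), (T0, R0), (R1, R0), (R0, T0), (R0, R1), (T1, R0), (T0, T0), (T0, R1), (T2, R0),
      (R2, R0), (R1, T0), (R1, R1), (R0, T1), (R0, T2), (R0, R2), (T1, T0), (T1, R1), (T0, T1),
      (T0, T2), (T0, R2), (T2, T0), (T2, R1), (R2, T0), (R2, R1), (R1, T1), (R1, T2), (R1, R2),
      (T1, T1), (T1, T2), (T1, R2), (T2, T1), (T2, T2), (T2, R2), (R2, T1), (R2, T2), (R2, R2)]),
    ([(T0, T0)],
     [(R0, R0), (T0, T0)]),
    ([(R1, R1)],
     [(R0, R0), (R1, R1), (R2, R2)]),
    ([(T0, T0), (R1, R1)],
     [(R0, R0), (T0, T0), (R1, R1), (T1, T1), (T2, T2), (R2, R2)]),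
    ([(T0, T0), (R0, R1)],
     [(R0, R0), (T0, T0), (R0, R1), (T0, T1), (T0, T2), (R0, R2)]),
    ([(T0, T0), (R1, R0)],
     [(R0, R0), (T0, T0), (R1, R0), (T1, T0), (T2, T0), (R2, R0)]),
    ([(T0, T0), (R1, R0), (R0, R1)],
     [(R0, R0), (T0, T0), (R1, R0), (R0, R1), (T1, T0), (T0, T1), (T2, T0), (R2, R0), (R1, R1),
      (T0, T2), (R0, R2), (T1, T1), (T2, T1), (R2, R1), (T2, T2), (R1, R2), (T1, T2), (R2, R2)])]"

definition gens :: "nat \<Rightarrow> (s3 \<times> s3) list"
  where "gens i = fst (rep_table ! i)"

definition elts :: "nat \<Rightarrow> (s3 \<times> s3) list"
  where "elts i = snd (rep_table ! i)"

text \<open>An entry \<open>(x, t, g, h)\<close> of row \<open>i\<close> says that the \<open>(g, h)\<close>-conjugate of the \<open>t\<close>-th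
  representative is larger than the \<open>i\<close>-th one and contained in every subgroup containing
  the \<open>i\<close>-th one and \<open>x\<close>.\<close>

definition extension_table :: "((s3 \<times> s3) \<times> nat \<times> s3 \<times> s3) list list"
  where "extension_table = [
    [((R0, R1), 2, R0, R0), ((R0, R2), 2, R0, T0), ((R0, T0), 1, R0, R0), ((R0, T1), 1, R0, R1),
     ((R0, T2), 1, R0, R2), ((R1, R0), 8, R0, R0), ((R1, R1), 17, R0, R0),
     ((R1, R2), 17, R0, T0), ((R1, T0), 8, T0, R0), ((R1, T1), 8, T0, R0),
     ((R1, T2), 8, T0, R0), ((R2, R0), 8, T0, R0), ((R2, R1), 17, T0, R0),
     ((R2, R2), 17, T0, T0), ((R2, T0), 8, R0, R0), ((R2, T1), 8, R0, R0),
     ((R2, T2), 8, R0, R0), ((T0, R0), 4, R0, R0), ((T0, R1), 2, R0, T0), ((T0, R2), 2, R0, R0),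
     ((T0, T0), 16, R0, R0), ((T0, T1), 16, R0, R1), ((T0, T2), 16, R0, R2),
     ((T1, R0), 4, R1, R0), ((T1, R1), 2, R0, T0), ((T1, R2), 2, R0, R0),
     ((T1, T0), 16, R1, R0), ((T1, T1), 16, R1, R1), ((T1, T2), 16, R1, R2),
     ((T2, R0), 4, R2, R0), ((T2, R1), 2, R0, T0), ((T2, R2), 2, R0, R0),
     ((T2, T0), 16, R2, R0), ((T2, T1), 16, R2, R1), ((T2, T2), 16, R2, R2)],
    [((R0, R1), 2, R0, R0), ((R0, R2), 2, R0, T0), ((R1, R0), 8, R0, R0),
     ((R1, R1), 17, R0, R0), ((R1, R2), 17, R0, T0), ((R2, R0), 8, T0, R0),
     ((R2, R1), 17, T0, R0), ((R2, R2), 17, T0, T0), ((T0, R0), 5, R0, R0),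
     ((T0, R1), 2, R0, T0), ((T0, R2), 2, R0, R0), ((T1, R0), 5, R1, R0), ((T1, R1), 2, R0, T0),
     ((T1, R2), 2, R0, R0), ((T2, R0), 5, R2, R0), ((T2, R1), 2, R0, T0), ((T2, R2), 2, R0, R0)],
    [((R0, T0), 3, R0, R0), ((R1, R0), 10, R0, R0), ((R1, T0), 10, T0, R0),
     ((R2, R0), 10, T0, R0), ((R2, T0), 10, R0, R0), ((T0, R0), 6, R0, R0),
     ((T0, T0), 19, R0, R0), ((T1, R0), 6, R1, R0), ((T1, T0), 19, R1, R0),
     ((T2, R0), 6, R2, R0), ((T2, T0), 19, R2, R0)],
    [((R1, R0), 10, R0, R0), ((R2, R0), 10, T0, R0), ((T0, R0), 7, R0, R0),
     ((T1, R0), 7, R1, R0), ((T2, R0), 7, R2, R0)],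
    [((R0, R1), 2, R0, R0), ((R0, R2), 2, R0, T0), ((R0, T0), 5, R0, R0), ((R0, T1), 5, R0, R1),
     ((R0, T2), 5, R0, R2), ((R1, R0), 8, R0, R0), ((R1, R1), 17, R0, R0),
     ((R1, R2), 17, R0, T0), ((R1, T0), 8, T0, R0), ((R1, T1), 8, T0, R0),
     ((R1, T2), 8, T0, R0), ((R2, R0), 8, T0, R0), ((R2, R1), 17, T0, R0),
     ((R2, R2), 17, T0, T0), ((R2, T0), 8, R0, R0), ((R2, T1), 8, R0, R0), ((R2, T2), 8, R0, R0)],
    [((R0, R1), 3, R0, R0), ((R0, R2), 3, R0, T0), ((R1, R0), 9, R0, R0),
     ((R1, R1), 18, R0, R0), ((R1, R2), 18, R0, T0), ((R2, R0), 9, T0, R0),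
     ((R2, R1), 18, T0, R0), ((R2, R2), 18, T0, T0)],
    [((R0, T0), 7, R0, R0), ((R1, R0), 10, R0, R0), ((R1, T0), 10, T0, R0),
     ((R2, R0), 10, T0, R0), ((R2, T0), 10, R0, R0)],
    [((R1, R0), 11, R0, R0), ((R2, R0), 11, T0, R0)],
    [((R0, R1), 10, R0, R0), ((R0, R2), 10, R0, T0), ((R0, T0), 9, R0, R0),
     ((R0, T1), 9, R0, R1), ((R0, T2), 9, R0, R2), ((T0, R0), 12, R0, R0),
     ((T0, R1), 10, R0, T0), ((T0, R2), 10, R0, R0), ((T0, T0), 20, R0, R0),
     ((T0, T1), 20, R0, R1), ((T0, T2), 20, R0, R2)],
    [((R0, R1), 10, R0, R0), ((R0, R2), 10, R0, T0), ((T0, R0), 13, R0, R0),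
     ((T0, R1), 10, R0, T0), ((T0, R2), 10, R0, R0)],
    [((R0, T0), 11, R0, R0), ((T0, R0), 14, R0, R0), ((T0, T0), 21, R0, R0)],
    [((T0, R0), 15, R0, R0)],
    [((R0, R1), 10, R0, R0), ((R0, R2), 10, R0, T0), ((R0, T0), 13, R0, R0),
     ((R0, T1), 13, R0, R1), ((R0, T2), 13, R0, R2)],
    [((R0, R1), 11, R0, R0), ((R0, R2), 11, R0, T0)],
    [((R0, T0), 15, R0, R0)],
    [],
    [((R0, R1), 2, R0, R0), ((R0, R2), 2, R0, T0), ((R0, T0), 5, R0, R0), ((R0, T1), 2, R0, T0),
     ((R0, T2), 2, R0, R0), ((R1, R0), 8, R0, R0), ((R1, R1), 17, R0, R0),
     ((R1, R2), 17, R0, T0), ((R1, T0), 8, T0, R0), ((R1, T1), 2, R0, T0),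
     ((R1, T2), 2, R0, R0), ((R2, R0), 8, T0, R0), ((R2, R1), 17, T0, R0),
     ((R2, R2), 17, T0, T0), ((R2, T0), 8, R0, R0), ((R2, T1), 2, R0, T0), ((R2, T2), 2, R0, R0)],
    [((R0, R1), 10, T0, R0), ((R0, R2), 10, R0, T0), ((R0, T0), 3, R0, R0),
     ((R0, T1), 3, R0, R0), ((R0, T2), 3, R0, R0), ((T0, R0), 6, R0, R0), ((T0, R1), 6, R0, R0),
     ((T0, R2), 6, R0, R0), ((T0, T0), 18, R0, R0), ((T0, T1), 18, R0, R1),
     ((T0, T2), 18, R0, R2)],
    [((R0, R1), 10, T0, R0), ((R0, R2), 10, R0, T0), ((R0, T0), 10, R0, R0),
     ((R0, T1), 10, R0, R0), ((R0, T2), 10, R0, R0)],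
    [((R0, T0), 7, R0, R0), ((R1, R0), 10, R0, R0), ((R1, T0), 10, T0, R0),
     ((R2, R0), 10, T0, R0), ((R2, T0), 10, R0, R0)],
    [((R0, R1), 10, R0, R0), ((R0, R2), 10, R0, T0), ((R0, T0), 13, R0, R0),
     ((R0, T1), 10, R0, T0), ((R0, T2), 10, R0, R0)],
    [((R0, T0), 15, R0, R0)]]"

section \<open>Certificates that the 22 representatives exhaust the subgroups up to
  conjugacy\<close>

fun reachable :: "(s3 \<times> s3) list \<Rightarrow> (s3 \<times> s3) list \<Rightarrow> (s3 \<times> s3) list \<Rightarrow> bool" where
  "reachable gs seen [] \<longleftrightarrow> True"
| "reachable gs seen (p # ps) \<longleftrightarrow>
    list_ex (\<lambda>s. list_ex (\<lambda>q. p = pair_mult q s) seen) gs \<and> reachable gs (p # seen) ps"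

text \<open>The elements of K and of K x, for K the representative: they lie in every subgroup that
  contains K and x. Products of two of them already reach the conjugated generators in each table
  entry, so no closure has to be computed.\<close>

definition words :: "nat \<Rightarrow> s3 \<times> s3 \<Rightarrow> (s3 \<times> s3) list"
  where "words i x = elts i @ map (\<lambda>r. pair_mult r x) (elts i)"

definition is_product :: "(s3 \<times> s3) list \<Rightarrow> s3 \<times> s3 \<Rightarrow> bool"
  where "is_product ws y \<longleftrightarrow> list_ex (\<lambda>u. list_ex (\<lambda>v. pair_mult u v = y) ws) ws"

definition extension_ok :: "nat \<Rightarrow> (s3 \<times> s3) \<times> nat \<times> s3 \<times> s3 \<Rightarrow> bool"
  where "extension_ok i = (\<lambda>(x, t, p). t < 22 \<and> length (elts i) < length (elts t) \<and>
    list_all (\<lambda>s. is_product (words i x) (pair_conj p s)) (gens t))"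

text \<open>For r in K, adjoining y to K gives the same subgroup as adjoining r y. So the table has
  to list only one element of each coset K y outside K.\<close>

definition covered :: "nat \<Rightarrow> s3 \<times> s3 \<Rightarrow> bool"
  where "covered i y \<longleftrightarrow> list_ex (\<lambda>r. r = y) (elts i) \<or>
    list_ex (\<lambda>e. list_ex (\<lambda>r. fst e = pair_mult r y) (elts i)) (extension_table ! i)"

lemma extension_table_ok: "list_all (\<lambda>i. list_all (extension_ok i) (extension_table ! i)) [0..<22]"
  by code_simp

lemma extension_table_covers: "list_all (\<lambda>i. list_all (covered i) (List.product s3_all s3_all)) [0..<22]"
  by code_simp

lemma elts_reachable: "list_all (\<lambda>i. reachable (gens i) [(R0, R0)] (tl (elts i)) \<and>
    elts i = (R0, R0) # tl (elts i)) [0..<22]"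
  by code_simp

lemma elts_closed: "list_all (\<lambda>i. list_all (\<lambda>p. list_all (\<lambda>q. list_ex (\<lambda>r. r = pair_mult p q) (elts i))
    (elts i)) (elts i)) [0..<22]"
  by code_simp

text \<open>The row of a class is \<open>6 |K| \<beta>\<close>, where \<open>\<beta>\<close> are the coordinates of the class of
  \<open>(S\<^sub>3 \<times> S\<^sub>3)/K\<close> in the basis given by the images under \<open>\<gamma>\<close> of the matrix units and
  of $1$, $\bar\eta$, $\bar\xi$; it is indexed by the orders of the two projections of \<open>K\<close> and their kernels.\<close>

definition mark_table :: "((nat \<times> nat \<times> nat \<times> nat) \<times> int list) list"
  where "mark_table = [
    ((1, 1, 1, 1),
     [36, 0, 0, -18, 0, 0, 0, 0, 0, 0, 0, 0, 0, 0, 0, 0, 0, 0, 0, 0, 0, 0]),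
    ((1, 1, 2, 2),
     [72, 72, 0, -36, -36, 0, 0, 0, 0, 0, 0, 0, 0, 0, 0, 0, 0, 0, 0, 0, 0, 0]),
    ((1, 1, 3, 3),
     [108, 144, 144, -54, -72, -72, 0, 0, 0, 0, 0, 0, 0, 0, 0, 0, 0, 0, 0, 0, 0, 0]),
    ((1, 1, 6, 6),
     [216, 360, 144, -108, -180, -72, 0, 0, 0, 432, -216, 0, 0, 0, 0, 0, 0, 0, 0, 0, 0, 0]),
    ((2, 2, 1, 1),
     [36, 0, 0, -12, 0, 0, -6, 0, 0, 0, 0, 0, 0, 0, 0, 0, 0, 0, 0, 0, 0, 0]),
    ((2, 2, 2, 2),
     [72, 72, 0, -24, -24, 0, -12, -12, 0, 0, 0, 0, 0, 0, 0, 0, 0, 0, 0, 0, 0, 0]),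
    ((2, 2, 3, 3),
     [108, 144, 144, -36, -48, -48, -18, -24, -24, 0, 0, 0, 0, 0, 0, 0, 0, 0, 0, 0, 0, 0]),
    ((2, 2, 6, 6),
     [216, 360, 144, -72, -120, -48, -36, -60, -24, 432, -144, -72, 0, 0, 0, 0, 0, 0, 0, 0, 0, 0]),
    ((3, 3, 1, 1),
     [36, 0, 0, -18, 0, 0, 18, 0, 0, 0, 0, 0, 0, 0, 0, 0, 0, 0, 0, 0, 0, 0]),
    ((3, 3, 2, 2),
     [72, 72, 0, -36, -36, 0, 36, 36, 0, 0, 0, 0, 0, 0, 0, 0, 0, 0, 0, 0, 0, 0]),
    ((3, 3, 3, 3),
     [108, 144, 144, -54, -72, -72, 54, 72, 72, 0, 0, 0, 0, 0, 0, 0, 0, 0, 0, 0, 0, 0]),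
    ((3, 3, 6, 6),
     [216, 360, 144, -108, -180, -72, 108, 180, 72, 432, -216, 216, 0, 0, 0, 0, 0, 0, 0, 0, 0, 0]),
    ((6, 6, 1, 1),
     [36, 0, 0, 0, 0, 0, 0, 0, 0, 0, 0, 0, 0, 0, 0, 108, 0, 0, 0, 0, 0, 0]),
    ((6, 6, 2, 2),
     [72, 72, 0, 0, 0, 0, 0, 0, 0, 0, 0, 0, 0, 0, 0, 216, 216, 0, 0, 0, 0, 0]),
    ((6, 6, 3, 3),
     [108, 144, 144, 0, 0, 0, 0, 0, 0, 0, 0, 0, 0, 0, 0, 324, 432, 432, 0, 0, 0, 0]),
    ((6, 6, 6, 6),
     [216, 360, 144, 0, 0, 0, 0, 0, 0, 432, 0, 0, 0, 0, 0, 648, 1080, 432, 0, 0, 1296, 0]),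
    ((2, 1, 2, 1),
     [36, 0, 0, -12, 12, 0, -6, -12, 0, 0, 0, 0, 12, 0, 0, 0, 0, 0, 0, 0, 0, 0]),
    ((3, 1, 3, 1),
     [36, 0, 0, -18, 0, 0, 18, 36, 36, 0, 0, 0, 0, 0, 36, 0, 0, 0, 0, 0, 0, 0]),
    ((6, 1, 6, 1),
     [36, 0, 0, 0, 36, 0, 0, 0, 36, 0, 0, 0, 36, 0, 36, 0, 0, 0, 0, 36, 0, 0]),
    ((2, 1, 6, 3),
     [108, 144, 144, -36, -36, -72, -18, -36, 0, 0, 72, -72, 36, -72, 0, 0, 0, 0, 0, 0, 0, 0]),
    ((6, 3, 2, 1),
     [36, 0, 0, 0, 36, 0, 0, -36, 0, 0, 0, 0, 36, 0, 0, 108, 216, 0, -72, 0, 0, 0]),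
    ((6, 3, 6, 3),
     [108, 144, 144, 0, 36, -72, 0, -36, 72, 0, 216, -216, 108, -216, 0, 324, 648, 0, -216, 0,
      -3888, 432])]"
text \<open>An entry \<open>(c, a, b)\<close> of the list at position k contributes c x_a y_b to
  coordinate k of the product x y. Positions 0 to 8 are \<open>A11\<close> by rows, 9 to 11
  \<open>A14\<close>, 12 \<open>A22\<close>, 13 \<open>A24\<close>, 14 \<open>A33\<close>, 15 to 17
  \<open>A41\<close>, 18 \<open>A42\<close>, and 19 to 21 the coefficients of 1, eta, xi in
  \<open>A44\<close>. The constant -12 comes from \<open>alpha_424\<close>;
  \<open>arr_mult_arr_of\<close> confirms the list.\<close>

definition arr_structure :: "(int \<times> nat \<times> nat) list list"
  where "arr_structure = [
    [(1, 0, 0), (1, 1, 3), (1, 2, 6)],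
    [(1, 0, 1), (1, 1, 4), (1, 2, 7)],
    [(1, 0, 2), (1, 1, 5), (1, 2, 8)],
    [(1, 3, 0), (1, 4, 3), (1, 5, 6)],
    [(1, 3, 1), (1, 4, 4), (1, 5, 7)],
    [(1, 3, 2), (1, 4, 5), (1, 5, 8)],
    [(1, 6, 0), (1, 7, 3), (1, 8, 6)],
    [(1, 6, 1), (1, 7, 4), (1, 8, 7)],
    [(1, 6, 2), (1, 7, 5), (1, 8, 8)],
    [(1, 0, 9), (1, 1, 10), (1, 2, 11), (1, 9, 19)],
    [(1, 3, 9), (1, 4, 10), (1, 5, 11), (1, 10, 19)],
    [(1, 6, 9), (1, 7, 10), (1, 8, 11), (1, 11, 19)],
    [(1, 12, 12)],
    [(1, 12, 13), (1, 13, 19)],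
    [(1, 14, 14)],
    [(1, 15, 0), (1, 19, 15), (1, 16, 3), (1, 17, 6)],
    [(1, 15, 1), (1, 16, 4), (1, 19, 16), (1, 17, 7)],
    [(1, 15, 2), (1, 16, 5), (1, 17, 8), (1, 19, 17)],
    [(1, 18, 12), (1, 19, 18)],
    [(1, 19, 19)],
    [(1, 15, 9), (1, 16, 10), (1, 17, 11), (-12, 18, 13), (1, 19, 20), (1, 20, 19)],
    [(1, 18, 13), (1, 19, 21), (1, 21, 19)]]"

text \<open>The zero row for types outside the table keeps the length at 22. Subgroups never reach
  it, since each of them has the type of a representative.\<close>

definition mark_row :: "nat \<times> nat \<times> nat \<times> nat \<Rightarrow> int list"
  where "mark_row t = (case map_of mark_table t of Some r \<Rightarrow> r | None \<Rightarrow> replicate 22 0)"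

section \<open>Evaluation of types and link sizes on lists\<close>

fun hits :: "s3 \<Rightarrow> s3 list \<Rightarrow> (s3 \<times> s3) list \<Rightarrow> bool" where
  "hits x S [] \<longleftrightarrow> False"
| "hits x S ((u, v) # K) \<longleftrightarrow>
    (if u = x then if List.member S v then True else hits x S K else hits x S K)"

fun hitting :: "s3 list \<Rightarrow> s3 list \<Rightarrow> (s3 \<times> s3) list \<Rightarrow> s3 list" where
  "hitting [] S K = []"
| "hitting (x # xs) S K = (if hits x S K then x # hitting xs S K else hitting xs S K)"

definition preimage :: "(s3 \<times> s3) list \<Rightarrow> s3 list \<Rightarrow> s3 list"
  where "preimage K S = hitting s3_all S K"

text \<open>The type of \<open>K O L\<close>, where \<open>K'\<close> and \<open>L'\<close> are the
  converses of \<open>K\<close> and \<open>L\<close>. Preimages are taken through one relation after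
  the other, so the composition itself is never listed.\<close>

definition comp_type :: "(s3 \<times> s3) list \<Rightarrow> (s3 \<times> s3) list \<Rightarrow> (s3 \<times> s3) list \<Rightarrow> (s3 \<times> s3) list \<Rightarrow>
    nat \<times> nat \<times> nat \<times> nat"
  where "comp_type K K' L L' =
    (length (preimage K (preimage L s3_all)), length (preimage K (preimage L [R0])),
     length (preimage L' (preimage K' s3_all)), length (preimage L' (preimage K' [R0])))"

fun list_link :: "s3 list \<Rightarrow> s3 list \<Rightarrow> nat" where
  "list_link [] S = 0"
| "list_link (x # xs) S = (if List.member S x then Suc (list_link xs S) else list_link xs S)"

definition link_and_type :: "(s3 \<times> s3) list \<Rightarrow> (s3 \<times> s3) list \<Rightarrow> nat \<times> nat \<times> nat \<times> nat \<times> nat"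
  where "link_and_type K L =
    (list_link (preimage (map prod.swap K) [R0]) (preimage L [R0]),
     comp_type K (map prod.swap K) L (map prod.swap L))"

definition list_type :: "(s3 \<times> s3) list \<Rightarrow> nat \<times> nat \<times> nat \<times> nat"
  where "list_type K =
    (length (preimage K s3_all), length (preimage K [R0]),
     length (preimage (map prod.swap K) s3_all), length (preimage (map prod.swap K) [R0]))"

definition product_types :: "nat \<Rightarrow> nat \<Rightarrow> (nat \<times> nat \<times> nat \<times> nat \<times> nat) list"
  where "product_types i j =
    map (\<lambda>g. link_and_type (elts i) (map (pair_conj (g, R0)) (elts j))) s3_all"

fun row_combination :: "(nat \<times> nat \<times> nat \<times> nat \<times> nat) list \<Rightarrow> int list" where
  "row_combination [] = replicate 22 0"
| "row_combination ((l, t) # ps) = map2 (\<lambda>x y. int l * x + y) (mark_row t) (row_combination ps)"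

definition row_product :: "int list \<Rightarrow> int list \<Rightarrow> int list"
  where "row_product r s = map (\<lambda>l. sum_list (map (\<lambda>(c, a, b). c * (r ! a * s ! b)) l)) arr_structure"

text \<open>Marks are rows divided by 216, and averaging brings in |G|^2 = 36. Clearing these
  denominators in the product law leaves the factor 6 = 216 / 36 on the side of the
  compositions.\<close>

definition product_ok :: "nat \<Rightarrow> nat \<Rightarrow> bool"
  where "product_ok i j \<longleftrightarrow>
    map ((*) 6) (row_combination (product_types i j)) =
      row_product (snd (mark_table ! i)) (snd (mark_table ! j))"

text \<open>The second conjunct makes the lookup by type unambiguous: \<open>map_of\<close> stops at
  the first entry with the type of a representative, and the row found there is the row of that
  representative.\<close>

lemma mark_table_types: "list_all (\<lambda>i. fst (mark_table ! i) = list_type (elts i) \<and>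
    mark_row (fst (mark_table ! i)) = snd (mark_table ! i)) [0..<22]"
  by code_simp

section \<open>Group laws of the model, and the classification of its closed sets of pairs\<close>

lemma set_s3_all: "set s3_all = UNIV"
  by (auto simp: s3_all_def) (metis s3.exhaust)

lemma distinct_s3_all: "distinct s3_all"
  by (simp add: s3_all_def)

instance s3 :: finite
  by standard (simp flip: set_s3_all)

lemma s3_mult_assoc: "s3_mult (s3_mult x y) z = s3_mult x (s3_mult y z)"
  by (cases x; cases y; cases z; simp)

lemma s3_mult_one [simp]: "s3_mult R0 x = x" "s3_mult x R0 = x"
  by (cases x; simp)+

lemma s3_inv_left [simp]: "s3_mult (s3_inv x) x = R0" and s3_inv_right [simp]: "s3_mult x (s3_inv x) = R0"
  by (cases x; simp)+

lemma s3_conj_mult: "s3_conj (s3_mult g h) x = s3_conj g (s3_conj h x)"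
  by (cases g; cases h; cases x; simp add: s3_conj_def)

lemma s3_conj_hom: "s3_conj g (s3_mult x y) = s3_mult (s3_conj g x) (s3_conj g y)"
  by (cases g; cases x; cases y; simp add: s3_conj_def)

lemma s3_conj_one [simp]: "s3_conj R0 x = x" "s3_conj g R0 = R0"
  by (simp_all add: s3_conj_def; cases x; simp)+

lemma s3_conj_inv [simp]: "s3_conj (s3_inv g) (s3_conj g x) = x" "s3_conj g (s3_conj (s3_inv g) x) = x"
  by (simp_all flip: s3_conj_mult)

lemma inj_s3_conj: "inj (s3_conj g)"
  by (metis injI s3_conj_inv(1))

lemma s3_conj_eq_one_iff [simp]: "s3_conj g x = R0 \<longleftrightarrow> x = R0"
  by (metis s3_conj_inv(1) s3_conj_one(2))

lemma pair_conj_map_prod: "pair_conj (g, h) = map_prod (s3_conj g) (s3_conj h)"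
  by (auto simp: pair_conj_def)

lemma pair_conj_pair_mult: "pair_conj (pair_mult p q) r = pair_conj p (pair_conj q r)"
  by (simp add: pair_conj_def pair_mult_def s3_conj_mult)

lemma pair_conj_hom: "pair_conj p (pair_mult q r) = pair_mult (pair_conj p q) (pair_conj p r)"
  by (simp add: pair_conj_def pair_mult_def s3_conj_hom)

text \<open>In a finite group a submonoid is already a subgroup;
  \<open>subgroup_closed_pairs\<close> supplies the inverses.\<close>

definition closed_pairs :: "(s3 \<times> s3) set \<Rightarrow> bool"
  where "closed_pairs A \<longleftrightarrow> (R0, R0) \<in> A \<and> (\<forall>p\<in>A. \<forall>q\<in>A. pair_mult p q \<in> A)"

lemma closed_pairs_conj: "closed_pairs A \<Longrightarrow> closed_pairs {q. pair_conj p q \<in> A}"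
  by (simp add: closed_pairs_def pair_conj_hom) (simp add: pair_conj_def)

text \<open>\<open>reachable\<close> certifies each element as an earlier one times a generator, so
  a closed set containing the generators contains the elements by induction along the list.\<close>

lemma reachable_subset:
  assumes "closed_pairs A" "set gs \<subseteq> A" "set seen \<subseteq> A" "reachable gs seen ps"
  shows "set ps \<subseteq> A"
  using assms(3,4)
proof (induction ps arbitrary: seen)
  case (Cons p ps)
  then obtain g q where "g \<in> set gs" "q \<in> set seen" "p = pair_mult q g"
    by (auto simp: list_ex_iff)
  then have "p \<in> A"
    using assms(1,2) Cons.prems(1) by (auto simp: closed_pairs_def)
  then show ?case
    using Cons.IH[of "p # seen"] Cons.prems by simp
qed simp

lemma is_product_mem: "closed_pairs A \<Longrightarrow> set ws \<subseteq> A \<Longrightarrow> is_product ws y \<Longrightarrow> y \<in> A"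
  by (auto simp: is_product_def list_ex_iff closed_pairs_def)

lemma elts_subset:
  assumes "closed_pairs A" "set (gens i) \<subseteq> A" "i < 22"
  shows "set (elts i) \<subseteq> A"
proof -
  have *: "reachable (gens i) [(R0, R0)] (tl (elts i))" "elts i = (R0, R0) # tl (elts i)"
    using elts_reachable assms(3) by (simp_all add: list_all_iff)
  have "set (tl (elts i)) \<subseteq> A"
    by (rule reachable_subset[OF assms(1,2) _ *(1)]) (use assms(1) in \<open>simp add: closed_pairs_def\<close>)
  then show ?thesis
    using assms(1) by (subst *(2)) (simp add: closed_pairs_def)
qed

lemma elts_one: "i < 22 \<Longrightarrow> (R0, R0) \<in> set (elts i)"
  using elts_reachable by (simp add: list_all_iff) (metis atLeastLessThan_iff le0 list.set_intros(1))

lemma elts_closed_pairs: "i < 22 \<Longrightarrow> closed_pairs (set (elts i))"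
  using elts_closed elts_one by (auto simp: closed_pairs_def list_all_iff list_ex_iff)

text \<open>Among the conjugates of representatives contained in \<open>A\<close> choose one with the most elements:
  if it is not \<open>A\<close>, the extension table provides a larger one.\<close>

lemma closed_pairs_conj_elts:
  assumes A: "closed_pairs A"
  shows "\<exists>i<22. \<exists>p. A = pair_conj p ` set (elts i)"
proof -
  have "\<exists>j<22. \<exists>q. A = pair_conj q ` set (elts j)"
    if "i < 22" "pair_conj p ` set (elts i) \<subseteq> A" for i p
    using that
  proof (induction "36 - length (elts i)" arbitrary: i p rule: less_induct)
    case less
    show ?case
    proof (cases "pair_conj p ` set (elts i) = A")
      case True
      then show ?thesis using less.prems(1) by blast
    next
      case False
      then obtain z where z: "z \<in> A" "z \<notin> pair_conj p ` set (elts i)"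
        using less.prems(2) by blast
      \<comment> \<open>Conjugating back by \<open>p\<close> replaces \<open>A\<close> by a closed
        set \<open>B\<close> that contains the representative itself, where the extension table
        applies.\<close>
      define y where "y = pair_conj (map_prod s3_inv s3_inv p) z"
      have pz: "pair_conj p y = z"
        by (cases p; cases z) (simp add: y_def pair_conj_def)
      define B where "B = {q. pair_conj p q \<in> A}"
      have B: "closed_pairs B" unfolding B_def by (rule closed_pairs_conj[OF A])
      have EB: "set (elts i) \<subseteq> B" and yB: "y \<in> B"
        using less.prems(2) z(1) pz by (auto simp: B_def)
      have "covered i y"
        using extension_table_covers less.prems(1) by (cases y) (auto simp: list_all_iff set_s3_all)
      moreover have "y \<notin> set (elts i)" using z(2) pz by blast
      ultimately obtain e r where er: "e \<in> set (extension_table ! i)" "r \<in> set (elts i)"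
        "fst e = pair_mult r y"
        by (auto simp: covered_def list_ex_iff)
      obtain x t q where e: "e = (x, t, q)" by (cases e)
      have t: "t < 22" "length (elts i) < length (elts t)"
        and gens: "\<And>s. s \<in> set (gens t) \<Longrightarrow> is_product (words i x) (pair_conj q s)"
        using bspec[OF bspec[OF extension_table_ok[unfolded list_all_iff], of i] er(1)] less.prems(1)
        by (simp_all add: extension_ok_def e list_all_iff)
      have x: "x \<in> B" using B EB yB er e by (auto simp: closed_pairs_def)
      then have "set (words i x) \<subseteq> B"
        using B EB by (auto simp: words_def closed_pairs_def)
      then have "set (gens t) \<subseteq> {s. pair_conj q s \<in> B}"
        using gens is_product_mem[OF B] by blast
      then have "set (elts t) \<subseteq> {s. pair_conj q s \<in> B}"
        using elts_subset[OF closed_pairs_conj[OF B]] t(1) by blast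
      then have "pair_conj (pair_mult p q) ` set (elts t) \<subseteq> A"
        by (auto simp: B_def pair_conj_pair_mult)
      \<comment> \<open>No representative has more than 36 elements, the order of the whole square;
        so the truncated subtraction really decreases.\<close>
      moreover have "36 - length (elts t) < 36 - length (elts i)"
      proof -
        have "list_all (\<lambda>t. length (elts t) \<le> 36) [0..<22]" by code_simp
        then have "length (elts t) \<le> 36" using t(1) by (auto simp: list_all_iff)
        then show ?thesis using t(2) by simp
      qed
      ultimately show ?thesis using less.hyps t(1) by blast
    qed
  qed
  \<comment> \<open>The climb starts at class 0, the trivial subgroup, which every closed set
    contains.\<close>
  from this[of 0 "(R0, R0)"] show ?thesis
    using A by (simp add: elts_def rep_table_def pair_conj_def closed_pairs_def)
qed

text \<open>The orders, in this sequence, of the first projection, the intersection with the first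
  factor, the second projection and the intersection with the second factor.\<close>

definition s3_type :: "(s3 \<times> s3) set \<Rightarrow> nat \<times> nat \<times> nat \<times> nat"
  where "s3_type A = (card (A\<inverse> `` UNIV), card (A\<inverse> `` {R0}), card (A `` UNIV), card (A `` {R0}))"

lemma hits_iff: "hits x S K \<longleftrightarrow> (\<exists>v\<in>set S. (x, v) \<in> set K)"
  by (induction x S K rule: hits.induct) (auto simp: List.member_iff)

lemma hitting_eq_filter: "hitting xs S K = filter (\<lambda>x. hits x S K) xs"
  by (induction xs S K rule: hitting.induct) auto

lemma set_preimage: "set (preimage K S) = (set K)\<inverse> `` set S"
  by (auto simp: preimage_def hitting_eq_filter set_s3_all hits_iff)

lemma distinct_preimage: "distinct (preimage K S)"
  by (simp add: preimage_def hitting_eq_filter distinct_s3_all)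

lemma length_preimage: "length (preimage K S) = card ((set K)\<inverse> `` set S)"
  by (metis distinct_card distinct_preimage set_preimage)

lemma swap_image: "prod.swap ` A = A\<inverse>"
  by force

lemma list_type_eq: "list_type K = s3_type (set K)"
  by (simp add: list_type_def s3_type_def length_preimage swap_image set_s3_all)

lemma list_link_eq: "distinct xs \<Longrightarrow> list_link xs S = card (set xs \<inter> set S)"
  by (induction xs S rule: list_link.induct) (auto simp: List.member_iff Int_insert_left)

lemma link_and_type_eq: "link_and_type K L =
  (card {y. (R0, y) \<in> set K \<and> (y, R0) \<in> set L}, s3_type (set K O set L))"
proof -
  have "{y. (R0, y) \<in> set K \<and> (y, R0) \<in> set L} = (set K) `` {R0} \<inter> (set L)\<inverse> `` {R0}"
    by auto
  then show ?thesis
    by (simp add: link_and_type_def comp_type_def s3_type_def length_preimage swap_image set_preimage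
        set_s3_all list_link_eq distinct_preimage converse_relcomp relcomp_Image)
qed

lemma length_row_combination: "length (row_combination ps) = 22"
  if "\<And>t. length (mark_row t) = 22"
  by (induction ps rule: row_combination.induct) (simp_all add: that)

lemma length_mark_row: "length (mark_row t) = 22"
proof -
  have *: "list_all (\<lambda>p. length (snd p) = 22) mark_table" by code_simp
  show ?thesis
    using * by (auto simp: mark_row_def list_all_iff split: option.split dest!: map_of_SomeD)
qed

lemma nth_row_combination:
  "k < 22 \<Longrightarrow> row_combination ps ! k = (\<Sum>(l, t)\<leftarrow>ps. int l * mark_row t ! k)"
  by (induction ps rule: row_combination.induct)
    (simp_all add: length_mark_row length_row_combination)

lemma length_arr_structure: "length arr_structure = 22"
  by (simp add: arr_structure_def)

lemma mark_table_type: "i < 22 \<Longrightarrow> snd (mark_table ! i) = mark_row (s3_type (set (elts i)))"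
  using mark_table_types by (simp add: list_all_iff list_type_eq) (metis atLeastLessThan_iff le0)

lemma product_ok_sum:
  assumes "product_ok i j" "i < 22" "j < 22" "k < 22"
  shows "6 * (\<Sum>g\<in>UNIV. int (card {y. (R0, y) \<in> set (elts i) \<and> (y, R0) \<in> pair_conj (g, R0) ` set (elts j)}) *
      mark_row (s3_type (set (elts i) O pair_conj (g, R0) ` set (elts j))) ! k) =
    (\<Sum>(c, a, b)\<leftarrow>arr_structure ! k. c * (mark_row (s3_type (set (elts i))) ! a *
      mark_row (s3_type (set (elts j))) ! b))"
proof -
  let ?f = "\<lambda>g. int (card {y. (R0, y) \<in> set (elts i) \<and> (y, R0) \<in> pair_conj (g, R0) ` set (elts j)}) *
      mark_row (s3_type (set (elts i) O pair_conj (g, R0) ` set (elts j))) ! k"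
  have "6 * row_combination (product_types i j) ! k =
      row_product (snd (mark_table ! i)) (snd (mark_table ! j)) ! k"
    using assms(1,4) unfolding product_ok_def
    by (metis (no_types, lifting) length_row_combination[OF length_mark_row] nth_map)
  moreover have "row_combination (product_types i j) ! k = (\<Sum>g\<leftarrow>s3_all. ?f g)"
    using assms(4)
    by (simp add: nth_row_combination product_types_def link_and_type_eq comp_def)
  moreover have "(\<Sum>g\<leftarrow>s3_all. ?f g) = (\<Sum>g\<in>UNIV. ?f g)"
    using sum_list_distinct_conv_sum_set[OF distinct_s3_all, of ?f] by (simp only: set_s3_all)
  ultimately show ?thesis
    using assms(2-4) by (simp add: row_product_def length_arr_structure mark_table_type)
qed

text \<open>The finite computation behind multiplicativity: for each of the 484 pairs of classes,
  six conjugates of the second representative are composed with the first. The rows are split into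
  four blocks that are evaluated separately.\<close>

lemma product_ok_rows_0_5: "list_all (\<lambda>i. list_all (product_ok i) [0..<22]) [0..<6]"
  by code_simp

lemma product_ok_rows_6_10: "list_all (\<lambda>i. list_all (product_ok i) [0..<22]) [6..<11]"
  by code_simp

lemma product_ok_rows_11_15: "list_all (\<lambda>i. list_all (product_ok i) [0..<22]) [11..<16]"
  by code_simp

lemma product_ok_rows_16_21: "list_all (\<lambda>i. list_all (product_ok i) [0..<22]) [16..<22]"
  by code_simp

lemma product_ok: "product_ok i j" if "i < 22" "j < 22"
proof -
  have "i \<in> {0..<6} \<union> {6..<11} \<union> {11..<16} \<union> {16..<22}" "j \<in> {0..<22}"
    using that by auto
  then show ?thesis
    using product_ok_rows_0_5 product_ok_rows_6_10 product_ok_rows_11_15 product_ok_rows_16_21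
    unfolding list_all_iff set_upt by blast
qed

section \<open>Behaviour of types, compositions and links under conjugation\<close>

lemma Image_map_prod:
  "inj f \<Longrightarrow> (map_prod f g ` A) `` (f ` S) = g ` (A `` S)"
  by (fastforce simp: inj_eq Image_iff)

lemma converse_map_prod: "(map_prod f g ` A)\<inverse> = map_prod g f ` A\<inverse>"
  by force

lemma s3_type_map_prod:
  assumes "inj f" "inj g" "surj f" "surj g" "f R0 = R0" "g R0 = R0"
  shows "s3_type (map_prod f g ` A) = s3_type A"
  using Image_map_prod[OF assms(1), of g A UNIV] Image_map_prod[OF assms(1), of g A "{R0}"]
    Image_map_prod[OF assms(2), of f "A\<inverse>" UNIV] Image_map_prod[OF assms(2), of f "A\<inverse>" "{R0}"] assms
  by (simp add: s3_type_def converse_map_prod card_image inj_on_subset[OF _ subset_UNIV])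

lemma surj_s3_conj: "surj (s3_conj g)"
  by (rule finite_UNIV_inj_surj[OF finite_class.finite_UNIV inj_s3_conj])

lemma s3_type_conj: "s3_type (pair_conj p ` A) = s3_type A"
  by (cases p) (simp add: pair_conj_map_prod s3_type_map_prod inj_s3_conj surj_s3_conj)

lemma relcomp_map_prod:
  assumes "inj g"
  shows "(map_prod f g ` A) O (map_prod (\<lambda>x. g (u x)) h ` B) = map_prod f h ` (A O map_prod u id ` B)"
  using assms by (force simp: relcomp_unfold image_iff inj_eq)

text \<open>Conjugation of the middle coordinate by the common element \<open>b\<close> is injective
  and cancels in the composition. Up to conjugation only the relative twist \<open>u\<close>
  remains.\<close>

lemma conj_relcomp:
  "pair_conj (a, b) ` A O pair_conj (s3_mult b u, d) ` B = pair_conj (a, d) ` (A O pair_conj (u, R0) ` B)"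
proof -
  have "s3_conj (s3_mult b u) = (\<lambda>x. s3_conj b (s3_conj u x))" "s3_conj R0 = id"
    by (auto simp: s3_conj_mult)
  then show ?thesis
    using relcomp_map_prod[OF inj_s3_conj, of "s3_conj a" b A "s3_conj u" "s3_conj d" B]
    by (simp add: pair_conj_map_prod)
qed

definition s3_link :: "(s3 \<times> s3) set \<Rightarrow> (s3 \<times> s3) set \<Rightarrow> nat"
  where "s3_link A B = card {y. (R0, y) \<in> A \<and> (y, R0) \<in> B}"

text \<open>Both link sets live in the middle factor, where conjugation by \<open>b\<close> carries
  one onto the other.\<close>

lemma conj_link:
  "s3_link (pair_conj (a, b) ` A) (pair_conj (s3_mult b u, d) ` B) = s3_link A (pair_conj (u, R0) ` B)"
proof -
  have "{y. (R0, y) \<in> pair_conj (a, b) ` A \<and> (y, R0) \<in> pair_conj (s3_mult b u, d) ` B} =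
      s3_conj b ` {y. (R0, y) \<in> A \<and> (y, R0) \<in> pair_conj (u, R0) ` B}"
  proof (intro equalityI subsetI)
    fix y assume "y \<in> {y. (R0, y) \<in> pair_conj (a, b) ` A \<and> (y, R0) \<in> pair_conj (s3_mult b u, d) ` B}"
    then obtain p q where pq: "p \<in> A" "(R0, y) = pair_conj (a, b) p" "q \<in> B"
      "(y, R0) = pair_conj (s3_mult b u, d) q" by blast
    then have "p = (R0, snd p)" "s3_conj b (snd p) = y" "s3_conj b (s3_conj u (fst q)) = y" "snd q = R0"
      by (auto simp: pair_conj_def s3_conj_mult prod_eq_iff eq_commute[of R0])
    then have "(R0, snd p) \<in> A" "(snd p, R0) = pair_conj (u, R0) q"
      using pq(1) inj_eq[OF inj_s3_conj, of b] by (auto simp: pair_conj_def)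
    then show "y \<in> s3_conj b ` {y. (R0, y) \<in> A \<and> (y, R0) \<in> pair_conj (u, R0) ` B}"
      using \<open>s3_conj b (snd p) = y\<close> \<open>q \<in> B\<close> by blast
  next
    fix y assume "y \<in> s3_conj b ` {y. (R0, y) \<in> A \<and> (y, R0) \<in> pair_conj (u, R0) ` B}"
    then obtain v q where v: "y = s3_conj b v" "(R0, v) \<in> A" "q \<in> B" "(v, R0) = pair_conj (u, R0) q"
      by blast
    then have "(R0, y) = pair_conj (a, b) (R0, v)" "(y, R0) = pair_conj (s3_mult b u, d) q"
      by (auto simp: pair_conj_def s3_conj_mult)
    with v(2,3) show "y \<in> {y. (R0, y) \<in> pair_conj (a, b) ` A \<and>
        (y, R0) \<in> pair_conj (s3_mult b u, d) ` B}" by blast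
  qed
  then show ?thesis
    by (simp add: s3_link_def card_image inj_on_subset[OF inj_s3_conj])
qed

definition int_mark :: "nat \<Rightarrow> (s3 \<times> s3) set \<Rightarrow> int"
  where "int_mark k A = mark_row (s3_type A) ! k"

text \<open>Write A and B as conjugates of representatives by (a, b) and (c, d). Then g c = b r(g)
  with r a permutation of the group, so the sum over all g equals the sum for the representatives. A
  single summand has no such invariance, which is why the average is taken.\<close>

lemma int_mark_product:
  assumes A: "closed_pairs A" and B: "closed_pairs B" and k: "k < 22"
  shows "6 * (\<Sum>g\<in>UNIV. int (s3_link A (pair_conj (g, R0) ` B)) * int_mark k (A O pair_conj (g, R0) ` B)) =
    (\<Sum>(c, a, b)\<leftarrow>arr_structure ! k. c * (int_mark a A * int_mark b B))"
proof -
  obtain i a b where i: "i < 22" "A = pair_conj (a, b) ` set (elts i)"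
    using closed_pairs_conj_elts[OF A] by auto
  obtain j c d where j: "j < 22" "B = pair_conj (c, d) ` set (elts j)"
    using closed_pairs_conj_elts[OF B] by auto
  let ?F = "\<lambda>u. int (s3_link (set (elts i)) (pair_conj (u, R0) ` set (elts j))) *
    int_mark k (set (elts i) O pair_conj (u, R0) ` set (elts j))"
  define r where "r g = s3_mult (s3_inv b) (s3_mult g c)" for g
  have "int (s3_link A (pair_conj (g, R0) ` B)) * int_mark k (A O pair_conj (g, R0) ` B) = ?F (r g)" for g
  proof -
    have "s3_mult g c = s3_mult b (r g)"
      by (simp add: r_def flip: s3_mult_assoc)
    then have "pair_conj (g, R0) ` B = pair_conj (s3_mult b (r g), d) ` set (elts j)"
      by (simp add: j(2) image_image pair_mult_def flip: pair_conj_pair_mult)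
    then show ?thesis
      by (simp add: i(2) conj_relcomp conj_link int_mark_def s3_type_conj)
  qed
  moreover have "(\<Sum>g\<in>UNIV. ?F (r g)) = (\<Sum>u\<in>UNIV. ?F u)"
  proof (rule sum.reindex_bij_betw)
    have "r (s3_mult b (s3_mult u (s3_inv c))) = u" for u
      by (simp add: r_def s3_mult_assoc) (simp flip: s3_mult_assoc)
    then have "surj r" by (rule surjI)
    then show "bij r" by (simp add: bij_def finite_UNIV_surj_inj)
  qed
  ultimately show ?thesis
    using product_ok_sum[OF product_ok[OF i(1) j(1)] i(1) j(1) k]
    by (simp add: i(2) j(2) int_mark_def s3_type_conj s3_link_def)
qed

section \<open>The symmetric group of degree three\<close>

fun s3_perm :: "s3 \<Rightarrow> nat \<Rightarrow> nat" where
  "s3_perm R0 = id"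
| "s3_perm R1 = b_S3"
| "s3_perm R2 = b_S3 \<circ> b_S3"
| "s3_perm T0 = a_S3"
| "s3_perm T1 = a_S3 \<circ> b_S3"
| "s3_perm T2 = a_S3 \<circ> (b_S3 \<circ> b_S3)"

abbreviation s3_perm_pair :: "s3 \<times> s3 \<Rightarrow> (nat \<Rightarrow> nat) \<times> (nat \<Rightarrow> nat)"
  where "s3_perm_pair \<equiv> map_prod s3_perm s3_perm"

lemma a_S3_apply: "a_S3 i = (if i = 1 then 2 else if i = 2 then 1 else i)"
  by (simp add: a_S3_def transpose_def)

lemma b_S3_apply: "b_S3 i = (if i = 1 then 2 else if i = 2 then 3 else if i = 3 then 1 else i)"
  by (simp add: b_S3_def transpose_def)

lemma s3_perm_mult: "s3_perm (s3_mult x y) = s3_perm x \<circ> s3_perm y"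
  by (cases x; cases y) (simp_all add: fun_eq_iff a_S3_apply b_S3_apply)

lemma s3_perm_eq_id: "s3_perm x = id \<longleftrightarrow> x = R0"
proof -
  have "s3_perm x 1 \<noteq> 1 \<or> s3_perm x 2 \<noteq> 2" if "x \<noteq> R0"
    using that by (cases x) (simp_all add: a_S3_apply b_S3_apply)
  then show ?thesis by (cases "x = R0") auto
qed

interpretation S3: group S3
  by (rule sym_group_is_group)

lemma inj_s3_perm: "inj s3_perm"
proof (rule injI)
  fix x y assume *: "s3_perm x = s3_perm y"
  have "s3_perm (s3_mult (s3_inv x) y) = s3_perm (s3_mult (s3_inv x) x)"
    by (simp only: s3_perm_mult *)
  then have "s3_mult (s3_inv x) y = R0"
    by (simp add: s3_perm_eq_id)
  then have "s3_mult x (s3_mult (s3_inv x) y) = x" by simp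
  then show "x = y" by (simp flip: s3_mult_assoc)
qed

text \<open>The six values of \<open>s3_perm\<close> are distinct permutations of three points, and
  there are only 3! = 6 of those.\<close>

lemma carrier_S3: "carrier S3 = range s3_perm"
proof (rule sym, rule card_subset_eq)
  have ab: "a_S3 permutes {1..3}" "b_S3 permutes {1..3}"
    by (rule bij_imp_permutes;
        force simp: bij_betw_def inj_on_def a_S3_apply b_S3_apply image_def split: if_splits)+
  show "finite (carrier S3)"
    by (simp add: sym_group_def finite_permutations)
  show "range s3_perm \<subseteq> carrier S3"
  proof clarify
    fix x show "s3_perm x \<in> carrier S3"
      using ab by (cases x) (auto simp: sym_group_carrier intro: permutes_compose permutes_id)
  qed
  have "card (range s3_perm) = 6"
    using inj_s3_perm by (simp add: card_image flip: set_s3_all) (simp add: s3_all_def)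
  moreover have "card (carrier S3) = 6"
    using card_permutations[of "{1..3::nat}" 3] by (simp add: sym_group_def fact_numeral)
  ultimately show "card (range s3_perm) = card (carrier S3)" by simp
qed

lemma finite_S3: "finite (carrier S3)" and card_S3: "card (carrier S3) = 6"
proof -
  show "finite (carrier S3)" by (simp add: carrier_S3)
  show "card (carrier S3) = 6"
    unfolding carrier_S3 using inj_s3_perm
    by (simp add: card_image flip: set_s3_all) (simp add: s3_all_def)
qed

lemma s3_perm_inv: "inv\<^bsub>S3\<^esub> s3_perm x = s3_perm (s3_inv x)"
  by (rule S3.inv_equality)
    (simp_all add: carrier_S3 sym_group_mult sym_group_one flip: s3_perm_mult)

lemma conj_pair_s3: "conj_pair S3 (s3_perm_pair p) (s3_perm_pair q) = s3_perm_pair (pair_conj p q)"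
  by (cases p; cases q)
    (simp add: conj_pair_def pair_conj_def s3_conj_def s3_perm_inv carrier_S3 sym_group_mult
      s3_perm_mult sym_group_is_group)

lemma carrier_S3_pair: "carrier (S3 \<times>\<times> S3) = range s3_perm_pair"
  by (auto simp: carrier_S3 image_iff)

lemma inj_s3_perm_pair: "inj s3_perm_pair"
  by (simp add: inj_s3_perm prod.inj_map)

lemma pair_mult_s3: "s3_perm_pair p \<otimes>\<^bsub>S3 \<times>\<times> S3\<^esub> s3_perm_pair q = s3_perm_pair (pair_mult p q)"
  by (cases p; cases q) (simp add: pair_mult_def sym_group_mult s3_perm_mult)

lemma closed_pairs_vimage:
  assumes "subgroup K (S3 \<times>\<times> S3)"
  shows "closed_pairs (s3_perm_pair -` K)" "s3_perm_pair ` (s3_perm_pair -` K) = K"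
proof -
  show "closed_pairs (s3_perm_pair -` K)"
    using subgroup.one_closed[OF assms] subgroup.m_closed[OF assms]
    by (auto simp: closed_pairs_def sym_group_one simp flip: pair_mult_s3)
  show "s3_perm_pair ` (s3_perm_pair -` K) = K"
    using subgroup.subset[OF assms] unfolding carrier_S3_pair by auto
qed

definition rep_subgroup :: "nat \<Rightarrow> ((nat \<Rightarrow> nat) \<times> (nat \<Rightarrow> nat)) set"
  where "rep_subgroup i = s3_perm_pair ` set (elts i)"

lemma subgroup_conj_rep:
  assumes "subgroup K (S3 \<times>\<times> S3)"
  shows "\<exists>i<22. \<exists>p\<in>carrier (S3 \<times>\<times> S3). K = conj_pair S3 p ` rep_subgroup i"
proof -
  obtain i p where ip: "i < 22" "s3_perm_pair -` K = pair_conj p ` set (elts i)"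
    using closed_pairs_conj_elts[OF closed_pairs_vimage(1)[OF assms]] by blast
  have "K = s3_perm_pair ` pair_conj p ` set (elts i)"
    using closed_pairs_vimage(2)[OF assms] ip(2) by simp
  also have "\<dots> = conj_pair S3 (s3_perm_pair p) ` rep_subgroup i"
    by (simp add: rep_subgroup_def image_image conj_pair_s3)
  finally show ?thesis
    using ip(1) unfolding carrier_S3_pair by blast
qed

lemma subgroup_closed_pairs:
  assumes "closed_pairs A"
  shows "subgroup (s3_perm_pair ` A) (S3 \<times>\<times> S3)"
proof -
  interpret GG: group "S3 \<times>\<times> S3" by (rule S3.pair_group)
  obtain i p where A: "i < 22" "A = pair_conj p ` set (elts i)"
    using closed_pairs_conj_elts[OF assms] by blast
  \<comment> \<open>Closure under inverses is evaluated on the 22 representatives and transported to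
    \<open>A\<close> by conjugation.\<close>
  have *: "list_all (\<lambda>i. list_all (\<lambda>q. list_ex (\<lambda>r. r = (s3_inv (fst q), s3_inv (snd q))) (elts i))
      (elts i)) [0..<22]"
    by code_simp
  have inv_elts: "(s3_inv x, s3_inv y) \<in> set (elts i)" if "(x, y) \<in> set (elts i)" for x y
    using bspec[OF bspec[OF *[unfolded list_all_iff], of i, unfolded list_all_iff] that] A(1)
    by (auto simp: list_ex_iff)
  have inv: "(s3_inv x, s3_inv y) \<in> A" if "(x, y) \<in> A" for x y
  proof -
    have c: "s3_inv (s3_conj g z) = s3_conj g (s3_inv z)" for g z
      by (cases g; cases z; simp add: s3_conj_def)
    show ?thesis
      using that inv_elts unfolding A(2) by (force simp: pair_conj_def c)
  qed
  show ?thesis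
  proof (rule GG.subgroupI)
    show "s3_perm_pair ` A \<subseteq> carrier (S3 \<times>\<times> S3)" unfolding carrier_S3_pair by blast
    show "s3_perm_pair ` A \<noteq> {}" using assms by (auto simp: closed_pairs_def)
    show "inv\<^bsub>S3 \<times>\<times> S3\<^esub> p \<in> s3_perm_pair ` A" if "p \<in> s3_perm_pair ` A" for p
      using that inv by (force simp: s3_perm_inv carrier_S3 sym_group_is_group)
    show "p \<otimes>\<^bsub>S3 \<times>\<times> S3\<^esub> q \<in> s3_perm_pair ` A"
      if pq: "p \<in> s3_perm_pair ` A" "q \<in> s3_perm_pair ` A" for p q
    proof -
      obtain x y where "p = s3_perm_pair x" "x \<in> A" "q = s3_perm_pair y" "y \<in> A"
        using pq by (elim imageE)
      then show ?thesis using assms by (simp only: pair_mult_s3) (simp add: closed_pairs_def)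
    qed
  qed
qed

lemma rep_subgroup: "i < 22 \<Longrightarrow> subgroup (rep_subgroup i) (S3 \<times>\<times> S3)"
  unfolding rep_subgroup_def by (intro subgroup_closed_pairs elts_closed_pairs)

text \<open>The factor 216 makes the mark of $(S_3 \times S_3)/K$ equal to the row of \<open>K\<close> divided by $6|K|$.\<close>

definition s3_mark :: "nat \<Rightarrow> ((nat \<Rightarrow> nat) \<times> (nat \<Rightarrow> nat)) set \<Rightarrow> rat"
  where "s3_mark k K = of_int (int_mark k (s3_perm_pair -` K)) / 216"

lemma s3_mark_image: "s3_mark k (s3_perm_pair ` A) = of_int (int_mark k A) / 216"
  by (simp add: s3_mark_def inj_vimage_image_eq[OF inj_s3_perm_pair])

lemma relcomp_s3: "s3_perm_pair ` A O s3_perm_pair ` B = s3_perm_pair ` (A O B)"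
  using relcomp_map_prod[OF inj_s3_perm, of s3_perm A id s3_perm B]
  by (simp add: prod.map_id0)

lemma link_size_s3: "link_size S3 (s3_perm_pair ` A) (s3_perm_pair ` B) = s3_link A B"
proof -
  have "{y. (\<one>\<^bsub>S3\<^esub>, y) \<in> s3_perm_pair ` A \<and> (y, \<one>\<^bsub>S3\<^esub>) \<in> s3_perm_pair ` B} =
      s3_perm ` {y. (R0, y) \<in> A \<and> (y, R0) \<in> B}"
    by (force simp: sym_group_one image_iff s3_perm_eq_id inj_eq[OF inj_s3_perm] eq_commute[of id])
  then show ?thesis
    by (simp add: link_size_def s3_link_def card_image inj_on_subset[OF inj_s3_perm])
qed

lemma s3_mark_product:
  assumes K: "subgroup K (S3 \<times>\<times> S3)" and L: "subgroup L (S3 \<times>\<times> S3)" and k: "k < 22"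
  shows "(\<Sum>g\<in>carrier S3. of_nat (link_size S3 K (conj_pair S3 (g, \<one>\<^bsub>S3\<^esub>) ` L)) *
      s3_mark k (K O conj_pair S3 (g, \<one>\<^bsub>S3\<^esub>) ` L)) =
    36 * (\<Sum>(c, a, b)\<leftarrow>arr_structure ! k. of_int c * s3_mark a K * s3_mark b L)"
proof -
  define A B where "A = s3_perm_pair -` K" and "B = s3_perm_pair -` L"
  note A = closed_pairs_vimage[OF K, folded A_def] and B = closed_pairs_vimage[OF L, folded B_def]
  have conj: "conj_pair S3 (s3_perm g, \<one>\<^bsub>S3\<^esub>) ` L = s3_perm_pair ` pair_conj (g, R0) ` B" for g
    using conj_pair_s3[of "(g, R0)"] by (simp add: image_image sym_group_one flip: B(2))
  have "(\<Sum>g\<in>carrier S3. of_nat (link_size S3 K (conj_pair S3 (g, \<one>\<^bsub>S3\<^esub>) ` L)) *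
      s3_mark k (K O conj_pair S3 (g, \<one>\<^bsub>S3\<^esub>) ` L)) =
    (\<Sum>g\<in>UNIV. of_nat (s3_link A (pair_conj (g, R0) ` B)) *
      (of_int (int_mark k (A O pair_conj (g, R0) ` B)) / 216))"
    unfolding carrier_S3 sum.reindex[OF inj_s3_perm] comp_def conj A(2)[symmetric]
    by (simp add: link_size_s3 relcomp_s3 s3_mark_image)
  \<comment> \<open>Here 1296 = 6 * 216 brings in the factor of the integer identity; afterwards 1 /
    1296 = 36 / 216^2 restores the two marks on the right.\<close>
  also have "\<dots> = of_int (6 * (\<Sum>g\<in>UNIV. int (s3_link A (pair_conj (g, R0) ` B)) *
      int_mark k (A O pair_conj (g, R0) ` B))) / 1296"
    by (simp add: sum_divide_distrib sum_distrib_left)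
  also have "\<dots> = of_int (\<Sum>(c, a, b)\<leftarrow>arr_structure ! k. c * (int_mark a A * int_mark b B)) / 1296"
    by (simp only: int_mark_product[OF A(1) B(1) k])
  also have "\<dots> = 36 * (\<Sum>(c, a, b)\<leftarrow>arr_structure ! k. of_int c * s3_mark a K * s3_mark b L)"
  proof -
    have "of_int (\<Sum>(c, a, b)\<leftarrow>l. c * (int_mark a A * int_mark b B)) / 1296 =
        36 * (\<Sum>(c, a, b)\<leftarrow>l. of_int c * s3_mark a K * s3_mark b L)" for l
      by (induction l) (auto simp: s3_mark_def A_def B_def field_simps)
    then show ?thesis .
  qed
  finally show ?thesis .
qed

lemma sum_list_sum_swap: "(\<Sum>x\<in>A. \<Sum>y\<leftarrow>ys. f x y) = (\<Sum>y\<leftarrow>ys. \<Sum>x\<in>A. f x y)"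
  for f :: "_ \<Rightarrow> _ \<Rightarrow> 'r::comm_monoid_add"
  by (induction ys) (simp_all add: sum.distrib)

text \<open>The 36 = |G|^2 of the averaged formula cancels the 36 in \<open>s3_mark_product\<close>.
  Each term then separates into a sum over \<open>M\<close> times a sum over
  \<open>N\<close>.\<close>

lemma biset_mark_s3_tensor:
  assumes M: "finite_biset S3 M" and N: "finite_biset S3 N" and k: "k < 22"
  shows "biset_mark S3 (s3_mark k) (biset_tensor S3 M N) =
    (\<Sum>(c, a, b)\<leftarrow>arr_structure ! k.
      of_int c * biset_mark S3 (s3_mark a) M * biset_mark S3 (s3_mark b) N)"
proof -
  interpret finite_biset_pair S3 M N by (simp add: finite_biset_pair_def M N)
  have "36 * biset_mark S3 (s3_mark k) (biset_tensor S3 M N) =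
      (\<Sum>m\<in>elems M. \<Sum>n\<in>elems N. 36 * (\<Sum>(c, a, b)\<leftarrow>arr_structure ! k.
        of_int c * s3_mark a (biset_stab S3 M m) * s3_mark b (biset_stab S3 N n)))"
  proof -
    have "36 * biset_mark S3 (s3_mark k) (biset_tensor S3 M N) =
        (\<Sum>m\<in>elems M. \<Sum>n\<in>elems N. \<Sum>g\<in>carrier S3.
          of_nat (link_size S3 (biset_stab S3 M m) (conj_pair S3 (g, \<one>\<^bsub>S3\<^esub>) ` biset_stab S3 N n)) *
          s3_mark k (biset_stab S3 M m O conj_pair S3 (g, \<one>\<^bsub>S3\<^esub>) ` biset_stab S3 N n))"
      using biset_mark_tensor_average[OF finite_S3, of "s3_mark k"] by (simp add: card_S3)
    also have "\<dots> = (\<Sum>m\<in>elems M. \<Sum>n\<in>elems N. 36 * (\<Sum>(c, a, b)\<leftarrow>arr_structure ! k.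
        of_int c * s3_mark a (biset_stab S3 M m) * s3_mark b (biset_stab S3 N n)))"
      by (intro sum.cong refl s3_mark_product M.stab_subgroup N.stab_subgroup k)
    finally show ?thesis .
  qed
  also have "\<dots> = 36 * (\<Sum>x\<leftarrow>arr_structure ! k. \<Sum>m\<in>elems M. \<Sum>n\<in>elems N. case x of (c, a, b) \<Rightarrow>
      of_int c * s3_mark a (biset_stab S3 M m) * s3_mark b (biset_stab S3 N n))"
    by (simp only: sum_distrib_left[symmetric] sum_list_sum_swap)
  also have "\<dots> = 36 * (\<Sum>(c, a, b)\<leftarrow>arr_structure ! k.
      of_int c * biset_mark S3 (s3_mark a) M * biset_mark S3 (s3_mark b) N)"
  proof -
    have "(\<Sum>m\<in>elems M. \<Sum>n\<in>elems N. case x of (c, a, b) \<Rightarrow>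
        of_int c * s3_mark a (biset_stab S3 M m) * s3_mark b (biset_stab S3 N n)) =
      (case x of (c, a, b) \<Rightarrow> of_int c * biset_mark S3 (s3_mark a) M * biset_mark S3 (s3_mark b) N)" for x
      by (cases x) (simp only: prod.case biset_mark_def mult.assoc sum_product sum_distrib_left[symmetric])
    then show ?thesis by simp
  qed
  finally show ?thesis by simp
qed

section \<open>The double Burnside algebra as a quotient\<close>

lemma free_burnside_simps:
  "x \<in> carrier (free_burnside G) \<longleftrightarrow> Poly_Mapping.keys x \<subseteq> biset_classes G"
  "x \<oplus>\<^bsub>free_burnside G\<^esub> y = x + y" "\<zero>\<^bsub>free_burnside G\<^esub> = 0"
  "r \<odot>\<^bsub>free_burnside G\<^esub> x = Poly_Mapping.map ((*) r) x"
  "\<one>\<^bsub>free_burnside G\<^esub> = Poly_Mapping.single (biset_class G (regular_biset G)) 1"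
  by (simp_all add: free_burnside_def)

lemma class_mult_closed:
  assumes "c \<in> biset_classes G" "d \<in> biset_classes G"
  shows "class_mult G c d \<in> biset_classes G"
proof -
  obtain M N :: "('a, nat) biset" where MN: "finite_biset G M" "c = biset_class G M"
    "finite_biset G N" "d = biset_class G N"
    using assms by (auto simp: biset_classes_def)
  then have "finite_biset G (biset_tensor G M N)"
    by (intro finite_biset_pair.tensor_finite) (simp add: finite_biset_pair_def)
  then show ?thesis
    by (simp add: MN class_mult_eq biset_class_in_classes)
qed

lemma free_burnside_mult_closed:
  fixes x y :: "('g, nat) biset set \<Rightarrow>\<^sub>0 'r::comm_ring_1"
  assumes "x \<in> carrier (free_burnside G)" "y \<in> carrier (free_burnside G)"
  shows "x \<otimes>\<^bsub>free_burnside G\<^esub> y \<in> carrier (free_burnside G)"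
proof -
  have "Poly_Mapping.keys (\<Sum>c\<in>A. \<Sum>d\<in>B. Poly_Mapping.single (class_mult G c d) (f c d)) \<subseteq> biset_classes G"
    if "A \<subseteq> biset_classes G" "B \<subseteq> biset_classes G" for A B and f :: "_ \<Rightarrow> _ \<Rightarrow> 'r"
  proof -
    have "Poly_Mapping.keys (Poly_Mapping.single (class_mult G c d) (f c d)) \<subseteq> biset_classes G"
      if "c \<in> A" "d \<in> B" for c d
      using that \<open>A \<subseteq> _\<close> \<open>B \<subseteq> _\<close> class_mult_closed[of c G d] by (auto simp: keys_single)
    then show ?thesis
      by (intro order_trans[OF keys_sum] UN_least)
  qed
  then show ?thesis
    using assms by (simp add: free_burnside_def)
qed

text \<open>Both sides are bilinear, so a product law on bisets extends to formal sums. The list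
  \<open>l\<close> holds the structure constants together with the indices of the marks they
  combine.\<close>

lemma formal_mark_mult:
  fixes x y :: "('g, nat) biset set \<Rightarrow>\<^sub>0 'r::comm_ring_1"
  assumes x: "x \<in> carrier (free_burnside G)" and y: "y \<in> carrier (free_burnside G)"
    and tensor: "\<And>(M :: ('g, nat) biset) (N :: ('g, nat) biset). finite_biset G M \<Longrightarrow> finite_biset G N \<Longrightarrow>
      biset_mark G w (biset_tensor G M N) =
        (\<Sum>(c, u, v)\<leftarrow>l. c * biset_mark G (f u) M * biset_mark G (f v) N)"
  shows "formal_mark G w (x \<otimes>\<^bsub>free_burnside G\<^esub> y) =
    (\<Sum>(c, u, v)\<leftarrow>l. c * formal_mark G (f u) x * formal_mark G (f v) y)"
proof -
  let ?m = "\<lambda>w c. biset_mark G w (SOME M. M \<in> c)"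
  have single: "formal_mark G w (Poly_Mapping.single (class_mult G c d) r) =
      r * (\<Sum>(k, u, v)\<leftarrow>l. k * ?m (f u) c * ?m (f v) d)"
    if c: "c \<in> biset_classes G" and d: "d \<in> biset_classes G" for c d r
  proof -
    obtain M N :: "('g, nat) biset" where MN: "finite_biset G M" "c = biset_class G M"
      "finite_biset G N" "d = biset_class G N"
      using c d by (auto simp: biset_classes_def)
    have "?m w c = biset_mark G w M" "?m w d = biset_mark G w N" for w :: "_ \<Rightarrow> 'r"
      using formal_mark_single[OF MN(1), of w 1] formal_mark_single[OF MN(3), of w 1]
      by (simp_all add: formal_mark_def MN)
    then show ?thesis
      using MN finite_biset_pair.tensor_finite[of G M N]
        tensor[OF MN(1,3)]
      by (simp add: class_mult_eq formal_mark_single finite_biset_pair_def)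
  qed
  let ?X = "Poly_Mapping.keys x" and ?Y = "Poly_Mapping.keys y"
  have "formal_mark G w (x \<otimes>\<^bsub>free_burnside G\<^esub> y) =
      (\<Sum>c\<in>?X. \<Sum>d\<in>?Y. Poly_Mapping.lookup x c * Poly_Mapping.lookup y d *
        (\<Sum>(k, u, v)\<leftarrow>l. k * ?m (f u) c * ?m (f v) d))"
    using x y by (simp add: free_burnside_def formal_mark_sum single subset_iff)
  also have "\<dots> = (\<Sum>(k, u, v)\<leftarrow>l. k * formal_mark G (f u) x * formal_mark G (f v) y)"
  proof (induction l)
    case (Cons a l)
    then show ?case
      by (cases a) (simp add: distrib_left sum.distrib formal_mark_def sum_product sum_distrib_left mult_ac)
  qed simp
  finally show ?thesis .
qed

lemma relation_module_subset:
  "(relation_module G :: (('g, nat) biset set \<Rightarrow>\<^sub>0 'r::comm_ring_1) set) \<subseteq> carrier (free_burnside G)"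
proof -
  have "pm.subspace (carrier (free_burnside G) :: (('g, nat) biset set \<Rightarrow>\<^sub>0 'r) set)"
    by (auto simp: pm.subspace_def free_burnside_simps in_keys_iff subset_iff lookup_add)
      (metis add.right_neutral, metis mult_zero_right)
  moreover have "(burnside_relations G :: (('g, nat) biset set \<Rightarrow>\<^sub>0 'r) set) \<subseteq> carrier (free_burnside G)"
  proof
    fix x :: "('g, nat) biset set \<Rightarrow>\<^sub>0 'r" assume "x \<in> burnside_relations G"
    then obtain M N :: "('g, nat) biset" where MN: "finite_biset G M" "finite_biset G N"
      "x = Poly_Mapping.single (biset_class G (biset_sum M N)) 1
       - (Poly_Mapping.single (biset_class G M) 1 + Poly_Mapping.single (biset_class G N) 1)"
      by (auto simp: burnside_relations_def)
    have "Poly_Mapping.keys x \<subseteq>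
        {biset_class G (biset_sum M N), biset_class G M, biset_class G N}"
      by (auto simp: MN(3) in_keys_iff lookup_minus lookup_add lookup_single when_def split: if_splits)
    moreover have "{biset_class G (biset_sum M N), biset_class G M, biset_class G N} \<subseteq> biset_classes G"
      by (simp add: biset_class_in_classes biset_sum_finite MN(1,2))
    ultimately show "x \<in> carrier (free_burnside G)"
      by (simp only: free_burnside_simps)
  qed
  ultimately show ?thesis
    unfolding relation_module_def by (intro pm.span_minimal)
qed

text \<open>The assumptions say that \<open>coords\<close> respects all operations on formal sums
  and that its fibres are the cosets of the relations. This is enough to read the quotient off from
  \<open>N\<close>; no ring law for the free module is assumed.\<close>

locale burnside_coordinates =
  fixes G :: "('g, 'm) monoid_scheme"
    and N :: "('r::comm_ring_1, 'v, 'n) module_scheme"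
    and coords :: "(('g, nat) biset set \<Rightarrow>\<^sub>0 'r) \<Rightarrow> 'v"
  assumes regular: "finite_biset G (regular_biset G)"
    and coords_add: "coords (x + y) = coords x \<oplus>\<^bsub>N\<^esub> coords y"
    and coords_smult: "coords (Poly_Mapping.map ((*) r) x) = r \<odot>\<^bsub>N\<^esub> coords x"
    and coords_zero: "coords 0 = \<zero>\<^bsub>N\<^esub>"
    and coords_mult: "\<lbrakk>x \<in> carrier (free_burnside G); y \<in> carrier (free_burnside G)\<rbrakk> \<Longrightarrow>
      coords (x \<otimes>\<^bsub>free_burnside G\<^esub> y) = coords x \<otimes>\<^bsub>N\<^esub> coords y"
    and coords_eq_iff: "\<lbrakk>x \<in> carrier (free_burnside G); y \<in> carrier (free_burnside G)\<rbrakk> \<Longrightarrow>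
      coords x = coords y \<longleftrightarrow> x - y \<in> relation_module G"
begin

abbreviation "F \<equiv> free_burnside G :: ('r, ('g, nat) biset set \<Rightarrow>\<^sub>0 'r) module"
abbreviation "B \<equiv> double_burnside G :: ('r, (('g, nat) biset set \<Rightarrow>\<^sub>0 'r) set) module"
abbreviation "I \<equiv> relation_module G :: (('g, nat) biset set \<Rightarrow>\<^sub>0 'r) set"

text \<open>A relation between cosets and coordinate vectors: it records that \<open>C\<close> lies
  in the quotient, is single-valued in both directions, and passes through each operation
  separately.\<close>

definition represents :: "(('g, nat) biset set \<Rightarrow>\<^sub>0 'r) set \<Rightarrow> 'v \<Rightarrow> bool"
  where "represents C a \<longleftrightarrow> (\<exists>x\<in>carrier F. C = I +>\<^bsub>F\<^esub> x \<and> coords x = a)"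

lemma carrier_add: "x \<in> carrier F \<Longrightarrow> y \<in> carrier F \<Longrightarrow> x + y \<in> carrier F"
  using keys_add[of x y] by (auto simp: free_burnside_simps)

lemma carrier_diff: "x \<in> carrier F \<Longrightarrow> y \<in> carrier F \<Longrightarrow> x - y \<in> carrier F"
  using keys_diff[of x y] by (auto simp: free_burnside_simps)

lemma carrier_smult: "x \<in> carrier F \<Longrightarrow> Poly_Mapping.map ((*) r) x \<in> carrier F"
  by (auto simp: free_burnside_simps in_keys_iff subset_iff) (metis mult_zero_right)

lemma coset_eq:
  assumes x: "x \<in> carrier F"
  shows "I +>\<^bsub>F\<^esub> x = {y \<in> carrier F. coords y = coords x}"
proof -
  have "I +>\<^bsub>F\<^esub> x = {h + x |h. h \<in> I}"
    by (auto simp: a_r_coset_def' free_burnside_simps)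
  also have "\<dots> = {y \<in> carrier F. y - x \<in> I}"
    using relation_module_subset carrier_add x
    by (auto simp: subset_iff) (metis diff_add_cancel)
  also have "\<dots> = {y \<in> carrier F. coords y = coords x}"
    using coords_eq_iff x by blast
  finally show ?thesis .
qed

lemma represents_iff:
  "represents C a \<longleftrightarrow> (\<exists>x\<in>carrier F. coords x = a) \<and> C = {y \<in> carrier F. coords y = a}"
  by (auto simp: represents_def coset_eq)

lemma represents_unique: "represents C a \<Longrightarrow> represents C b \<Longrightarrow> a = b"
  by (auto simp: represents_iff)

lemma represents_unique_coset: "represents C a \<Longrightarrow> represents D a \<Longrightarrow> C = D"
  by (simp add: represents_iff)

lemma double_burnside_simps:
  "carrier B = (\<lambda>x. I +>\<^bsub>F\<^esub> x) ` carrier F"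
  "C \<oplus>\<^bsub>B\<^esub> D = C <+>\<^bsub>F\<^esub> D"
  "C \<otimes>\<^bsub>B\<^esub> D = rcoset_mult F I C D"
  "r \<odot>\<^bsub>B\<^esub> C = (\<Union>x\<in>C. I +>\<^bsub>F\<^esub> (r \<odot>\<^bsub>F\<^esub> x))"
  "\<zero>\<^bsub>B\<^esub> = I" "\<one>\<^bsub>B\<^esub> = I +>\<^bsub>F\<^esub> \<one>\<^bsub>F\<^esub>"
  by (auto simp: double_burnside_def Let_def FactRing_def ring.defs A_RCOSETS_def' )

lemma carrier_iff: "C \<in> carrier B \<longleftrightarrow> (\<exists>a. represents C a)"
  by (auto simp: double_burnside_simps represents_def)

lemma represents_zero: "represents \<zero>\<^bsub>B\<^esub> \<zero>\<^bsub>N\<^esub>"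
proof -
  have "0 \<in> carrier F" by (simp add: free_burnside_simps)
  moreover have "I = {y \<in> carrier F. coords y = coords 0}"
    using coords_eq_iff[OF _ \<open>0 \<in> carrier F\<close>] relation_module_subset by fastforce
  ultimately show ?thesis
    by (auto simp: double_burnside_simps represents_iff coords_zero)
qed

lemma one_closed: "\<one>\<^bsub>F\<^esub> \<in> carrier F"
  using biset_class_in_classes[OF regular] by (simp add: free_burnside_simps)

lemma represents_one: "represents \<one>\<^bsub>B\<^esub> (coords \<one>\<^bsub>F\<^esub>)"
  using one_closed by (auto simp: represents_def double_burnside_simps)

lemma represents_burnside_class:
  assumes "finite_biset G M"
  shows "represents (burnside_class G M) (coords (Poly_Mapping.single (biset_class G M) 1))"
  using biset_class_in_classes[OF assms]
  by (auto simp: represents_def burnside_class_def free_burnside_simps)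

lemma represents_add:
  assumes "represents C a" "represents D b"
  shows "represents (C \<oplus>\<^bsub>B\<^esub> D) (a \<oplus>\<^bsub>N\<^esub> b)"
proof -
  obtain x y where xy: "x \<in> carrier F" "coords x = a" "y \<in> carrier F" "coords y = b"
    using assms by (auto simp: represents_iff)
  have "C <+>\<^bsub>F\<^esub> D = {c + d |c d. c \<in> C \<and> d \<in> D}"
    by (auto simp: set_add_def' free_burnside_simps)
  also have "\<dots> = {z \<in> carrier F. coords z = a \<oplus>\<^bsub>N\<^esub> b}"
  proof (intro equalityI subsetI)
    fix z assume "z \<in> {c + d |c d. c \<in> C \<and> d \<in> D}"
    then show "z \<in> {z \<in> carrier F. coords z = a \<oplus>\<^bsub>N\<^esub> b}"
      using assms by (auto simp: represents_iff carrier_add coords_add)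
  next
    fix z assume z: "z \<in> {z \<in> carrier F. coords z = a \<oplus>\<^bsub>N\<^esub> b}"
    \<comment> \<open>The sum of two cosets is a set of sums, so every z in the fibre has to be
      split: z = (z - y) + y, with z - y in \<open>C\<close> because it has the coordinates of
      x.\<close>
    then have "coords z = coords (x + y)" by (simp add: coords_add xy)
    then have "z - (x + y) \<in> I"
      using z xy coords_eq_iff carrier_add by blast
    then have "(z - y) - x \<in> I" by (simp add: algebra_simps)
    then have "coords (z - y) = a" using coords_eq_iff z xy carrier_diff by auto
    then have "z - y \<in> C" "y \<in> D"
      using assms z xy carrier_diff by (auto simp: represents_iff)
    then show "z \<in> {c + d |c d. c \<in> C \<and> d \<in> D}"
      by (metis (mono_tags, lifting) diff_add_cancel mem_Collect_eq)
  qed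
  finally show ?thesis
    using xy carrier_add[of x y] coords_add[of x y]
    by (simp add: represents_iff double_burnside_simps) blast
qed

text \<open>The product of cosets is a union of cosets of products c d. They all coincide because
  \<open>coords\<close> is multiplicative; this takes the place of the ideal property of the
  relations.\<close>

lemma represents_mult:
  assumes "represents C a" "represents D b"
  shows "represents (C \<otimes>\<^bsub>B\<^esub> D) (a \<otimes>\<^bsub>N\<^esub> b)"
proof -
  obtain x y where xy: "x \<in> carrier F" "coords x = a" "y \<in> carrier F" "coords y = b"
    using assms by (auto simp: represents_iff)
  have "x \<in> C" "y \<in> D" using assms xy by (auto simp: represents_iff)
  moreover have "I +>\<^bsub>F\<^esub> (c \<otimes>\<^bsub>F\<^esub> d) = {z \<in> carrier F. coords z = a \<otimes>\<^bsub>N\<^esub> b}" if "c \<in> C" "d \<in> D" for c d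
    using that assms by (simp add: represents_iff coset_eq free_burnside_mult_closed coords_mult)
  ultimately have "rcoset_mult F I C D = {z \<in> carrier F. coords z = a \<otimes>\<^bsub>N\<^esub> b}"
    unfolding rcoset_mult_def by blast
  then show ?thesis
    using xy bexI[of _ "x \<otimes>\<^bsub>F\<^esub> y" "carrier F"] free_burnside_mult_closed[of x G y] coords_mult[of x y]
    by (simp add: represents_iff double_burnside_simps)
qed

lemma represents_smult:
  assumes "represents C a"
  shows "represents (r \<odot>\<^bsub>B\<^esub> C) (r \<odot>\<^bsub>N\<^esub> a)"
proof -
  obtain x where x: "x \<in> carrier F" "coords x = a"
    using assms by (auto simp: represents_iff)
  have "x \<in> C" using assms x by (auto simp: represents_iff)
  moreover have "I +>\<^bsub>F\<^esub> (r \<odot>\<^bsub>F\<^esub> c) = {z \<in> carrier F. coords z = r \<odot>\<^bsub>N\<^esub> a}" if "c \<in> C" for c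
    using that assms carrier_smult[of c r] coset_eq[of "Poly_Mapping.map ((*) r) c"]
    by (simp add: represents_iff free_burnside_simps(4) coords_smult)
  ultimately have "(\<Union>c\<in>C. I +>\<^bsub>F\<^esub> (r \<odot>\<^bsub>F\<^esub> c)) = {z \<in> carrier F. coords z = r \<odot>\<^bsub>N\<^esub> a}"
    by blast
  then show ?thesis
    using x carrier_smult[of x r] coords_smult[of r x]
    by (simp add: represents_iff double_burnside_simps) blast
qed

lemma represents_lincomb:
  assumes "list_all2 (\<lambda>(c, C) (d, a). c = d \<and> represents C a) xs ys"
  shows "represents (lincomb B xs) (lincomb N ys)"
  using assms
  by (induction rule: list_all2_induct)
    (auto simp: lincomb_def represents_zero represents_add represents_smult)

text \<open>A map \<open>f\<close> that picks for each vector a coset with these coordinates is the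
  inverse of the coordinate map, hence bijective and compatible with the operations. All algebra
  laws of the quotient are then transported from \<open>N\<close> along \<open>f\<close>.\<close>

lemma represents_iso:
  fixes R :: "('r, 'k) ring_scheme"
  assumes f: "\<And>a. a \<in> carrier N \<Longrightarrow> represents (f a) a"
    and closed: "\<And>x. x \<in> carrier F \<Longrightarrow> coords x \<in> carrier N"
    and one: "coords \<one>\<^bsub>F\<^esub> = \<one>\<^bsub>N\<^esub>"
    and N: "assoc_algebra R N"
  shows "f \<in> algebra_iso R N B" "assoc_algebra R B"
proof -
  interpret N: assoc_algebra R N by (rule N)
  have surj: "\<exists>a\<in>carrier N. C = f a" if "C \<in> carrier B" for C
    using that f closed represents_unique_coset unfolding carrier_iff represents_def by metis
  have f_closed: "f a \<in> carrier B" if "a \<in> carrier N" for a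
    using f[OF that] carrier_iff by blast
  have add: "f (a \<oplus>\<^bsub>N\<^esub> b) = f a \<oplus>\<^bsub>B\<^esub> f b" if "a \<in> carrier N" "b \<in> carrier N" for a b
    using represents_unique_coset[OF f represents_add[OF f f]] that by simp
  have mult: "f (a \<otimes>\<^bsub>N\<^esub> b) = f a \<otimes>\<^bsub>B\<^esub> f b" if "a \<in> carrier N" "b \<in> carrier N" for a b
    using represents_unique_coset[OF f represents_mult[OF f f]] that by simp
  have smult: "f (r \<odot>\<^bsub>N\<^esub> a) = r \<odot>\<^bsub>B\<^esub> f a" if "r \<in> carrier R" "a \<in> carrier N" for a r
    using represents_unique_coset[OF f represents_smult[OF f]] that by simp
  have f_one: "f \<one>\<^bsub>N\<^esub> = \<one>\<^bsub>B\<^esub>"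
    using represents_unique_coset[OF f] represents_one one by simp
  have f_zero: "f \<zero>\<^bsub>N\<^esub> = \<zero>\<^bsub>B\<^esub>"
    using represents_unique_coset[OF f represents_zero] by simp
  have inj: "inj_on f (carrier N)"
    using f represents_unique by (metis inj_onI)
  have "f ` carrier N = carrier B" using surj f_closed by blast
  then show "f \<in> algebra_iso R N B"
    using inj f_closed by (auto simp: algebra_iso_def ring_iso_def ring_hom_def add mult smult f_one bij_betw_def)
  have ab: "abelian_group B"
  proof (rule abelian_groupI)
    fix C D assume C: "C \<in> carrier B" and D: "D \<in> carrier B"
    show "C \<oplus>\<^bsub>B\<^esub> D \<in> carrier B"
      using surj[OF C] surj[OF D] f_closed by (auto simp flip: add)
    show "C \<oplus>\<^bsub>B\<^esub> D = D \<oplus>\<^bsub>B\<^esub> C"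
      using surj[OF C] surj[OF D] by (auto simp: N.M.a_comm simp flip: add)
    fix E assume E: "E \<in> carrier B"
    show "C \<oplus>\<^bsub>B\<^esub> D \<oplus>\<^bsub>B\<^esub> E = C \<oplus>\<^bsub>B\<^esub> (D \<oplus>\<^bsub>B\<^esub> E)"
      using surj[OF C] surj[OF D] surj[OF E] by (auto simp: N.M.a_assoc simp flip: add)
  next
    show "\<zero>\<^bsub>B\<^esub> \<in> carrier B" using f_closed by (auto simp flip: f_zero)
    fix C assume C: "C \<in> carrier B"
    show "\<zero>\<^bsub>B\<^esub> \<oplus>\<^bsub>B\<^esub> C = C"
      using surj[OF C] by (auto simp flip: add f_zero)
    show "\<exists>D\<in>carrier B. D \<oplus>\<^bsub>B\<^esub> C = \<zero>\<^bsub>B\<^esub>"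
    proof -
      obtain a where a: "a \<in> carrier N" "C = f a" using surj[OF C] by blast
      then have "f (\<ominus>\<^bsub>N\<^esub> a) \<oplus>\<^bsub>B\<^esub> C = \<zero>\<^bsub>B\<^esub>"
        by (simp add: N.M.l_neg flip: add f_zero)
      then show ?thesis using a f_closed by blast
    qed
  qed
  have ring: "ring B"
  proof (rule ringI[OF ab])
    show "monoid B"
    proof (rule monoidI)
      fix C D assume C: "C \<in> carrier B" and D: "D \<in> carrier B"
      show "C \<otimes>\<^bsub>B\<^esub> D \<in> carrier B"
        using surj[OF C] surj[OF D] f_closed by (auto simp flip: mult)
      fix E assume E: "E \<in> carrier B"
      show "C \<otimes>\<^bsub>B\<^esub> D \<otimes>\<^bsub>B\<^esub> E = C \<otimes>\<^bsub>B\<^esub> (D \<otimes>\<^bsub>B\<^esub> E)"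
        using surj[OF C] surj[OF D] surj[OF E] by (auto simp: N.m_assoc simp flip: mult)
    next
      show "\<one>\<^bsub>B\<^esub> \<in> carrier B" using f_closed by (auto simp flip: f_one)
      fix C assume C: "C \<in> carrier B"
      show "\<one>\<^bsub>B\<^esub> \<otimes>\<^bsub>B\<^esub> C = C" "C \<otimes>\<^bsub>B\<^esub> \<one>\<^bsub>B\<^esub> = C"
        using surj[OF C] by (auto simp flip: mult f_one)
    qed
    fix C D E assume C: "C \<in> carrier B" and D: "D \<in> carrier B" and E: "E \<in> carrier B"
    show "(C \<oplus>\<^bsub>B\<^esub> D) \<otimes>\<^bsub>B\<^esub> E = C \<otimes>\<^bsub>B\<^esub> E \<oplus>\<^bsub>B\<^esub> D \<otimes>\<^bsub>B\<^esub> E"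
      "E \<otimes>\<^bsub>B\<^esub> (C \<oplus>\<^bsub>B\<^esub> D) = E \<otimes>\<^bsub>B\<^esub> C \<oplus>\<^bsub>B\<^esub> E \<otimes>\<^bsub>B\<^esub> D"
      using surj[OF C] surj[OF D] surj[OF E]
      by (auto simp: N.l_distr N.r_distr simp flip: mult add)
  qed
  have "module R B"
  proof (rule moduleI[OF N.R.is_cring ab])
    fix C assume C: "C \<in> carrier B"
    show "\<one>\<^bsub>R\<^esub> \<odot>\<^bsub>B\<^esub> C = C"
      using surj[OF C] by (auto simp flip: smult)
    fix r assume r: "r \<in> carrier R"
    show "r \<odot>\<^bsub>B\<^esub> C \<in> carrier B"
      using surj[OF C] r f_closed by (auto simp flip: smult)
    fix s assume s: "s \<in> carrier R"
    show "(r \<oplus>\<^bsub>R\<^esub> s) \<odot>\<^bsub>B\<^esub> C = r \<odot>\<^bsub>B\<^esub> C \<oplus>\<^bsub>B\<^esub> s \<odot>\<^bsub>B\<^esub> C"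
      "(r \<otimes>\<^bsub>R\<^esub> s) \<odot>\<^bsub>B\<^esub> C = r \<odot>\<^bsub>B\<^esub> (s \<odot>\<^bsub>B\<^esub> C)"
      using surj[OF C] r s by (auto simp: N.smult_l_distr N.smult_assoc1 simp flip: smult add)
  next
    fix r C D assume r: "r \<in> carrier R" and C: "C \<in> carrier B" and D: "D \<in> carrier B"
    show "r \<odot>\<^bsub>B\<^esub> (C \<oplus>\<^bsub>B\<^esub> D) = r \<odot>\<^bsub>B\<^esub> C \<oplus>\<^bsub>B\<^esub> r \<odot>\<^bsub>B\<^esub> D"
      using surj[OF C] surj[OF D] r by (auto simp: N.smult_r_distr simp flip: smult add)
  qed
  moreover have "assoc_algebra_axioms R B"
  proof
    fix r C D assume r: "r \<in> carrier R" and C: "C \<in> carrier B" and D: "D \<in> carrier B"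
    show "(r \<odot>\<^bsub>B\<^esub> C) \<otimes>\<^bsub>B\<^esub> D = r \<odot>\<^bsub>B\<^esub> (C \<otimes>\<^bsub>B\<^esub> D)"
      "C \<otimes>\<^bsub>B\<^esub> (r \<odot>\<^bsub>B\<^esub> D) = r \<odot>\<^bsub>B\<^esub> (C \<otimes>\<^bsub>B\<^esub> D)"
      using surj[OF C] surj[OF D] r
      by (auto simp: N.smult_mult_left N.smult_mult_right simp flip: smult mult)
  qed
  ultimately show "assoc_algebra R B"
    using ring by (simp add: assoc_algebra_def)
qed

end

section \<open>The algebra of arrays in coordinates\<close>

lemma qex_eq_iff:
  "z = w \<longleftrightarrow> coeff_one z = coeff_one w \<and> coeff_eta z = coeff_eta w \<and> coeff_xi z = coeff_xi w"
  by transfer (auto simp: eta_xi_ideal_iff)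

lemma qex_coeff_simps [simp]:
  "coeff_one 0 = 0" "coeff_eta 0 = 0" "coeff_xi 0 = 0"
  "coeff_one 1 = 1" "coeff_eta 1 = 0" "coeff_xi 1 = 0"
  "coeff_one eta_bar = 0" "coeff_eta eta_bar = 1" "coeff_xi eta_bar = 0"
  "coeff_one xi_bar = 0" "coeff_eta xi_bar = 0" "coeff_xi xi_bar = 1"
  "coeff_one (z + w) = coeff_one z + coeff_one w"
  "coeff_eta (z + w) = coeff_eta z + coeff_eta w"
  "coeff_xi (z + w) = coeff_xi z + coeff_xi w"
  "coeff_one (z - w) = coeff_one z - coeff_one w"
  "coeff_eta (z - w) = coeff_eta z - coeff_eta w"
  "coeff_xi (z - w) = coeff_xi z - coeff_xi w"
  "coeff_one (qex_scale c z) = c * coeff_one z"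
  "coeff_eta (qex_scale c z) = c * coeff_eta z"
  "coeff_xi (qex_scale c z) = c * coeff_xi z"
  "coeff_one (z * w) = coeff_one z * coeff_one w"
  "coeff_eta (z * w) = coeff_one z * coeff_eta w + coeff_eta z * coeff_one w"
  "coeff_xi (z * w) = coeff_one z * coeff_xi w + coeff_xi z * coeff_one w"
  by (transfer; simp add: eta_def xi_def coeff_mult algebra_simps)+

text \<open>Serves to evaluate the numeral 12 in \<open>alpha_424\<close>.\<close>

lemma qex_coeff_numeral [simp]:
  "coeff_one (numeral n) = numeral n" "coeff_eta (numeral n) = 0" "coeff_xi (numeral n) = 0"
proof -
  have "coeff_one (of_nat n) = of_nat n" "coeff_eta (of_nat n) = 0" "coeff_xi (of_nat n) = 0" for n
    by (induction n) simp_all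
  from this[of "numeral n"] show
    "coeff_one (numeral n) = numeral n" "coeff_eta (numeral n) = 0" "coeff_xi (numeral n) = 0"
    by simp_all
qed

text \<open>The order of the coordinates is the one used in \<open>arr_structure\<close> and in the
  rows of \<open>mark_table\<close>.\<close>

definition arr_coords :: "arr \<Rightarrow> rat list"
  where "arr_coords x =
    [A11 x $ 1 $ 1, A11 x $ 1 $ 2, A11 x $ 1 $ 3, A11 x $ 2 $ 1, A11 x $ 2 $ 2, A11 x $ 2 $ 3,
     A11 x $ 3 $ 1, A11 x $ 3 $ 2, A11 x $ 3 $ 3, A14 x $ 1 $ 1, A14 x $ 2 $ 1, A14 x $ 3 $ 1,
     A22 x, A24 x, A33 x, A41 x $ 1 $ 1, A41 x $ 1 $ 2, A41 x $ 1 $ 3, A42 x,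
     coeff_one (A44 x), coeff_eta (A44 x), coeff_xi (A44 x)]"

text \<open>Vectors are functions on \<open>nat\<close> read below 22, so that sums and scalings
  become pointwise; equality of arrays is equality below 22 (\<open>arr_of_eq_iff\<close>).\<close>

definition arr_of :: "(nat \<Rightarrow> rat) \<Rightarrow> arr"
  where "arr_of v =
    \<lparr>A11 = (\<chi> i j. if i = 1 then if j = 1 then v 0 else if j = 2 then v 1 else v 2
       else if i = 2 then if j = 1 then v 3 else if j = 2 then v 4 else v 5
       else if j = 1 then v 6 else if j = 2 then v 7 else v 8),
     A14 = (\<chi> i j. if i = 1 then v 9 else if i = 2 then v 10 else v 11),
     A22 = v 12, A24 = v 13, A33 = v 14,
     A41 = (\<chi> i j. if j = 1 then v 15 else if j = 2 then v 16 else v 17), A42 = v 18,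
     A44 = qex_scale (v 19) 1 + qex_scale (v 20) eta_bar + qex_scale (v 21) xi_bar\<rparr>"

lemma upt_0_22: "[0..<22] = [0, 1, 2, 3, 4, 5, 6, 7, 8, 9, 10, 11, 12, 13, 14, 15, 16, 17, 18, 19, 20, 21]"
  by code_simp

lemma arr_coords_arr_of: "arr_coords (arr_of v) = map v [0..<22]"
  by (simp add: arr_coords_def arr_of_def upt_0_22)

lemma length_arr_coords: "length (arr_coords x) = 22"
  by (simp add: arr_coords_def)

lemma arr_coords_eq_iff: "arr_coords x = arr_coords y \<longleftrightarrow> x = y"
proof
  assume "arr_coords x = arr_coords y"
  then show "x = y"
    by (intro arr.equality) (simp_all add: arr_coords_def vec_eq_iff forall_3 qex_eq_iff)
qed simp

lemma arr_of_cong: "(\<And>k. k < 22 \<Longrightarrow> v k = w k) \<Longrightarrow> arr_of v = arr_of w"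
  by (simp add: arr_coords_arr_of flip: arr_coords_eq_iff)

lemma arr_of_coords: "arr_of (\<lambda>k. arr_coords x ! k) = x"
proof -
  have "map (\<lambda>k. arr_coords x ! k) [0..<length (arr_coords x)] = arr_coords x"
    by (rule map_nth)
  then show ?thesis
    by (simp only: arr_coords_eq_iff[symmetric] arr_coords_arr_of length_arr_coords)
qed

lemma arr_of_eq_iff: "arr_of v = arr_of w \<longleftrightarrow> (\<forall>k<22. v k = w k)"
  by (auto simp: arr_coords_arr_of simp flip: arr_coords_eq_iff)

lemma arr_add_arr_of: "arr_add (arr_of v) (arr_of w) = arr_of (\<lambda>k. v k + w k)"
  by (simp add: arr_coords_arr_of[of "\<lambda>k. v k + w k"] flip: arr_coords_eq_iff)
    (simp add: arr_add_def arr_coords_def arr_of_def upt_0_22)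

lemma arr_scale_arr_of: "arr_scale c (arr_of v) = arr_of (\<lambda>k. c * v k)"
  by (simp add: arr_coords_arr_of[of "\<lambda>k. c * v k"] flip: arr_coords_eq_iff)
    (simp add: arr_scale_def arr_coords_def arr_of_def upt_0_22)

lemma arr_zero_eq: "arr_zero = arr_of (\<lambda>k. 0)"
  by (simp add: arr_coords_arr_of[of "\<lambda>k. 0"] flip: arr_coords_eq_iff)
    (simp add: arr_zero_def arr_coords_def upt_0_22)

text \<open>The positions are the diagonal of \<open>A11\<close>, the entries \<open>A22\<close> and
  \<open>A33\<close>, and the constant term of \<open>A44\<close>.\<close>

lemma arr_one_eq: "arr_one = arr_of (\<lambda>k. if k \<in> {0, 4, 8, 12, 14, 19} then 1 else 0)"
  by (simp add: arr_coords_arr_of flip: arr_coords_eq_iff)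
    (simp add: arr_one_def arr_coords_def mat_def upt_0_22)

lemmas arr_mult_simps = arr_mult_def alpha_111_def alpha_114_def alpha_141_def alpha_144_def
  alpha_222_def alpha_224_def alpha_242_def alpha_244_def alpha_333_def alpha_411_def alpha_414_def
  alpha_422_def alpha_424_def alpha_441_def alpha_442_def alpha_444_def

lemma arr_mult_assoc: "arr_mult (arr_mult x y) z = arr_mult x (arr_mult y z)"
  unfolding arr_coords_eq_iff[symmetric]
  by (simp add: arr_coords_def arr_mult_simps matrix_matrix_mult_def sum_3 algebra_simps)

lemma arr_mult_distrib:
  "arr_mult (arr_add x y) z = arr_add (arr_mult x z) (arr_mult y z)"
  "arr_mult z (arr_add x y) = arr_add (arr_mult z x) (arr_mult z y)"
  unfolding arr_coords_eq_iff[symmetric]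
  by (simp_all add: arr_coords_def arr_mult_simps arr_add_def matrix_matrix_mult_def sum_3 algebra_simps)

lemma arr_mult_one: "arr_mult arr_one x = x" "arr_mult x arr_one = x"
  unfolding arr_coords_eq_iff[symmetric]
  by (simp_all add: arr_coords_def arr_mult_simps arr_one_def matrix_matrix_mult_def sum_3 mat_def)

lemma arr_mult_scale:
  "arr_mult (arr_scale c x) y = arr_scale c (arr_mult x y)"
  "arr_mult x (arr_scale c y) = arr_scale c (arr_mult x y)"
  unfolding arr_coords_eq_iff[symmetric]
  by (simp_all add: arr_coords_def arr_mult_simps arr_scale_def matrix_matrix_mult_def sum_3 algebra_simps)

lemma arr_algebra_simps [simp]:
  "carrier arr_algebra = UNIV" "x \<otimes>\<^bsub>arr_algebra\<^esub> y = arr_mult x y" "\<one>\<^bsub>arr_algebra\<^esub> = arr_one"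
  "\<zero>\<^bsub>arr_algebra\<^esub> = arr_zero" "x \<oplus>\<^bsub>arr_algebra\<^esub> y = arr_add x y" "c \<odot>\<^bsub>arr_algebra\<^esub> x = arr_scale c x"
  by (simp_all add: arr_algebra_def)

lemma rat_ring_simps [simp]:
  "carrier rat_ring = UNIV" "a \<otimes>\<^bsub>rat_ring\<^esub> b = a * b" "\<one>\<^bsub>rat_ring\<^esub> = 1" "a \<oplus>\<^bsub>rat_ring\<^esub> b = a + b"
  by (simp_all add: ring_of_type_algebra_def)

lemma abelian_group_arr: "abelian_group arr_algebra"
proof (rule abelian_groupI)
  fix x y z
  show "x \<oplus>\<^bsub>arr_algebra\<^esub> y \<oplus>\<^bsub>arr_algebra\<^esub> z = x \<oplus>\<^bsub>arr_algebra\<^esub> (y \<oplus>\<^bsub>arr_algebra\<^esub> z)"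
    "x \<oplus>\<^bsub>arr_algebra\<^esub> y = y \<oplus>\<^bsub>arr_algebra\<^esub> x"
    by (simp_all add: arr_add_def add_ac)
  show "\<zero>\<^bsub>arr_algebra\<^esub> \<oplus>\<^bsub>arr_algebra\<^esub> x = x"
    by (simp add: arr_add_def arr_zero_def)
  have "arr_add (arr_scale (- 1) x) x = arr_zero"
    unfolding arr_coords_eq_iff[symmetric]
    by (simp add: arr_coords_def arr_add_def arr_scale_def arr_zero_def)
  then show "\<exists>y\<in>carrier arr_algebra. y \<oplus>\<^bsub>arr_algebra\<^esub> x = \<zero>\<^bsub>arr_algebra\<^esub>"
    by auto
qed simp_all

lemma arr_scale_laws:
  "arr_scale (a + b) x = arr_add (arr_scale a x) (arr_scale b x)"
  "arr_scale a (arr_add x y) = arr_add (arr_scale a x) (arr_scale a y)"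
  "arr_scale (a * b) x = arr_scale a (arr_scale b x)"
  "arr_scale 1 x = x"
  unfolding arr_coords_eq_iff[symmetric]
  by (simp_all add: arr_coords_def arr_scale_def arr_add_def algebra_simps)

lemma assoc_algebra_arr: "assoc_algebra rat_ring arr_algebra"
proof -
  have "ring arr_algebra"
    by (rule ringI[OF abelian_group_arr monoidI])
      (simp_all add: arr_mult_assoc arr_mult_one arr_mult_distrib)
  moreover have "module rat_ring arr_algebra"
    by (rule moduleI[OF cring_from_type_algebra abelian_group_arr]) (simp_all add: arr_scale_laws)
  ultimately show ?thesis
    by (simp add: assoc_algebra_def assoc_algebra_axioms_def arr_mult_scale)
qed

lemma lincomb_arr_of:
  "lincomb arr_algebra (map (\<lambda>(c, v). (c, arr_of v)) xs) = arr_of (\<lambda>k. \<Sum>(c, v)\<leftarrow>xs. c * v k)"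
  by (induction xs) (auto simp: lincomb_def arr_zero_eq arr_scale_arr_of arr_add_arr_of)

section \<open>Coordinates on the double Burnside algebra\<close>

text \<open>Ties the list used in the finite computation to the actual multiplication of arrays, so
  that \<open>arr_structure\<close> carries no assumption.\<close>

lemma arr_mult_arr_of:
  "arr_mult (arr_of v) (arr_of w) =
    arr_of (\<lambda>k. \<Sum>(c, a, b)\<leftarrow>arr_structure ! k. of_int c * v a * w b)"
  by (simp add: arr_coords_arr_of[of "\<lambda>k. \<Sum>(c, a, b)\<leftarrow>arr_structure ! k. of_int c * v a * w b"]
      flip: arr_coords_eq_iff)
    (simp add: arr_mult_simps arr_coords_def arr_of_def upt_0_22 arr_structure_def
      matrix_matrix_mult_def sum_3 algebra_simps)

definition s3_coords :: "((nat \<Rightarrow> nat, nat) biset set \<Rightarrow>\<^sub>0 rat) \<Rightarrow> arr"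
  where "s3_coords x = arr_of (\<lambda>k. formal_mark S3 (s3_mark k) x)"

lemma regular_biset_finite:
  assumes "group G" "finite (carrier G)"
  shows "finite_biset G (regular_biset G)"
proof -
  interpret group G by fact
  show ?thesis
    by unfold_locales (auto simp: regular_biset_def assms(2) m_assoc)
qed

lemma s3_mark_conj:
  assumes "subgroup K (S3 \<times>\<times> S3)" "p \<in> carrier (S3 \<times>\<times> S3)"
  shows "s3_mark k (conj_pair S3 p ` K) = s3_mark k K"
proof -
  obtain q where q: "p = s3_perm_pair q"
    using assms(2) unfolding carrier_S3_pair by (elim rangeE)
  have "s3_mark k (conj_pair S3 p ` s3_perm_pair ` A) = s3_mark k (s3_perm_pair ` A)" for A
  proof -
    have "conj_pair S3 p ` s3_perm_pair ` A = s3_perm_pair ` pair_conj q ` A"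
      by (simp add: q image_image conj_pair_s3)
    then show ?thesis
      by (simp add: s3_mark_image int_mark_def s3_type_conj)
  qed
  then show ?thesis
    using closed_pairs_vimage(2)[OF assms(1)] by metis
qed

definition basis_row :: "nat \<Rightarrow> nat \<Rightarrow> rat"
  where "basis_row t k = of_int (snd (mark_table ! t) ! k) / (6 * of_nat (length (elts t)))"

lemma distinct_elts: "list_all (\<lambda>i. distinct (elts i)) [0..<22]"
  by code_simp

definition basis_elem :: "nat \<Rightarrow> (nat \<Rightarrow> nat, nat) biset set \<Rightarrow>\<^sub>0 rat"
  where "basis_elem t = Poly_Mapping.single (biset_class S3 (coset_biset S3 (rep_subgroup t))) 1"

lemma rep_biset_finite: "t < 22 \<Longrightarrow> finite_biset S3 (coset_biset S3 (rep_subgroup t))"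
  by (rule S3.coset_biset_finite[OF finite_S3 rep_subgroup])

text \<open>There are 36 / |K| cosets, each of mark row / 216; the total is row / (6 |K|).\<close>

lemma formal_mark_basis_elem:
  assumes t: "t < 22"
  shows "formal_mark S3 (s3_mark k) (basis_elem t) = basis_row t k"
proof -
  have card: "card (rep_subgroup t) = length (elts t)"
    using distinct_elts t
    by (simp add: rep_subgroup_def card_image inj_on_subset[OF inj_s3_perm_pair] distinct_card list_all_iff)
  have pos: "length (elts t) > 0"
    using elts_one[OF t] by (cases "elts t") auto
  have "s3_mark k (rep_subgroup t) = of_int (snd (mark_table ! t) ! k) / 216"
    by (simp add: rep_subgroup_def s3_mark_image int_mark_def mark_table_type[OF t])
  moreover have "of_nat (length (elts t)) * biset_mark S3 (s3_mark k) (coset_biset S3 (rep_subgroup t)) =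
      36 * s3_mark k (rep_subgroup t)"
    using S3.biset_mark_coset[OF finite_S3 rep_subgroup[OF t], of "s3_mark k"] s3_mark_conj[OF rep_subgroup[OF t]]
    by (simp add: card card_S3)
  ultimately show ?thesis
    using pos by (simp add: basis_elem_def formal_mark_single[OF rep_biset_finite[OF t]] basis_row_def field_simps)
qed

text \<open>Each row as a rewrite rule of its own, so that simplification handles one row and not
  the whole table.\<close>

lemmas nth_mark_table =
  arg_cong[OF mark_table_def, of "\<lambda>x. x ! 0", simplified]
  arg_cong[OF mark_table_def, of "\<lambda>x. x ! 1", simplified]
  arg_cong[OF mark_table_def, of "\<lambda>x. x ! 2", simplified]
  arg_cong[OF mark_table_def, of "\<lambda>x. x ! 3", simplified]
  arg_cong[OF mark_table_def, of "\<lambda>x. x ! 4", simplified]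
  arg_cong[OF mark_table_def, of "\<lambda>x. x ! 5", simplified]
  arg_cong[OF mark_table_def, of "\<lambda>x. x ! 6", simplified]
  arg_cong[OF mark_table_def, of "\<lambda>x. x ! 7", simplified]
  arg_cong[OF mark_table_def, of "\<lambda>x. x ! 8", simplified]
  arg_cong[OF mark_table_def, of "\<lambda>x. x ! 9", simplified]
  arg_cong[OF mark_table_def, of "\<lambda>x. x ! 10", simplified]
  arg_cong[OF mark_table_def, of "\<lambda>x. x ! 11", simplified]
  arg_cong[OF mark_table_def, of "\<lambda>x. x ! 12", simplified]
  arg_cong[OF mark_table_def, of "\<lambda>x. x ! 13", simplified]
  arg_cong[OF mark_table_def, of "\<lambda>x. x ! 14", simplified]
  arg_cong[OF mark_table_def, of "\<lambda>x. x ! 15", simplified]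
  arg_cong[OF mark_table_def, of "\<lambda>x. x ! 16", simplified]
  arg_cong[OF mark_table_def, of "\<lambda>x. x ! 17", simplified]
  arg_cong[OF mark_table_def, of "\<lambda>x. x ! 18", simplified]
  arg_cong[OF mark_table_def, of "\<lambda>x. x ! 19", simplified]
  arg_cong[OF mark_table_def, of "\<lambda>x. x ! 20", simplified]
  arg_cong[OF mark_table_def, of "\<lambda>x. x ! 21", simplified]

lemma length_elts:
  "length (elts 0) = 1" "length (elts 1) = 2" "length (elts 2) = 3" "length (elts 3) = 6"
  "length (elts 4) = 2" "length (elts 5) = 4" "length (elts 6) = 6" "length (elts 7) = 12"
  "length (elts 8) = 3" "length (elts 9) = 6" "length (elts 10) = 9" "length (elts 11) = 18"
  "length (elts 12) = 6" "length (elts 13) = 12" "length (elts 14) = 18" "length (elts 15) = 36"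
  "length (elts 16) = 2" "length (elts 17) = 3" "length (elts 18) = 6" "length (elts 19) = 6"
  "length (elts 20) = 6" "length (elts 21) = 18"
  by code_simp+

lemma all_less_22: "(\<forall>k<22. P k) \<longleftrightarrow> list_all P [0..<22]"
  by (auto simp: list_all_iff)

text \<open>Elimination in block-triangular order. Columns 13, 14 and 18 to 21 isolate the classes
  15 and 17 to 21 in a suitable sequence; then the classes 12, 13, 14 and 16 drop out. What is left
  is, for each second factor \<open>V 5\<close>, \<open>V 4\<close>, \<open>V 1\<close>,
  \<open>V 0\<close> in turn, a 3 by 3 system in the classes with first factor \<open>V 0\<close>,
  \<open>V 1\<close> or \<open>V 4\<close>.\<close>

lemma basis_rows_independent:
  fixes c :: "nat \<Rightarrow> rat"
  assumes "\<And>k. k < 22 \<Longrightarrow> (\<Sum>t<22. c t * basis_row t k) = 0" and "t < 22"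
  shows "c t = 0"
proof -
  define d where "d t = c t / (6 * of_nat (length (elts t)))" for t
  have "(\<Sum>t<22. d t * of_int (snd (mark_table ! t) ! k)) = 0" if "k < 22" for k
    using assms(1)[OF that] by (simp add: basis_row_def d_def)
  then have "\<forall>k<22. (\<Sum>t\<leftarrow>[0..<22]. d t * of_int (snd (mark_table ! t) ! k)) = 0"
    by (simp add: interv_sum_list_conv_sum_set_nat atLeast0LessThan)
  then have eqs: "list_all (\<lambda>k. (\<Sum>t\<leftarrow>[0..<22]. d t * of_int (snd (mark_table ! t) ! k)) = 0) [0..<22]"
    by (simp only: all_less_22)
  note [simp] = nth_mark_table
  note E = eqs[unfolded upt_0_22, simplified]
  have 1: "d 18 = 0" "d 21 = 0" "d 15 = 0" "d 20 = 0" "d 19 = 0" "d 17 = 0"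
    using E by (elim conjE; linarith)+
  note E = E[simplified 1, simplified]
  have 2: "d 16 = 0" "d 14 = 0" "d 13 = 0" "d 12 = 0" "d 11 = 0" "d 7 = 0" "d 3 = 0"
    using E by (elim conjE; linarith)+
  note E = E[simplified 2, simplified]
  have 3: "d 10 = 0" "d 6 = 0" "d 2 = 0"
    using E by (elim conjE; linarith)+
  note E = E[simplified 3, simplified]
  have 4: "d 9 = 0" "d 5 = 0" "d (Suc 0) = 0"
    using E by (elim conjE; linarith)+
  note E = E[simplified 4, simplified]
  have 5: "d 8 = 0" "d 4 = 0" "d 0 = 0"
    using E by (elim conjE; linarith)+
  have "list_all (\<lambda>t. d t = 0) [0..<22]"
    unfolding upt_0_22 by (simp add: 1 2 3 4 5)
  then have "d t = 0" using assms(2) by (simp add: list_all_iff)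
  moreover have "length (elts t) > 0"
    using elts_one[OF assms(2)] by (cases "elts t") auto
  ultimately show ?thesis by (simp add: d_def)
qed

lemma coset_class_basis_elem:
  assumes "subgroup K (S3 \<times>\<times> S3)"
  shows "\<exists>t<22. Poly_Mapping.single (biset_class S3 (coset_biset S3 K)) 1 = basis_elem t"
proof -
  obtain t p where "t < 22" "p \<in> carrier (S3 \<times>\<times> S3)" "K = conj_pair S3 p ` rep_subgroup t"
    using subgroup_conj_rep[OF assms] by blast
  then show ?thesis
    using S3.coset_biset_conj[OF finite_S3 rep_subgroup] by (auto simp: basis_elem_def simp del: carrier_DirProd)
qed

text \<open>The formal sums with such a decomposition form a submodule. It contains the relations
  and, since conjugate subgroups give the same class, all transitive bisets; together these
  span.\<close>

lemma free_burnside_decomposition: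
  assumes "x \<in> carrier (free_burnside S3 :: (rat, _) module)"
  shows "\<exists>c. x - (\<Sum>t<22. Poly_Mapping.map ((*) (c t)) (basis_elem t)) \<in> relation_module S3"
proof -
  let ?rel = "burnside_relations S3 :: ((nat \<Rightarrow> nat, nat) biset set \<Rightarrow>\<^sub>0 rat) set"
  let ?Q = "{x. \<exists>c. x - (\<Sum>t<22. Poly_Mapping.map ((*) (c t)) (basis_elem t)) \<in> pm.span ?rel}"
  have "pm.subspace ?Q"
    unfolding pm.subspace_def
  proof (intro conjI ballI allI)
    show "0 \<in> ?Q"
      by (auto intro!: exI[of _ "\<lambda>_. 0"] simp: pm.span_zero)
  next
    fix x y assume "x \<in> ?Q" "y \<in> ?Q"
    then obtain c d where "x - (\<Sum>t<22. Poly_Mapping.map ((*) (c t)) (basis_elem t)) \<in> pm.span ?rel"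
      "y - (\<Sum>t<22. Poly_Mapping.map ((*) (d t)) (basis_elem t)) \<in> pm.span ?rel"
      by auto
    from pm.span_add[OF this] have
      "x + y - (\<Sum>t<22. Poly_Mapping.map ((*) (c t + d t)) (basis_elem t)) \<in> pm.span ?rel"
      by (simp add: pm.scale_left_distrib sum.distrib algebra_simps)
    then show "x + y \<in> ?Q" by (auto intro: exI[of _ "\<lambda>t. c t + d t"])
  next
    fix r x assume "x \<in> ?Q"
    then obtain c where "x - (\<Sum>t<22. Poly_Mapping.map ((*) (c t)) (basis_elem t)) \<in> pm.span ?rel"
      by auto
    from pm.span_scale[OF this, of r] have
      "Poly_Mapping.map ((*) r) x - (\<Sum>t<22. Poly_Mapping.map ((*) (r * c t)) (basis_elem t)) \<in> pm.span ?rel"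
      by (simp add: pm.scale_right_diff_distrib pm.scale_sum_right)
    then show "Poly_Mapping.map ((*) r) x \<in> ?Q" by (auto intro: exI[of _ "\<lambda>t. r * c t"])
  qed
  moreover have "?rel \<subseteq> ?Q"
    by (auto intro!: exI[of _ "\<lambda>_. 0"] pm.span_base)
  moreover have "basis_elem t \<in> ?Q" if "t < 22" for t
  proof -
    have "(\<Sum>s<22. Poly_Mapping.map ((*) (if s = t then 1 else 0)) (basis_elem s)) =
        (\<Sum>s<22. if s = t then basis_elem t else 0)"
      by (intro sum.cong) auto
    also have "\<dots> = basis_elem t" using that by simp
    finally show ?thesis
      by (auto intro!: exI[of _ "\<lambda>s. if s = t then 1 else 0"] simp: pm.span_zero)
  qed
  ultimately have "pm.span (?rel \<union>
      {Poly_Mapping.single (biset_class S3 (coset_biset S3 K)) 1 |K. subgroup K (S3 \<times>\<times> S3)}) \<subseteq> ?Q"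
    using coset_class_basis_elem by (intro pm.span_minimal) (fastforce, assumption)
  then show ?thesis
    using free_burnside_in_span[OF finite_S3 assms] unfolding relation_module_def by blast
qed

text \<open>Modulo the relations x is a combination of the 22 classes, and vanishing marks force its
  coefficients to be 0 by independence of the rows. So the marks are both well defined and injective
  on the quotient.\<close>

lemma formal_marks_zero_iff:
  assumes "x \<in> carrier (free_burnside S3 :: (rat, _) module)"
  shows "(\<forall>k<22. formal_mark S3 (s3_mark k) x = 0) \<longleftrightarrow> x \<in> relation_module S3"
proof
  assume zero: "\<forall>k<22. formal_mark S3 (s3_mark k) x = 0"
  obtain c where c: "x - (\<Sum>t<22. Poly_Mapping.map ((*) (c t)) (basis_elem t)) \<in> relation_module S3"
    using free_burnside_decomposition[OF assms] by blast
  have "(\<Sum>t<22. c t * basis_row t k) = 0" if "k < 22" for k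
    using formal_mark_relation[OF c, of "s3_mark k"] zero that
    by (simp add: formal_mark_diff formal_mark_sum formal_mark_scale formal_mark_basis_elem)
  then have "c t = 0" if "t < 22" for t
    using basis_rows_independent that by blast
  then have "(\<Sum>t<22. Poly_Mapping.map ((*) (c t)) (basis_elem t)) = 0"
    by simp
  then show "x \<in> relation_module S3" using c by simp
qed (simp add: formal_mark_relation)

interpretation coords: burnside_coordinates S3 arr_algebra s3_coords
proof (rule burnside_coordinates.intro)
  show "finite_biset S3 (regular_biset S3)"
    by (rule regular_biset_finite[OF sym_group_is_group finite_S3])
  fix x y :: "(nat \<Rightarrow> nat, nat) biset set \<Rightarrow>\<^sub>0 rat"
  show "s3_coords (x + y) = s3_coords x \<oplus>\<^bsub>arr_algebra\<^esub> s3_coords y"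
    by (simp add: s3_coords_def arr_add_arr_of formal_mark_add)
  show "s3_coords (Poly_Mapping.map ((*) r) x) = r \<odot>\<^bsub>arr_algebra\<^esub> s3_coords x" for r
    by (simp add: s3_coords_def arr_scale_arr_of formal_mark_scale)
  show "s3_coords 0 = \<zero>\<^bsub>arr_algebra\<^esub>"
    by (simp add: s3_coords_def arr_zero_eq)
  assume x: "x \<in> carrier (free_burnside S3)" and y: "y \<in> carrier (free_burnside S3)"
  show "s3_coords (x \<otimes>\<^bsub>free_burnside S3\<^esub> y) = s3_coords x \<otimes>\<^bsub>arr_algebra\<^esub> s3_coords y"
  proof -
    have "formal_mark S3 (s3_mark k) (x \<otimes>\<^bsub>free_burnside S3\<^esub> y) =
        (\<Sum>(c, a, b)\<leftarrow>arr_structure ! k.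
          of_int c * formal_mark S3 (s3_mark a) x * formal_mark S3 (s3_mark b) y)" if "k < 22" for k
    proof -
      have "biset_mark S3 (s3_mark k) (biset_tensor S3 M N) =
          (\<Sum>(c, a, b)\<leftarrow>map (\<lambda>(c, a, b). (of_int c, a, b)) (arr_structure ! k).
            c * biset_mark S3 (s3_mark a) M * biset_mark S3 (s3_mark b) N)"
        if "finite_biset S3 M" "finite_biset S3 N"
        for M :: "(nat \<Rightarrow> nat, nat) biset" and N :: "(nat \<Rightarrow> nat, nat) biset"
        using biset_mark_s3_tensor[OF that \<open>k < 22\<close>] by (simp add: comp_def case_prod_unfold)
      from formal_mark_mult[OF x y this] show ?thesis
        by (simp add: comp_def case_prod_unfold)
    qed
    then show ?thesis
      by (simp add: s3_coords_def arr_mult_arr_of cong: arr_of_cong)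
  qed
  have "x - y \<in> carrier (free_burnside S3)"
    using x y keys_diff[of x y] by (auto simp: free_burnside_simps)
  from formal_marks_zero_iff[OF this]
  show "s3_coords x = s3_coords y \<longleftrightarrow> x - y \<in> relation_module S3"
    by (simp add: s3_coords_def arr_of_eq_iff formal_mark_diff)
qed

text \<open>The stabilizer of each of the six points of the regular biset is the graph of an inner
  automorphism, of type (6, 1, 6, 1). The marks are therefore 6 / 216 = 1 / 36 of the row of the
  diagonal subgroup, which has 36 exactly at the positions of the unit array.\<close>

lemma coords_one: "s3_coords \<one>\<^bsub>free_burnside S3\<^esub> = arr_one"
proof -
  have "formal_mark S3 (s3_mark k) \<one>\<^bsub>free_burnside S3\<^esub> = of_int (mark_row (6, 1, 6, 1) ! k) / 36" for k
  proof -
    have "s3_mark k (biset_stab S3 (regular_biset S3) p) = of_int (mark_row (6, 1, 6, 1) ! k) / 216"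
      if p: "p \<in> carrier S3" for p
    proof -
      obtain x where x: "p = s3_perm x" using p unfolding carrier_S3 by (elim rangeE)
      have "s3_perm_pair -` biset_stab S3 (regular_biset S3) p = {(g, h). s3_mult g x = s3_mult x h}"
        by (auto simp: biset_stab_def regular_biset_def carrier_S3 x sym_group_mult inj_eq[OF inj_s3_perm]
            simp flip: s3_perm_mult)
      also have "s3_type \<dots> = s3_type (set (filter (\<lambda>(g, h). s3_mult g x = s3_mult x h) (List.product s3_all s3_all)))"
        by (rule arg_cong[of _ _ s3_type]) (auto simp: set_s3_all)
      also have "\<dots> = (6, 1, 6, 1)"
        unfolding list_type_eq[symmetric] by (cases x) (simp_all only:, code_simp+)
      finally show ?thesis
        by (simp add: s3_mark_def int_mark_def)
    qed
    then have "biset_mark S3 (s3_mark k) (regular_biset S3) =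
        (\<Sum>p\<in>carrier S3. of_int (mark_row (6, 1, 6, 1) ! k) / 216)"
      unfolding biset_mark_def by (intro sum.cong) (simp_all add: regular_biset_def)
    then show ?thesis
      by (simp add: free_burnside_simps(5) formal_mark_single[OF coords.regular] card_S3)
  qed
  then have "s3_coords \<one>\<^bsub>free_burnside S3\<^esub> = arr_of (\<lambda>k. of_int (mark_row (6, 1, 6, 1) ! k) / 36)"
    by (simp only: s3_coords_def)
  also have "\<dots> = arr_one"
    by (simp add: arr_one_eq arr_of_eq_iff all_less_22 upt_0_22 mark_row_def mark_table_def)
  finally show ?thesis .
qed

section \<open>The isomorphism\<close>

lemma B_S3_eq: "B_S3 = double_burnside S3"
  by (simp add: B_S3_def)

lemma represents_basis: "t < 22 \<Longrightarrow>
  coords.represents (burnside_class S3 (coset_biset S3 (rep_subgroup t))) (arr_of (basis_row t))"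
  using coords.represents_burnside_class[OF rep_biset_finite, of t]
  by (simp add: s3_coords_def formal_mark_basis_elem[unfolded basis_elem_def])

lemma represents_lincomb_arr_of:
  assumes "list_all2 (\<lambda>(c, C) (d, v). c = d \<and> coords.represents C (arr_of v)) xs ys"
  shows "coords.represents (lincomb B_S3 xs) (arr_of (\<lambda>k. \<Sum>(c, v)\<leftarrow>ys. c * v k))"
proof -
  have "list_all2 (\<lambda>(c, C) (d, a). c = d \<and> coords.represents C a) xs (map (\<lambda>(c, v). (c, arr_of v)) ys)"
    using assms by (simp add: list.rel_map case_prod_unfold)
  from coords.represents_lincomb[OF this] show ?thesis
    by (simp add: B_S3_eq lincomb_arr_of)
qed

section \<open>Identification of the subgroups in the statement with the representatives\<close>

lemma generate_s3_perm_subset: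
  assumes "gs \<subseteq> A" "R0 \<in> A" "\<And>x y. x \<in> A \<Longrightarrow> y \<in> A \<Longrightarrow> s3_mult x y \<in> A" "\<And>x. x \<in> A \<Longrightarrow> s3_inv x \<in> A"
  shows "generate S3 (s3_perm ` gs) \<subseteq> s3_perm ` A"
proof
  fix g assume "g \<in> generate S3 (s3_perm ` gs)"
  then show "g \<in> s3_perm ` A"
  proof induction
    case one
    show ?case using assms(2) by (force simp: sym_group_one)
  next
    case (incl h)
    then show ?case using assms(1) by blast
  next
    case (inv h)
    then show ?case using assms(1,4) by (auto simp: s3_perm_inv)
  next
    case (eng g h)
    then obtain x y where "x \<in> A" "g = s3_perm x" "y \<in> A" "h = s3_perm y" by blast
    then show ?case
      using assms(3) by (auto simp: sym_group_mult s3_perm_mult[symmetric] simp del: comp_apply)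
  qed
qed

lemma V_eq:
  "V 0 = s3_perm ` {R0}" "V (Suc 0) = s3_perm ` {R0, T0}" "V 4 = s3_perm ` {R0, R1, R2}" "V 5 = s3_perm ` UNIV"
proof -
  show "V 0 = s3_perm ` {R0}" by (simp add: V_def)
  have "generate S3 (s3_perm ` {T0}) = s3_perm ` {R0, T0}"
  proof
    show "generate S3 (s3_perm ` {T0}) \<subseteq> s3_perm ` {R0, T0}"
      by (rule generate_s3_perm_subset) auto
    show "s3_perm ` {R0, T0} \<subseteq> generate S3 (s3_perm ` {T0})"
      using generate.one[of S3] by (auto simp: sym_group_one intro: generate.incl)
  qed
  then show "V (Suc 0) = s3_perm ` {R0, T0}" by (simp add: V_def)
  have "generate S3 (s3_perm ` {R1}) = s3_perm ` {R0, R1, R2}"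
  proof
    show "generate S3 (s3_perm ` {R1}) \<subseteq> s3_perm ` {R0, R1, R2}"
      by (rule generate_s3_perm_subset) auto
    have "b_S3 \<in> generate S3 {b_S3}" by (simp add: generate.incl)
    then have "b_S3 \<circ> b_S3 \<in> generate S3 {b_S3}"
      using generate.eng[of b_S3 S3 "{b_S3}" b_S3] by (simp add: sym_group_mult)
    then show "s3_perm ` {R0, R1, R2} \<subseteq> generate S3 (s3_perm ` {R1})"
      using generate.one[of S3 "{b_S3}"] by (auto simp: sym_group_one intro: generate.incl)
  qed
  then show "V 4 = s3_perm ` {R0, R1, R2}" by (simp add: V_def)
  show "V 5 = s3_perm ` UNIV" by (simp add: V_def carrier_S3)
qed

lemma s3_perm_Times: "s3_perm ` A \<times> s3_perm ` B = s3_perm_pair ` (A \<times> B)"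
  by auto

lemma s3_perm_diag: "{(x, x) |x. x \<in> s3_perm ` A} = s3_perm_pair ` (\<lambda>x. (x, x)) ` A"
  by auto

lemma UNIV_s3: "UNIV = {R0, R1, R2, T0, T1, T2}"
  using set_s3_all by (simp add: s3_all_def)

lemma V_Times_rep:
  "V 0 \<times> V 0 = rep_subgroup 0" "V 0 \<times> V (Suc 0) = rep_subgroup 1"
  "V 0 \<times> V 4 = rep_subgroup 2" "V 0 \<times> V 5 = rep_subgroup 3"
  "V (Suc 0) \<times> V 0 = rep_subgroup 4" "V (Suc 0) \<times> V (Suc 0) = rep_subgroup 5"
  "V (Suc 0) \<times> V 4 = rep_subgroup 6" "V (Suc 0) \<times> V 5 = rep_subgroup 7"
  "V 4 \<times> V 0 = rep_subgroup 8" "V 4 \<times> V (Suc 0) = rep_subgroup 9"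
  "V 4 \<times> V 4 = rep_subgroup 10" "V 4 \<times> V 5 = rep_subgroup 11"
  "V 5 \<times> V 0 = rep_subgroup 12" "V 5 \<times> V (Suc 0) = rep_subgroup 13"
  "V 5 \<times> V 4 = rep_subgroup 14" "V 5 \<times> V 5 = rep_subgroup 15"
  unfolding V_eq s3_perm_Times rep_subgroup_def UNIV_s3
  by (rule arg_cong[of _ _ "image s3_perm_pair"], code_simp)+

lemma V_diag_rep:
  "{(x, x) |x. x \<in> V (Suc 0)} = rep_subgroup 16" "{(x, x) |x. x \<in> V 4} = rep_subgroup 17"
  "{(x, x) |x. x \<in> V 5} = rep_subgroup 18"
  unfolding V_eq s3_perm_diag rep_subgroup_def UNIV_s3
  by (rule arg_cong[of _ _ "image s3_perm_pair"], code_simp)+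

text \<open>For the harder inclusion, the preimage of the generated subgroup is a closed set
  containing the generators, so \<open>elts_subset\<close> puts all listed elements into it.\<close>

lemma generate_gens:
  assumes "i < 22" "set (gens i) \<subseteq> set (elts i)"
  shows "generate (S3 \<times>\<times> S3) (s3_perm_pair ` set (gens i)) = rep_subgroup i"
proof -
  interpret GG: group "S3 \<times>\<times> S3" by (rule S3.pair_group)
  have sub: "s3_perm_pair ` set (gens i) \<subseteq> rep_subgroup i"
    using assms(2) by (auto simp: rep_subgroup_def)
  show ?thesis
  proof
    show "generate (S3 \<times>\<times> S3) (s3_perm_pair ` set (gens i)) \<subseteq> rep_subgroup i"
      by (rule GG.generate_subgroup_incl[OF sub rep_subgroup[OF assms(1)]])
    have "subgroup (generate (S3 \<times>\<times> S3) (s3_perm_pair ` set (gens i))) (S3 \<times>\<times> S3)"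
      by (rule GG.generate_is_subgroup) (use carrier_S3_pair in blast)
    note closed = closed_pairs_vimage(1)[OF this]
    have "set (elts i) \<subseteq> s3_perm_pair -` generate (S3 \<times>\<times> S3) (s3_perm_pair ` set (gens i))"
      by (rule elts_subset[OF closed _ assms(1)]) (auto intro: generate.incl)
    then show "rep_subgroup i \<subseteq> generate (S3 \<times>\<times> S3) (s3_perm_pair ` set (gens i))"
      by (auto simp: rep_subgroup_def)
  qed
qed

lemma U_rep: "U 6 = rep_subgroup 19" "U 7 = rep_subgroup 20" "U 8 = rep_subgroup 21"
  using generate_gens[of 19] generate_gens[of 20] generate_gens[of 21]
  by (simp_all add: U_def gens_def elts_def rep_table_def)

lemma represents_H:
  "coords.represents (H 0 0) (arr_of (basis_row 0))" "coords.represents (H 0 (Suc 0)) (arr_of (basis_row 1))"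
  "coords.represents (H 0 4) (arr_of (basis_row 2))" "coords.represents (H 0 5) (arr_of (basis_row 3))"
  "coords.represents (H (Suc 0) 0) (arr_of (basis_row 4))" "coords.represents (H (Suc 0) (Suc 0)) (arr_of (basis_row 5))"
  "coords.represents (H (Suc 0) 4) (arr_of (basis_row 6))" "coords.represents (H (Suc 0) 5) (arr_of (basis_row 7))"
  "coords.represents (H 4 0) (arr_of (basis_row 8))" "coords.represents (H 4 (Suc 0)) (arr_of (basis_row 9))"
  "coords.represents (H 4 4) (arr_of (basis_row 10))" "coords.represents (H 4 5) (arr_of (basis_row 11))"
  "coords.represents (H 5 0) (arr_of (basis_row 12))" "coords.represents (H 5 (Suc 0)) (arr_of (basis_row 13))"
  "coords.represents (H 5 4) (arr_of (basis_row 14))" "coords.represents (H 5 5) (arr_of (basis_row 15))"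
  "coords.represents (Hdiag (Suc 0)) (arr_of (basis_row 16))" "coords.represents (Hdiag 4) (arr_of (basis_row 17))"
  "coords.represents (Hdiag 5) (arr_of (basis_row 18))" "coords.represents (HU 6) (arr_of (basis_row 19))"
  "coords.represents (HU 7) (arr_of (basis_row 20))" "coords.represents (HU 8) (arr_of (basis_row 21))"
  unfolding H_def Hdiag_def HU_def V_Times_rep V_diag_rep U_rep
  by (rule represents_basis; simp)+

section \<open>Coordinates of the basis elements that define the isomorphism\<close>

definition unit_vec :: "nat \<Rightarrow> nat \<Rightarrow> rat"
  where "unit_vec i k = (if k = i then 1 else 0)"

text \<open>Used for each element of the statement in turn: replacing every transitive biset by its
  row must give a unit vector. This is the check that the rows invert the base change.\<close>

lemma represents_lincomb_unit:
  assumes "list_all2 (\<lambda>(c, C) (d, v). c = d \<and> coords.represents C (arr_of v)) xs ys"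
    and "list_all (\<lambda>k. (\<Sum>(c, v)\<leftarrow>ys. c * v k) = unit_vec i k) [0..<22]"
  shows "coords.represents (lincomb B_S3 xs) (arr_of (unit_vec i))"
  using represents_lincomb_arr_of[OF assms(1)] assms(2)
  by (simp add: list_all_iff cong: arr_of_cong)

lemmas basis_row_simps = basis_row_def nth_mark_table length_elts[unfolded One_nat_def]

lemmas represents_H_simps = represents_H[unfolded One_nat_def]

lemma represents_eps2: "coords.represents eps2 (arr_of (unit_vec 12))"
  unfolding eps2_def
  by (rule represents_lincomb_unit[where ys = "[(-1, basis_row 0), (1, basis_row 4), (1, basis_row 1), (1, basis_row 16),
      (-2, basis_row 5)]"])
    (simp_all add: represents_H_simps upt_0_22 unit_vec_def basis_row_simps)

lemma represents_eps3: "coords.represents eps3 (arr_of (unit_vec 14))"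
  unfolding eps3_def
  by (rule represents_lincomb_unit[where ys = "[(-1/4, basis_row 0), (1/4, basis_row 8), (1/4, basis_row 2), (1/2, basis_row 17),
      (-3/4, basis_row 10)]"])
    (simp_all add: represents_H_simps upt_0_22 unit_vec_def basis_row_simps)

lemma represents_eps4: "coords.represents eps4 (arr_of (unit_vec 19))"
  unfolding eps4_def
  by (rule represents_lincomb_unit[where ys = "[(1/2, basis_row 0), (-1, basis_row 16), (-1/2, basis_row 17), (1, basis_row 18)]"])
    (simp_all add: represents_H_simps upt_0_22 unit_vec_def basis_row_simps)

lemma represents_b_eps2_eps4: "coords.represents b_eps2_eps4 (arr_of (unit_vec 13))"
  unfolding b_eps2_eps4_def
  by (rule represents_lincomb_unit[where ys = "[(-1/2, basis_row 0), (1/2, basis_row 4), (1/2, basis_row 1), (1/2, basis_row 16),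
      (1/2, basis_row 2), (-1, basis_row 5), (-1/2, basis_row 3), (-1/2, basis_row 19),
      (-1/2, basis_row 6), (1, basis_row 7)]"])
    (simp_all add: represents_H_simps upt_0_22 unit_vec_def basis_row_simps)

lemma represents_b_eps4_eps2: "coords.represents b_eps4_eps2 (arr_of (unit_vec 18))"
  unfolding b_eps4_eps2_def
  by (rule represents_lincomb_unit[where ys = "[(-1/2, basis_row 0), (1/2, basis_row 4), (1/2, basis_row 1), (1/2, basis_row 16),
      (1/2, basis_row 8), (-1, basis_row 5), (-1/2, basis_row 12), (-1/2, basis_row 9),
      (-1/2, basis_row 20), (1, basis_row 13)]"])
    (simp_all add: represents_H_simps upt_0_22 unit_vec_def basis_row_simps)

lemma represents_b''_eps4_eps4: "coords.represents b''_eps4_eps4 (arr_of (unit_vec 21))"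
  unfolding b''_eps4_eps4_def
  by (rule represents_lincomb_unit[where ys = "[(1/4, basis_row 0), (-3/4, basis_row 4), (-3/4, basis_row 1), (1/4, basis_row 16),
      (-1/4, basis_row 8), (-1/4, basis_row 2), (3/2, basis_row 5), (3/4, basis_row 12),
      (3/4, basis_row 3), (-1/4, basis_row 19), (3/4, basis_row 9), (3/4, basis_row 6),
      (-1/4, basis_row 20), (1/4, basis_row 10), (-3/2, basis_row 7), (-3/2, basis_row 13),
      (-3/4, basis_row 11), (-3/4, basis_row 14), (1/4, basis_row 21), (3/2, basis_row 15)]"])
    (simp_all add: represents_H_simps upt_0_22 unit_vec_def basis_row_simps)

lemma represents_T:
  "coords.represents (T [x0, x1, x4, x5] [y0, y1, y4, y5])
    (arr_of (\<lambda>k. \<Sum>(c, v)\<leftarrow>[(x0 * y0, basis_row 0), (x0 * y1, basis_row 1), (x0 * y4, basis_row 2),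
      (x0 * y5, basis_row 3), (x1 * y0, basis_row 4), (x1 * y1, basis_row 5),
      (x1 * y4, basis_row 6), (x1 * y5, basis_row 7), (x4 * y0, basis_row 8),
      (x4 * y1, basis_row 9), (x4 * y4, basis_row 10), (x4 * y5, basis_row 11),
      (x5 * y0, basis_row 12), (x5 * y1, basis_row 13), (x5 * y4, basis_row 14),
      (x5 * y5, basis_row 15)]. c * v k))"
  unfolding T_def by (rule represents_lincomb_arr_of) (simp add: represents_H_simps)

text \<open>The position of the array unit that is mapped to \<open>bT p q\<close>: the block
  \<open>A11\<close> by rows, the column \<open>A14\<close>, the row \<open>A41\<close>, and at 20
  the coefficient of eta.\<close>

fun bT_index :: "label \<Rightarrow> label \<Rightarrow> nat" where
  "bT_index lab_e q = (case q of lab_e \<Rightarrow> 0 | lab_g \<Rightarrow> 1 | lab_h \<Rightarrow> 2 | lab_4 \<Rightarrow> 9)"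
| "bT_index lab_g q = (case q of lab_e \<Rightarrow> 3 | lab_g \<Rightarrow> 4 | lab_h \<Rightarrow> 5 | lab_4 \<Rightarrow> 10)"
| "bT_index lab_h q = (case q of lab_e \<Rightarrow> 6 | lab_g \<Rightarrow> 7 | lab_h \<Rightarrow> 8 | lab_4 \<Rightarrow> 11)"
| "bT_index lab_4 q = (case q of lab_e \<Rightarrow> 15 | lab_g \<Rightarrow> 16 | lab_h \<Rightarrow> 17 | lab_4 \<Rightarrow> 20)"

lemma represents_arr_of_unit:
  assumes "coords.represents C (arr_of v)" "list_all (\<lambda>k. v k = unit_vec i k) [0..<22]"
  shows "coords.represents C (arr_of (unit_vec i))"
  using assms by (simp add: list_all_iff cong: arr_of_cong)

lemma represents_bT: "coords.represents (bT p q) (arr_of (unit_vec (bT_index p q)))"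
proof (cases p; cases q)
qed (simp_all only: bT_def l_vec.simps f_vec.simps bT_index.simps label.case,
    (rule represents_arr_of_unit[OF represents_T],
     simp add: upt_0_22 unit_vec_def basis_row_simps)+)

lemma represents_gamma_11: "coords.represents (gamma_11 r)
    (arr_of (\<lambda>k. \<Sum>(c, v)\<leftarrow>[
      (r $ 1 $ 1, unit_vec (bT_index lab_e lab_e)), (r $ 1 $ 2, unit_vec (bT_index lab_e lab_g)),
      (r $ 1 $ 3, unit_vec (bT_index lab_e lab_h)), (r $ 2 $ 1, unit_vec (bT_index lab_g lab_e)),
      (r $ 2 $ 2, unit_vec (bT_index lab_g lab_g)), (r $ 2 $ 3, unit_vec (bT_index lab_g lab_h)),
      (r $ 3 $ 1, unit_vec (bT_index lab_h lab_e)), (r $ 3 $ 2, unit_vec (bT_index lab_h lab_g)),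
      (r $ 3 $ 3, unit_vec (bT_index lab_h lab_h))]. c * v k))"
  unfolding gamma_11_def
  by (rule represents_lincomb_arr_of) (simp add: represents_bT del: bT_index.simps)

lemma represents_gamma_14: "coords.represents (gamma_14 u)
    (arr_of (\<lambda>k. \<Sum>(c, v)\<leftarrow>[
      (u $ 1 $ 1, unit_vec (bT_index lab_e lab_4)), (u $ 2 $ 1, unit_vec (bT_index lab_g lab_4)),
      (u $ 3 $ 1, unit_vec (bT_index lab_h lab_4))]. c * v k))"
  unfolding gamma_14_def
  by (rule represents_lincomb_arr_of) (simp add: represents_bT del: bT_index.simps)

lemma represents_gamma_41: "coords.represents (gamma_41 u)
    (arr_of (\<lambda>k. \<Sum>(c, v)\<leftarrow>[
      (u $ 1 $ 1, unit_vec (bT_index lab_4 lab_e)), (u $ 1 $ 2, unit_vec (bT_index lab_4 lab_g)),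
      (u $ 1 $ 3, unit_vec (bT_index lab_4 lab_h))]. c * v k))"
  unfolding gamma_41_def
  by (rule represents_lincomb_arr_of) (simp add: represents_bT del: bT_index.simps)

lemma represents_gamma_44: "coords.represents (gamma_44 z)
    (arr_of (\<lambda>k. \<Sum>(c, v)\<leftarrow>[
      (coeff_one z, unit_vec 19), (coeff_eta z, unit_vec (bT_index lab_4 lab_4)),
      (coeff_xi z, unit_vec 21)]. c * v k))"
  unfolding gamma_44_def
  by (rule represents_lincomb_arr_of)
    (simp add: represents_bT represents_eps4 represents_b''_eps4_eps4 del: bT_index.simps)

lemma represents_smult_unit:
  assumes "coords.represents C (arr_of v)"
  shows "coords.represents (u \<odot>\<^bsub>B_S3\<^esub> C) (arr_of (\<lambda>k. u * v k))"
  using coords.represents_smult[OF assms, of u] by (simp add: B_S3_eq arr_scale_arr_of)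

lemma represents_add_arr_of:
  assumes "coords.represents C (arr_of v)" "coords.represents D (arr_of w)"
  shows "coords.represents (C \<oplus>\<^bsub>B_S3\<^esub> D) (arr_of (\<lambda>k. v k + w k))"
  using coords.represents_add[OF assms] by (simp add: B_S3_eq arr_add_arr_of)

lemma represents_arr_coords:
  assumes "coords.represents C (arr_of v)" "list_all (\<lambda>k. v k = arr_coords x ! k) [0..<22]"
  shows "coords.represents C x"
  using assms arr_of_cong[of v "\<lambda>k. arr_coords x ! k"] arr_of_coords[of x] by (simp add: list_all_iff)

text \<open>The coordinates of \<open>gamma x\<close> are x itself, so the coordinate map is a left
  inverse of \<open>gamma\<close>. Since it is injective on the quotient,
  \<open>represents_iso\<close> turns this into an isomorphism.\<close>

lemma represents_gamma: "coords.represents (gamma x) x"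
  unfolding gamma_def gamma_22_def gamma_24_def gamma_33_def gamma_42_def
  by (rule represents_arr_coords,
      (rule represents_add_arr_of represents_gamma_11 represents_gamma_14 represents_gamma_41
        represents_gamma_44 represents_smult_unit represents_eps2 represents_b_eps2_eps4
        represents_eps3 represents_b_eps4_eps2)+,
      simp add: upt_0_22 unit_vec_def arr_coords_def)

theorem proposition5:
  shows "assoc_algebra rat_ring arr_algebra \<and> assoc_algebra rat_ring B_S3 \<and>
    gamma \<in> algebra_iso rat_ring arr_algebra B_S3"
  using coords.represents_iso[OF represents_gamma _ _ assoc_algebra_arr] assoc_algebra_arr coords_one
  by (simp add: B_S3_eq)

end
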